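(* A Heun equation $$\frac{d^2y}{dx^2}+\Bigl(\frac{c}{x}+\frac{d}{x-1}+\frac{a+b-c-d+1}{x-t}\Bigr)\frac{dy}{dx}+\frac{abx-q}{x(x-1)(x-t)}\,y=0 ,\qquad t\in\mathbb{C}\setminus\{0,1\},$$ is (a specialization of) a parametric pull-back transformation of a hypergeometric equation if it satisfies one of the following conditions (where $j=j(t)$, and $Q_0,Q_1,k_1,k_2$ are the quantities defined in the context; exponent differences are matched in some order and up to multiplication by $-1$, with $\alpha,\beta,\gamma\in\mathbb{C}$). (i) $j=1728$, the equation is $HE(\alpha,\alpha,\beta,\gamma)$ (at least two exponent differences equal up to sign), $Q_0=0$, and $k_1=3(\alpha^2-\beta^2)(\alpha^2-\gamma^2)$. (ii) $j=0$, at least three exponent differences are equal up to sign, and $Q_0=0$. (iii) $j=35152/9$, the equation is $HE(1/2,\alpha,2\alpha,\beta)$, and $Q_1=\frac{5\cdot7\cdot13}{2^5\,3^2}(4\alpha^2+8\beta^2-3)$, $k_1=-13\,(\alpha^4-\frac54\alpha^2\beta^2+\frac1{16}\beta^2)$, $k_2=\frac{36}{13}\alpha^4+5\alpha^2\beta^2+\frac5{13}\alpha^2+\frac9{52}\beta^2$. (iv) $j=1556068/81$, and either the equation is $HE(\alpha,2\alpha,\beta,2\beta)$ with $Q_1=\frac{5\cdot7\cdot17\cdot73}{2^5\,3^4}(23\alpha^2+23\beta^2-4)$, $k_1=\frac{73}2(\alpha^4-4\alpha^2\beta^2+\beta^4)$, $k_2=\frac{324}{73}(\alpha^4+\frac{274}{81}\alpha^2\beta^2+\beta^4)$;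 or the equation is $HE(\alpha,3\alpha,\beta,3\beta)$ with $Q_1=\frac{5\cdot7\cdot17\cdot73}{2^4\,3^4}(23\alpha^2+23\beta^2-2)$, $k_1=-73(\alpha^4-10\alpha^2\beta^2+\beta^4)$, $k_2=\frac{576}{73}(\alpha^4+\frac{185}{16}\alpha^2\beta^2+\beta^4)$. (v) For one of the following entries, $j$ and the exponent differences are as listed, and the listed invariants hold with the same $\alpha$: P25: $j=\frac{2^4\cdot3^3\cdot7^3}{5^2}$; $(\frac12,\frac23,2\alpha,3\alpha)$; $Q_1=\frac{3^5\cdot7}{2^5\,5^2}(72\alpha^2-1)$, $k_1=\frac73(81\alpha^4-\frac{173}{16}\alpha^2+\frac14)$, $k_2=\frac{100}{189}(81\alpha^4+\frac{121}{16}\alpha^2+\frac14)$. P26: $j=\frac{13^3\cdot37^3}{3^4\cdot5^4}$; $(\frac13,\frac23,\alpha,5\alpha)$; $Q_1=\frac{7\cdot13\cdot17\cdot37\cdot41}{2^7\,3^6\,5^4}(1881\alpha^2-28)$, $k_1=-\frac{481}{400}(25\alpha^4-\frac{229}9\alpha^2+\frac4{81})$, $k_2=\frac{81}{481}(25\alpha^4+\frac{70549}{729}\alpha^2+\frac4{81})$. P27: $j=\frac{6481^3}{3^8\cdot5^2}$; $(\frac12,\frac14,2\alpha,3\alpha)$; $Q_1=\frac{7^2\cdot23\cdot41\cdot79\cdot6481}{2^{11}\,3^8\,5^2}(1696\alpha^2-83)$, $k_1=-\frac{6481}{81}(36\alpha^4-\frac{643}{256}\alpha^2+\frac1{64})$,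 $k_2=\frac{6400}{6481}(36\alpha^4+\frac{52493}{20480}\alpha^2+\frac1{64})$. P28: $j=\frac{6481^3}{3^8\cdot5^2}$; $(\frac13,\alpha,4\alpha,5\alpha)$; $Q_1=\frac{7\cdot23\cdot41\cdot79\cdot6481}{2^7\,3^{10}\,5^2}(22977\alpha^2-440)$, $k_1=\frac{6481}{144}\alpha^2(691\alpha^2-\frac{43}9)$, $k_2=\frac1{6481}\alpha^2(2726825\alpha^2+\frac{166577}9)$. P29: $j=\frac{2^6\cdot7^3\cdot97^3}{3^6\cdot5^4}$; $(\frac23,\alpha,2\alpha,5\alpha)$; $Q_1=\frac{2^2\cdot7\cdot13\cdot23\cdot29\cdot97}{3^8\,5^4}(1215\alpha^2-16)$, $k_1=\frac{679}9\alpha^2(17\alpha^2-\frac{404}{225})$, $k_2=\frac{20}{679}\alpha^2(3775\alpha^2+\frac{3274}9)$. P30: $j=\frac{2^4\cdot757^3}{3^6\cdot7^2}$; $(\frac12,\frac13,3\alpha,4\alpha)$; $Q_1=\frac{5^2\cdot11\cdot13\cdot29\cdot757}{2^5\,3^8\,7^2}(2952\alpha^2-71)$, $k_1=\frac{757}{27}(144\alpha^4-\frac{715}{144}\alpha^2+\frac1{36})$, $k_2=\frac{784}{757}(144\alpha^4+\frac{131365}{28224}\alpha^2+\frac1{36})$. P31: $j=\frac{7^3\cdot127^3}{2^2\cdot3^6\cdot5^2}$; $(\frac12,\frac23,\alpha,4\alpha)$; $Q_1=\frac{7\cdot11\cdot37\cdot59\cdot127}{2^{11}\,3^8\,5^2}(14004\alpha^2-323)$,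 $k_1=-\frac{889}{216}(4\alpha^4-\frac{52}9\alpha^2+\frac1{36})$, $k_2=\frac{100}{889}(4\alpha^4+\frac{970}9\alpha^2+\frac1{36})$. P32: $j=\frac{7^3\cdot127^3}{2^2\cdot3^6\cdot5^2}$; $(\frac13,2\alpha,3\alpha,5\alpha)$; $Q_1=\frac{7\cdot11\cdot37\cdot59\cdot127}{2^9\,3^8\,5^2}(4014\alpha^2-95)$, $k_1=889\,\alpha^2(\alpha^2-\frac1{162})$, $k_2=\frac{36}{889}\alpha^2(8450\alpha^2+\frac{5641}{162})$. P33: $j=\frac{7^3\cdot2287^3}{2^6\cdot3^2\cdot5^6}$; $(\frac12,\alpha,3\alpha,5\alpha)$; $Q_1=\frac{7\cdot11\cdot23\cdot61\cdot131\cdot2287}{2^{15}\,3^2\,5^6}(12580\alpha^2-237)$, $k_1=\frac{16009}{40}\alpha^2(23\alpha^2-\frac{63}{100})$, $k_2=\frac{250}{16009}\alpha^2(15309\alpha^2+\frac{40709}{100})$. P34: $j=\frac{7^3\cdot2287^3}{2^6\cdot3^2\cdot5^6}$; $(\frac15,\alpha,2\alpha,3\alpha)$; $Q_1=\frac{7\cdot11\cdot23\cdot61\cdot131\cdot2287}{2^{13}\,3^2\,5^8}(31450\alpha^2-1953)$, $k_1=-\frac{16009}{100}\alpha^2(7\alpha^2-\frac3{100})$, $k_2=\frac8{16009}\alpha^2(88749\alpha^2+\frac{40621}{100})$. P35: $j=\frac{4993^3}{2^2\cdot3^8\cdot7^4}$; $(\frac13,\alpha,2\alpha,7\alpha)$;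 $Q_1=\frac{5\cdot13\cdot17\cdot113\cdot4993}{2^9\,3^{10}\,7^4}(8262\alpha^2-67)$, $k_1=\frac{4993}9\alpha^2(\alpha^2-\frac{17}{882})$, $k_2=\frac2{4993}\alpha^2(672868\alpha^2+\frac{64153}9)$. P36: $j=\frac{19^3\cdot1459^3}{2^4\cdot3^6\cdot5^6\cdot7^2}$; $(\frac12,\frac13,2\alpha,5\alpha)$; $Q_1=\frac{11\cdot19\cdot23\cdot61\cdot157\cdot1459}{2^{13}\,3^8\,5^6\,7^2}(50184\alpha^2-635)$, $k_1=\frac{27721}{8000}(100\alpha^4-\frac{1849}{324}\alpha^2+\frac1{36})$, $k_2=\frac{35721}{27721}(100\alpha^4+\frac{4322681}{1285956}\alpha^2+\frac1{36})$. P37: $j=2^3\cdot3^3\cdot11^3$; $(\frac12,\frac12,\alpha,\alpha)$; $Q_1=\frac{3^5\cdot7\cdot11}{2^5}(4\alpha^2-1)$, $k_1=-33(\alpha^2-\frac14)^2$. P38: $j=2^4\cdot3^3\cdot5^3$; $(\frac12,\frac12,\alpha,\alpha)$; $Q_1=\frac{3^3\cdot5\cdot11}{2^4}(4\alpha^2-1)$, $k_1=15(\alpha^2-\frac14)^2$. P39: $j=\frac{2^2\cdot193^3}{3}$; $(\frac14,\frac14,\alpha,\alpha)$; $Q_1=\frac{7\cdot193\cdot383}{2^8\cdot3}(176\alpha^2-71)$, $k_1=-193(\alpha^2-\frac1{16})^2$. P40: $j=\frac{2^7\cdot53^3}{3^3}$; $(\frac13,\frac13,\alpha,\alpha)$;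 $Q_1=\frac{5\cdot53\cdot109}{3^5}(63\alpha^2-23)$, $k_1=53(\alpha^2-\frac19)^2$. P42: $j=2^4\cdot17^3$; $(\frac12,\alpha,2\alpha,2\alpha)$; $Q_1=\frac{3\cdot5\cdot17\cdot31}{2^5}(12\alpha^2-1)$, $k_1=-51\alpha^2(4\alpha^2-\frac14)$. P43: $j=\frac{2^{14}\cdot31^3}{5^3}$; $(\alpha,\alpha,5\alpha,5\alpha)$; $Q_1=\frac{2^5\cdot11\cdot31\cdot251}{5^3}(58\alpha^2-1)$, $k_1=71424\alpha^4$. P44: $j=\frac{2^2\cdot3^3\cdot13^3}{5^4}$; $(\frac14,\frac14,\alpha,5\alpha)$; $Q_1=\frac{3^5\cdot13\cdot17}{2^8\,5^4}(1-16\alpha^2)$, $k_1=39(\alpha^2-\frac1{16})(\alpha^2-\frac1{400})$. P45: $j=-\frac{2^4\cdot109^3}{5^6}$; $(\frac12,\frac12,\alpha,5\alpha)$; $Q_1=\frac{11\cdot109\cdot157}{2^4\,5^6}(5-356\alpha^2)$, $k_1=-\frac{109}5(\alpha^2-\frac14)(\alpha^2-\frac1{100})$. P46: $j=-\frac{2^4\cdot109^3}{5^6}$; $(\frac15,\alpha,\alpha,4\alpha)$; $Q_1=\frac{3^2\cdot11\cdot109\cdot157}{2^2\,5^8}(4-75\alpha^2)$, $k_1=\frac{327}{25}\alpha^2(\alpha^2-\frac1{25})$. P47: $j=-\frac{2^5\cdot19^3}{3^6}$; $(\frac12,\frac12,\frac13,\alpha)$; $Q_1=\frac{5\cdot19\cdot43}{2^3\,3^8}(11-36\alpha^2)$,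 $k_1=\frac{95}{972}(\alpha^2-\frac14)$. P48: $j=\frac{2\cdot47^3}{3^8}$; $(\frac12,\frac12,\alpha,3\alpha)$; $Q_1=\frac{7\cdot47\cdot337}{2^7\,3^8}(44\alpha^2-1)$, $k_1=\frac{47}9(\alpha^2-\frac14)(\alpha^2-\frac1{36})$. P49: $j=\frac{2\cdot47^3}{3^8}$; $(\frac13,\alpha,\alpha,8\alpha)$; $Q_1=\frac{7\cdot47\cdot337}{2^5\,3^{10}}(2-513\alpha^2)$, $k_1=-\frac{329}9\alpha^2(\alpha^2-\frac19)$. P50: $j=-\frac{2^6\cdot239^3}{3^{10}}$; $(\frac13,\alpha,\alpha,2\alpha)$; $Q_1=\frac{2\cdot5\cdot11\cdot239\cdot251}{3^{12}}(4-27\alpha^2)$, $k_1=\frac{239}{81}\alpha^2(\alpha^2-\frac19)$. P56: $j=-\frac{2^{11}\cdot11^3}{3^3\cdot7^4}$; $(\frac13,\frac13,\alpha,7\alpha)$; $Q_1=\frac{2\cdot5\cdot11\cdot13\cdot103}{3^5\,7^4}(1-153\alpha^2)$, $k_1=-22(\alpha^2-\frac19)(\alpha^2-\frac1{441})$. P57: $j=\frac{5^3\cdot43^3}{2^6\cdot7^3}$; $(\frac12,\alpha,\alpha,7\alpha)$; $Q_1=\frac{3\cdot5\cdot11\cdot13\cdot37\cdot43}{2^{15}\,7^3}(1-244\alpha^2)$, $k_1=-\frac{645}8\alpha^2(\alpha^2-\frac14)$. P58: $j=-\frac{269^3}{2^{10}\cdot3^5}$; $(\frac12,\alpha,\alpha,3\alpha)$;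 $Q_1=\frac{5\cdot19\cdot269\cdot499}{2^{19}\,3^5}(68\alpha^2+3)$, $k_1=\frac{269}{64}\alpha^2(\alpha^2-\frac14)$. P59: $j=\frac{71^3}{2^4\cdot3^3\cdot5}$; $(\frac12,\frac13,\frac13,\alpha)$; $Q_1=\frac{11\cdot71\cdot167}{2^{13}\,3^5\cdot5}(17-72\alpha^2)$, $k_1=\frac{355}{2304}(\alpha^2-\frac19)$. (vi) One of the following two entries holds as listed, or with the numbers in $j$, $Q_1$, $k_1$, $k_2$ all conjugated by $i\mapsto-i$, $\omega\mapsto-\omega-1$ (with $\alpha$ unchanged): P60: $j=\frac{(1+i)^{12}(3-2i)^3}{(2-i)^2}$; $(\frac12,\frac14,\alpha,4\alpha)$; $Q_1=\frac{229-53i}{2\cdot5^2}\left(\frac{4-i}{16}-(10-7i)\alpha^2\right)$, $k_1=\frac{2+3i}2\left(16\alpha^4-\frac{28+9i}8\alpha^2+\frac1{64}\right)$, $k_2=\frac{17-6i}{13}\left(16\alpha^4+\frac{9+12i}5\alpha^2+\frac1{64}\right)$. P61: $j=-\omega\,2^4\frac{(1-2\omega)^3(7+6\omega)^3}{(1+2\omega)^6(3+2\omega)^2}$; $(\frac12,\frac13,\alpha,6\alpha)$; $Q_1=\frac{531-6130\omega}{2^3\,3^3\,(2-\omega)^2}\left(\frac{5-4\omega}{36}-(19-8\omega)\alpha^2\right)$, $k_1=\frac{11\omega-23}9\left(9\alpha^4+\frac{2-21\omega}{4+8\omega}\alpha^2+\frac1{144}\right)$, $k_2=\frac{12-20\o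mega}{15+19\omega}\left(9\alpha^4-\frac{157+34\omega}{10+16\omega}\alpha^2+\frac1{144}\right)$.
   Context: $\omega=\exp(2\pi i/3)$. The hypergeometric equation with parameters $A,B,C$ is $$\frac{d^2y}{dz^2}+\Bigl(\frac{C}{z}+\frac{A+B-C+1}{z-1}\Bigr)\frac{dy}{dz}+\frac{AB}{z(z-1)}y=0,$$ with local exponent differences $1-C$, $C-A-B$, $A-B$ at $z=0,1,\infty$. The Heun equation is a Fuchsian equation with regular singular points $x=0,1,t,\infty$ and exponent differences $$e_0=1-c,\quad e_1=1-d,\quad e_t=c+d-a-b,\quad e_\infty=b-a$$ at these points, respectively. $HE(\alpha,\beta,\gamma,\delta)$ denotes a Heun equation whose four exponent differences are, up to sign, $\alpha,\beta,\gamma,\delta$, assigned to the four singular points in any order. Quantities attached to a Heun equation: $$j=j(t)=\frac{256\,(t^2-t+1)^3}{t^2(t-1)^2},$$ $$k_1=\frac{t^2-t+1}{t(t-1)}\left((e_0^2-e_1^2)(e_t^2-e_\infty^2)\,t-(e_0^2-e_t^2)(e_1^2-e_\infty^2)\right),$$ $$k_2=\frac{(e_0^2e_t^2+e_1^2e_\infty^2)t^2-(e_0^2e_\infty^2+e_1^2e_t^2)t+e_0^2e_1^2+e_t^2e_\infty^2}{t^2-t+1}+e_0^2e_\infty^2+e_1^2e_t^2\quad(\text{if } j\ne0),$$ $$Q_0=12q-6(e_0-1)(e_1t+e_t)+\left(e_\infty^2-2(e_0-1)(e_0-2)\right)(t+1)-e_1^2(2t-1)+e_t^2(t-2),$$ $$J_1=\frac{(t+1)(t-2)(2t-1)(t^2-t+1)}{t^2(t-1)^2},\qquad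 Q_1=J_1Q_0.$$ A pull-back transformation of a Fuchsian equation in $z$ is a transformation $z\mapsto\varphi(x)$, $y(z)\mapsto Y(x)=\theta(x)\,y(\varphi(x))$, where $\varphi$ is a (nonconstant) rational function, and $\theta(x)$ is a radical function, i.e. a product of (complex) powers of rational functions. A parametric pull-back transformation from hypergeometric to Heun equations is a pull-back transformation with a fixed covering $z=\varphi(x)$ that applies to a family of hypergeometric equations having at least one free continuous parameter (at least one exponent difference is an unrestricted complex parameter) and pulls these hypergeometric equations back to a family of Heun equations (Fuchsian equations with four singular points). A specialization of it is obtained by giving particular values to the free parameters. *)

theory Defs
  imports "HOL-Analysis.Analysis" "HOL-Computational_Algebra.Polynomial"
begin

text \<open>
  The parameter triple \<open>(A, B, C)\<close> stands for the equation
  \<open>y'' + (C / z + (A + B - C + 1) / (z - 1)) y' + A B / (z (z - 1)) y = 0\<close>.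
\<close>

type_synonym hg_params = "complex \<times> complex \<times> complex"

text \<open>
  Given \<open>t\<close>, the parameter tuple \<open>(q, a, b, c, d)\<close> stands for the equation
  \<open>y'' + (c / x + d / (x - 1) + (a + b - c - d + 1) / (x - t)) y'
       + (a b x - q) / (x (x - 1) (x - t)) y = 0\<close>.
\<close>

type_synonym heun_params = "complex \<times> complex \<times> complex \<times> complex \<times> complex"


section \<open>Local holomorphic solutions\<close>

definition ode2_solution ::
  "(complex \<Rightarrow> complex) \<Rightarrow> (complex \<Rightarrow> complex) \<Rightarrow> complex set \<Rightarrow> (complex \<Rightarrow> complex) \<Rightarrow> bool" where
  "ode2_solution P Q U y \<longleftrightarrow> open U \<and> y holomorphic_on U \<and>
     (\<forall>x\<in>U. deriv (deriv y) x + P x * deriv y x + Q x * y x = 0)"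

fun hg_solution :: "hg_params \<Rightarrow> complex set \<Rightarrow> (complex \<Rightarrow> complex) \<Rightarrow> bool" where
  "hg_solution (A, B, C) V y \<longleftrightarrow> V \<inter> {0, 1} = {} \<and>
     ode2_solution (\<lambda>z. C / z + (A + B - C + 1) / (z - 1)) (\<lambda>z. A * B / (z * (z - 1))) V y"

fun heun_solution ::
  "complex \<Rightarrow> heun_params \<Rightarrow> complex set \<Rightarrow> (complex \<Rightarrow> complex) \<Rightarrow> bool" where
  "heun_solution t (q, a, b, c, d) U Y \<longleftrightarrow> U \<inter> {0, 1, t} = {} \<and>
     ode2_solution (\<lambda>x. c / x + d / (x - 1) + (a + b - c - d + 1) / (x - t))
       (\<lambda>x. (a * b * x - q) / (x * (x - 1) * (x - t))) U Y"


section \<open>Rational and radical functions\<close>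

text \<open>
  A rational function is a pair (numerator, denominator). Its value is only used away
  from the zeros of the denominator.
\<close>

type_synonym ratfun = "complex poly \<times> complex poly"

definition rf_wf :: "ratfun \<Rightarrow> bool" where
  "rf_wf f \<longleftrightarrow> snd f \<noteq> 0"

definition rf_domain :: "ratfun \<Rightarrow> complex set" where
  "rf_domain f = {x. poly (snd f) x \<noteq> 0}"

definition rf_eval :: "ratfun \<Rightarrow> complex \<Rightarrow> complex" where
  "rf_eval f x = poly (fst f) x / poly (snd f) x"

definition rf_nonconstant :: "ratfun \<Rightarrow> bool" where
  "rf_nonconstant f \<longleftrightarrow> (\<nexists>k. fst f = smult k (snd f))"

text \<open>
  The list \<open>[(f\<^sub>1, r\<^sub>1), \<dots>, (f\<^sub>n, r\<^sub>n)]\<close> stands for the multivalued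
  product of the \<open>f\<^sub>i\<close> raised to the complex powers \<open>r\<^sub>i\<close>. Excluding \<open>f\<^sub>i = 0\<close>
  guarantees that branches exist locally away from finitely many points.
\<close>

type_synonym radical = "(ratfun \<times> complex) list"

definition radical_wf :: "radical \<Rightarrow> bool" where
  "radical_wf fs \<longleftrightarrow> (\<forall>(f, r) \<in> set fs. rf_wf f \<and> fst f \<noteq> 0)"

text \<open>
  A branch on \<open>U\<close> is obtained by choosing on \<open>U\<close> a holomorphic logarithm \<open>L\<^sub>i\<close> of every \<open>f\<^sub>i\<close>.
\<close>

definition radical_branch :: "radical \<Rightarrow> complex set \<Rightarrow> (complex \<Rightarrow> complex) \<Rightarrow> bool" where
  "radical_branch fs U \<theta> \<longleftrightarrow>
     (\<exists>L :: nat \<Rightarrow> complex \<Rightarrow> complex.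
        (\<forall>i<length fs. U \<subseteq> rf_domain (fst (fs ! i)) \<and> L i holomorphic_on U \<and>
           (\<forall>x\<in>U. exp (L i x) = rf_eval (fst (fs ! i)) x)) \<and>
        (\<forall>x\<in>U. \<theta> x = (\<Prod>i<length fs. exp (snd (fs ! i) * L i x))))"


section \<open>Pull-back transformations\<close>

definition pulls_back :: "ratfun \<Rightarrow> radical \<Rightarrow> hg_params \<Rightarrow> complex \<Rightarrow> heun_params \<Rightarrow> bool" where
  "pulls_back \<phi> fs p t h \<longleftrightarrow>
     (\<forall>U V y \<theta>. open U \<longrightarrow> U \<inter> {0, 1, t} = {} \<longrightarrow> U \<subseteq> rf_domain \<phi> \<longrightarrow> rf_eval \<phi> ` U \<subseteq> V \<longrightarrow>
        hg_solution p V y \<longrightarrow> radical_branch fs U \<theta> \<longrightarrow>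
        heun_solution t h U (\<lambda>x. \<theta> x * y (rf_eval \<phi> x)))"

definition is_pullback :: "ratfun \<Rightarrow> hg_params \<Rightarrow> complex \<Rightarrow> heun_params \<Rightarrow> bool" where
  "is_pullback \<phi> p t h \<longleftrightarrow>
     rf_wf \<phi> \<and> rf_nonconstant \<phi> \<and> (\<exists>fs. radical_wf fs \<and> pulls_back \<phi> fs p t h)"

datatype hg_sing = HG_Zero | HG_One | HG_Infinity

fun hg_exp_diff :: "hg_params \<Rightarrow> hg_sing \<Rightarrow> complex" where
  "hg_exp_diff (A, B, C) HG_Zero = 1 - C"
| "hg_exp_diff (A, B, C) HG_One = C - A - B"
| "hg_exp_diff (A, B, C) HG_Infinity = A - B"

text \<open>
  The exponent differences at the points of \<open>S\<close> are unrestricted complex parameters, those at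
  the other singular points are fixed to the values given by \<open>\<epsilon>\<close>.
\<close>

definition hg_family :: "hg_sing set \<Rightarrow> (hg_sing \<Rightarrow> complex) \<Rightarrow> hg_params set" where
  "hg_family S \<epsilon> = {p. \<forall>s. s \<notin> S \<longrightarrow> hg_exp_diff p s = \<epsilon> s}"

text \<open>
  The covering \<open>\<phi>\<close>, hence also \<open>t\<close>, is the same for the whole family, while the prefactor
  \<open>\<theta>\<close> may depend on the parameters.  The pulled-back equations \<open>H p\<close> depend continuously on
  the parameters \<open>p\<close>.
\<close>

definition parametric_pullback ::
  "ratfun \<Rightarrow> hg_sing set \<Rightarrow> (hg_sing \<Rightarrow> complex) \<Rightarrow> complex \<Rightarrow> (hg_params \<Rightarrow> heun_params) \<Rightarrow> bool" where
  "parametric_pullback \<phi> S \<epsilon> t H \<longleftrightarrow>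
     S \<noteq> {} \<and> continuous_on (hg_family S \<epsilon>) H \<and>
     (\<forall>p \<in> hg_family S \<epsilon>. is_pullback \<phi> p t (H p))"

definition specialization_of_parametric_pullback :: "complex \<Rightarrow> heun_params \<Rightarrow> bool" where
  "specialization_of_parametric_pullback t h \<longleftrightarrow>
     (\<exists>\<phi> S \<epsilon> H. parametric_pullback \<phi> S \<epsilon> t H \<and> (\<exists>p \<in> hg_family S \<epsilon>. h = H p))"


section \<open>Exponent differences and invariants of Heun equations\<close>

fun e_0 :: "heun_params \<Rightarrow> complex" where "e_0 (q, a, b, c, d) = 1 - c"
fun e_1 :: "heun_params \<Rightarrow> complex" where "e_1 (q, a, b, c, d) = 1 - d"
fun e_t :: "heun_params \<Rightarrow> complex" where "e_t (q, a, b, c, d) = c + d - a - b"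
fun e_inf :: "heun_params \<Rightarrow> complex" where "e_inf (q, a, b, c, d) = b - a"
fun accessory :: "heun_params \<Rightarrow> complex" where "accessory (q, a, b, c, d) = q"

definition HE :: "heun_params \<Rightarrow> complex \<Rightarrow> complex \<Rightarrow> complex \<Rightarrow> complex \<Rightarrow> bool" where
  "HE h \<alpha> \<beta> \<gamma> \<delta> \<longleftrightarrow>
     (\<exists>es. mset es = mset [e_0 h, e_1 h, e_t h, e_inf h] \<and>
           list_all2 (\<lambda>e r. e = r \<or> e = - r) es [\<alpha>, \<beta>, \<gamma>, \<delta>])"

definition jinv :: "complex \<Rightarrow> complex" where
  "jinv t = 256 * (t^2 - t + 1)^3 / (t^2 * (t - 1)^2)"

definition k1 :: "complex \<Rightarrow> heun_params \<Rightarrow> complex" where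
  "k1 t h = (t^2 - t + 1) / (t * (t - 1)) *
     (((e_0 h)^2 - (e_1 h)^2) * ((e_t h)^2 - (e_inf h)^2) * t
      - ((e_0 h)^2 - (e_t h)^2) * ((e_1 h)^2 - (e_inf h)^2))"

text \<open>Only meaningful when \<open>jinv t \<noteq> 0\<close>, that is, \<open>t\<^sup>2 - t + 1 \<noteq> 0\<close>.\<close>

definition k2 :: "complex \<Rightarrow> heun_params \<Rightarrow> complex" where
  "k2 t h =
     (((e_0 h)^2 * (e_t h)^2 + (e_1 h)^2 * (e_inf h)^2) * t^2
      - ((e_0 h)^2 * (e_inf h)^2 + (e_1 h)^2 * (e_t h)^2) * t
      + (e_0 h)^2 * (e_1 h)^2 + (e_t h)^2 * (e_inf h)^2) / (t^2 - t + 1)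
     + (e_0 h)^2 * (e_inf h)^2 + (e_1 h)^2 * (e_t h)^2"

definition Q0 :: "complex \<Rightarrow> heun_params \<Rightarrow> complex" where
  "Q0 t h = 12 * accessory h - 6 * (e_0 h - 1) * (e_1 h * t + e_t h)
     + ((e_inf h)^2 - 2 * (e_0 h - 1) * (e_0 h - 2)) * (t + 1)
     - (e_1 h)^2 * (2 * t - 1) + (e_t h)^2 * (t - 2)"

definition J1 :: "complex \<Rightarrow> complex" where
  "J1 t = (t + 1) * (t - 2) * (2 * t - 1) * (t^2 - t + 1) / (t^2 * (t - 1)^2)"

definition Q1 :: "complex \<Rightarrow> heun_params \<Rightarrow> complex" where
  "Q1 t h = J1 t * Q0 t h"


section \<open>Table entries\<close>

text \<open>
  In the entries without a value of \<open>k2\<close>, two of the exponent differences are equal up to sign.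
\<close>

fun entry :: "complex \<Rightarrow> heun_params \<Rightarrow> complex \<Rightarrow>
    complex \<times> complex \<times> complex \<times> complex \<Rightarrow> complex \<Rightarrow> complex \<Rightarrow> bool" where
  "entry t h j (\<delta>1, \<delta>2, \<delta>3, \<delta>4) q1 k \<longleftrightarrow>
     jinv t = j \<and> HE h \<delta>1 \<delta>2 \<delta>3 \<delta>4 \<and> Q1 t h = q1 \<and> k1 t h = k"

definition entry_k2 :: "complex \<Rightarrow> heun_params \<Rightarrow> complex \<Rightarrow>
    complex \<times> complex \<times> complex \<times> complex \<Rightarrow> complex \<Rightarrow> complex \<Rightarrow> complex \<Rightarrow> bool" where
  "entry_k2 t h j \<delta>s q1 k k' \<longleftrightarrow> entry t h j \<delta>s q1 k \<and> k2 t h = k'"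

definition P25_to_P36 :: "complex \<Rightarrow> heun_params \<Rightarrow> complex \<Rightarrow> bool" where
  "P25_to_P36 t h \<alpha> \<longleftrightarrow>
     entry_k2 t h (2^4 * 3^3 * 7^3 / 5^2) (1/2, 2/3, 2*\<alpha>, 3*\<alpha>)
       (3^5 * 7 / (2^5 * 5^2) * (72*\<alpha>^2 - 1))
       (7/3 * (81*\<alpha>^4 - 173/16*\<alpha>^2 + 1/4))
       (100/189 * (81*\<alpha>^4 + 121/16*\<alpha>^2 + 1/4)) \<or>
     entry_k2 t h (13^3 * 37^3 / (3^4 * 5^4)) (1/3, 2/3, \<alpha>, 5*\<alpha>)
       (7 * 13 * 17 * 37 * 41 / (2^7 * 3^6 * 5^4) * (1881*\<alpha>^2 - 28))
       (- (481/400) * (25*\<alpha>^4 - 229/9*\<alpha>^2 + 4/81))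
       (81/481 * (25*\<alpha>^4 + 70549/729*\<alpha>^2 + 4/81)) \<or>
     entry_k2 t h (6481^3 / (3^8 * 5^2)) (1/2, 1/4, 2*\<alpha>, 3*\<alpha>)
       (7^2 * 23 * 41 * 79 * 6481 / (2^11 * 3^8 * 5^2) * (1696*\<alpha>^2 - 83))
       (- (6481/81) * (36*\<alpha>^4 - 643/256*\<alpha>^2 + 1/64))
       (6400/6481 * (36*\<alpha>^4 + 52493/20480*\<alpha>^2 + 1/64)) \<or>
     entry_k2 t h (6481^3 / (3^8 * 5^2)) (1/3, \<alpha>, 4*\<alpha>, 5*\<alpha>)
       (7 * 23 * 41 * 79 * 6481 / (2^7 * 3^10 * 5^2) * (22977*\<alpha>^2 - 440))
       (6481/144 * \<alpha>^2 * (691*\<alpha>^2 - 43/9))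
       (1/6481 * \<alpha>^2 * (2726825*\<alpha>^2 + 166577/9)) \<or>
     entry_k2 t h (2^6 * 7^3 * 97^3 / (3^6 * 5^4)) (2/3, \<alpha>, 2*\<alpha>, 5*\<alpha>)
       (2^2 * 7 * 13 * 23 * 29 * 97 / (3^8 * 5^4) * (1215*\<alpha>^2 - 16))
       (679/9 * \<alpha>^2 * (17*\<alpha>^2 - 404/225))
       (20/679 * \<alpha>^2 * (3775*\<alpha>^2 + 3274/9)) \<or>
     entry_k2 t h (2^4 * 757^3 / (3^6 * 7^2)) (1/2, 1/3, 3*\<alpha>, 4*\<alpha>)
       (5^2 * 11 * 13 * 29 * 757 / (2^5 * 3^8 * 7^2) * (2952*\<alpha>^2 - 71))
       (757/27 * (144*\<alpha>^4 - 715/144*\<alpha>^2 + 1/36))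
       (784/757 * (144*\<alpha>^4 + 131365/28224*\<alpha>^2 + 1/36)) \<or>
     entry_k2 t h (7^3 * 127^3 / (2^2 * 3^6 * 5^2)) (1/2, 2/3, \<alpha>, 4*\<alpha>)
       (7 * 11 * 37 * 59 * 127 / (2^11 * 3^8 * 5^2) * (14004*\<alpha>^2 - 323))
       (- (889/216) * (4*\<alpha>^4 - 52/9*\<alpha>^2 + 1/36))
       (100/889 * (4*\<alpha>^4 + 970/9*\<alpha>^2 + 1/36)) \<or>
     entry_k2 t h (7^3 * 127^3 / (2^2 * 3^6 * 5^2)) (1/3, 2*\<alpha>, 3*\<alpha>, 5*\<alpha>)
       (7 * 11 * 37 * 59 * 127 / (2^9 * 3^8 * 5^2) * (4014*\<alpha>^2 - 95))
       (889 * \<alpha>^2 * (\<alpha>^2 - 1/162))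
       (36/889 * \<alpha>^2 * (8450*\<alpha>^2 + 5641/162)) \<or>
     entry_k2 t h (7^3 * 2287^3 / (2^6 * 3^2 * 5^6)) (1/2, \<alpha>, 3*\<alpha>, 5*\<alpha>)
       (7 * 11 * 23 * 61 * 131 * 2287 / (2^15 * 3^2 * 5^6) * (12580*\<alpha>^2 - 237))
       (16009/40 * \<alpha>^2 * (23*\<alpha>^2 - 63/100))
       (250/16009 * \<alpha>^2 * (15309*\<alpha>^2 + 40709/100)) \<or>
     entry_k2 t h (7^3 * 2287^3 / (2^6 * 3^2 * 5^6)) (1/5, \<alpha>, 2*\<alpha>, 3*\<alpha>)
       (7 * 11 * 23 * 61 * 131 * 2287 / (2^13 * 3^2 * 5^8) * (31450*\<alpha>^2 - 1953))
       (- (16009/100) * \<alpha>^2 * (7*\<alpha>^2 - 3/100))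
       (8/16009 * \<alpha>^2 * (88749*\<alpha>^2 + 40621/100)) \<or>
     entry_k2 t h (4993^3 / (2^2 * 3^8 * 7^4)) (1/3, \<alpha>, 2*\<alpha>, 7*\<alpha>)
       (5 * 13 * 17 * 113 * 4993 / (2^9 * 3^10 * 7^4) * (8262*\<alpha>^2 - 67))
       (4993/9 * \<alpha>^2 * (\<alpha>^2 - 17/882))
       (2/4993 * \<alpha>^2 * (672868*\<alpha>^2 + 64153/9)) \<or>
     entry_k2 t h (19^3 * 1459^3 / (2^4 * 3^6 * 5^6 * 7^2)) (1/2, 1/3, 2*\<alpha>, 5*\<alpha>)
       (11 * 19 * 23 * 61 * 157 * 1459 / (2^13 * 3^8 * 5^6 * 7^2) * (50184*\<alpha>^2 - 635))
       (27721/8000 * (100*\<alpha>^4 - 1849/324*\<alpha>^2 + 1/36))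
       (35721/27721 * (100*\<alpha>^4 + 4322681/1285956*\<alpha>^2 + 1/36))"

definition P37_to_P59 :: "complex \<Rightarrow> heun_params \<Rightarrow> complex \<Rightarrow> bool" where
  "P37_to_P59 t h \<alpha> \<longleftrightarrow>
     entry t h (2^3 * 3^3 * 11^3) (1/2, 1/2, \<alpha>, \<alpha>)
       (3^5 * 7 * 11 / 2^5 * (4*\<alpha>^2 - 1))
       (- 33 * (\<alpha>^2 - 1/4)^2) \<or>
     entry t h (2^4 * 3^3 * 5^3) (1/2, 1/2, \<alpha>, \<alpha>)
       (3^3 * 5 * 11 / 2^4 * (4*\<alpha>^2 - 1))
       (15 * (\<alpha>^2 - 1/4)^2) \<or>
     entry t h (2^2 * 193^3 / 3) (1/4, 1/4, \<alpha>, \<alpha>)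
       (7 * 193 * 383 / (2^8 * 3) * (176*\<alpha>^2 - 71))
       (- 193 * (\<alpha>^2 - 1/16)^2) \<or>
     entry t h (2^7 * 53^3 / 3^3) (1/3, 1/3, \<alpha>, \<alpha>)
       (5 * 53 * 109 / 3^5 * (63*\<alpha>^2 - 23))
       (53 * (\<alpha>^2 - 1/9)^2) \<or>
     entry t h (2^4 * 17^3) (1/2, \<alpha>, 2*\<alpha>, 2*\<alpha>)
       (3 * 5 * 17 * 31 / 2^5 * (12*\<alpha>^2 - 1))
       (- 51 * \<alpha>^2 * (4*\<alpha>^2 - 1/4)) \<or>
     entry t h (2^14 * 31^3 / 5^3) (\<alpha>, \<alpha>, 5*\<alpha>, 5*\<alpha>)
       (2^5 * 11 * 31 * 251 / 5^3 * (58*\<alpha>^2 - 1))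
       (71424 * \<alpha>^4) \<or>
     entry t h (2^2 * 3^3 * 13^3 / 5^4) (1/4, 1/4, \<alpha>, 5*\<alpha>)
       (3^5 * 13 * 17 / (2^8 * 5^4) * (1 - 16*\<alpha>^2))
       (39 * (\<alpha>^2 - 1/16) * (\<alpha>^2 - 1/400)) \<or>
     entry t h (- (2^4 * 109^3 / 5^6)) (1/2, 1/2, \<alpha>, 5*\<alpha>)
       (11 * 109 * 157 / (2^4 * 5^6) * (5 - 356*\<alpha>^2))
       (- (109/5) * (\<alpha>^2 - 1/4) * (\<alpha>^2 - 1/100)) \<or>
     entry t h (- (2^4 * 109^3 / 5^6)) (1/5, \<alpha>, \<alpha>, 4*\<alpha>)
       (3^2 * 11 * 109 * 157 / (2^2 * 5^8) * (4 - 75*\<alpha>^2))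
       (327/25 * \<alpha>^2 * (\<alpha>^2 - 1/25)) \<or>
     entry t h (- (2^5 * 19^3 / 3^6)) (1/2, 1/2, 1/3, \<alpha>)
       (5 * 19 * 43 / (2^3 * 3^8) * (11 - 36*\<alpha>^2))
       (95/972 * (\<alpha>^2 - 1/4)) \<or>
     entry t h (2 * 47^3 / 3^8) (1/2, 1/2, \<alpha>, 3*\<alpha>)
       (7 * 47 * 337 / (2^7 * 3^8) * (44*\<alpha>^2 - 1))
       (47/9 * (\<alpha>^2 - 1/4) * (\<alpha>^2 - 1/36)) \<or>
     entry t h (2 * 47^3 / 3^8) (1/3, \<alpha>, \<alpha>, 8*\<alpha>)
       (7 * 47 * 337 / (2^5 * 3^10) * (2 - 513*\<alpha>^2))
       (- (329/9) * \<alpha>^2 * (\<alpha>^2 - 1/9)) \<or>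
     entry t h (- (2^6 * 239^3 / 3^10)) (1/3, \<alpha>, \<alpha>, 2*\<alpha>)
       (2 * 5 * 11 * 239 * 251 / 3^12 * (4 - 27*\<alpha>^2))
       (239/81 * \<alpha>^2 * (\<alpha>^2 - 1/9)) \<or>
     entry t h (- (2^11 * 11^3 / (3^3 * 7^4))) (1/3, 1/3, \<alpha>, 7*\<alpha>)
       (2 * 5 * 11 * 13 * 103 / (3^5 * 7^4) * (1 - 153*\<alpha>^2))
       (- 22 * (\<alpha>^2 - 1/9) * (\<alpha>^2 - 1/441)) \<or>
     entry t h (5^3 * 43^3 / (2^6 * 7^3)) (1/2, \<alpha>, \<alpha>, 7*\<alpha>)
       (3 * 5 * 11 * 13 * 37 * 43 / (2^15 * 7^3) * (1 - 244*\<alpha>^2))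
       (- (645/8) * \<alpha>^2 * (\<alpha>^2 - 1/4)) \<or>
     entry t h (- (269^3 / (2^10 * 3^5))) (1/2, \<alpha>, \<alpha>, 3*\<alpha>)
       (5 * 19 * 269 * 499 / (2^19 * 3^5) * (68*\<alpha>^2 + 3))
       (269/64 * \<alpha>^2 * (\<alpha>^2 - 1/4)) \<or>
     entry t h (71^3 / (2^4 * 3^3 * 5)) (1/2, 1/3, 1/3, \<alpha>)
       (11 * 71 * 167 / (2^13 * 3^5 * 5) * (17 - 72*\<alpha>^2))
       (355/2304 * (\<alpha>^2 - 1/9))"

text \<open>
  The algebraic number in each of the following entries is an argument, so that the conjugate
  entry is obtained by replacing it by its conjugate.
\<close>

definition P60 :: "complex \<Rightarrow> complex \<Rightarrow> heun_params \<Rightarrow> complex \<Rightarrow> bool" where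
  "P60 I t h \<alpha> \<longleftrightarrow>
     entry_k2 t h ((1 + I)^12 * (3 - 2*I)^3 / (2 - I)^2) (1/2, 1/4, \<alpha>, 4*\<alpha>)
       ((229 - 53*I) / (2 * 5^2) * ((4 - I) / 16 - (10 - 7*I) * \<alpha>^2))
       ((2 + 3*I) / 2 * (16*\<alpha>^4 - (28 + 9*I) / 8 * \<alpha>^2 + 1/64))
       ((17 - 6*I) / 13 * (16*\<alpha>^4 + (9 + 12*I) / 5 * \<alpha>^2 + 1/64))"

definition P61 :: "complex \<Rightarrow> complex \<Rightarrow> heun_params \<Rightarrow> complex \<Rightarrow> bool" where
  "P61 w t h \<alpha> \<longleftrightarrow>
     entry_k2 t h
       (- w * 2^4 * ((1 - 2*w)^3 * (7 + 6*w)^3 / ((1 + 2*w)^6 * (3 + 2*w)^2)))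
       (1/2, 1/3, \<alpha>, 6*\<alpha>)
       ((531 - 6130*w) / (2^3 * 3^3 * (2 - w)^2) * ((5 - 4*w) / 36 - (19 - 8*w) * \<alpha>^2))
       ((11*w - 23) / 9 * (9*\<alpha>^4 + (2 - 21*w) / (4 + 8*w) * \<alpha>^2 + 1/144))
       ((12 - 20*w) / (15 + 19*w) * (9*\<alpha>^4 - (157 + 34*w) / (10 + 16*w) * \<alpha>^2 + 1/144))"

definition omega :: complex where
  "omega = exp (2 * of_real pi * \<i> / 3)"

end

(*
  A linear second-order equation y'' + P y' + Q y = 0 is determined, up to multiplication of its
  solutions by a function, by the invariant Q - P'/2 - P^2/4, and for a Heun equation this invariant
  depends only on t, on the squares of the exponent differences and on Q0. Hence z = phi(x) pulls a
  hypergeometric equation with invariant J back to a Heun equation with invariant I if and only if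
  I = phi'^2 J(phi) + S/2, S being the Schwarzian derivative of phi; the prefactor is then a product
  of powers of phi, phi - 1, phi' and linear functions.

  For each entry one covering is written down as phi = c0 g^k0 B0 / G, phi - 1 = c1 f^k1 B1 / G with
  B0, B1, G products of powers of (x - w) over the singular points w. The points over z = 0 and z = 1
  are then regular wherever g and f vanish as soon as the exponent differences there are 1/k0 and 1/k1.
  If u, v are the logarithmic derivatives of phi and phi - 1, then u v and the combination
  C u + D v - phi''/phi' have poles only at the singular points, and no third derivative of phi is needed.

  The Moebius transformations permuting 0, 1, t, infinity reduce an arbitrary Heun equation to the
  normal form of its entry: j fixes t up to the action of S3, and for fixed t the invariants k1, k2
  determine the pairings e0 e1 + et einf, e0 et + e1 einf, e0 einf + e1 et of the squares of the
  exponent differences, hence their arrangement up to the Klein four-group.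
*)
theory Submission
  imports Defs "HOL-Complex_Analysis.Cauchy_Integral_Formula"
begin

section \<open>Invariants and pull-backs\<close>

text \<open>The conclusion asks for more than one pull-back: a covering valid for a whole family of
  hypergeometric equations, with Heun parameters that are continuous along the family and equal to
  \<open>h\<close> at one member. Invariants see only the squares of exponent differences, so
  continuous exponent differences are carried along, and the signs read off from \<open>h\<close>
  are kept constant on the family. Under the substitutions t -> 1 - t and t -> 1/t the quantity
  \<open>Q0\<close> is negated, respectively divided by t; what the orbit of t preserves is
  \<open>J1 * Q0\<close>. As \<open>J1\<close> vanishes exactly for j = 0 and j = 1728,
  \<open>Q0 = 0\<close> is prescribed there, and (i) and (ii) are treated separately. For all other
  j the nonzero factors of \<open>J1\<close> are also what makes the linear system for the pairings
  solvable. In the one-parameter entries with two equal squares and rational j, t lies in a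
  quadratic field. Placing the two points with equal squares at r and -r with r^2 rational makes all
  data rational, up to a factor r in \<open>Q0\<close>.\<close>

fun hg_inv :: "hg_params \<Rightarrow> complex \<Rightarrow> complex" where
  "hg_inv (A, B, C) z = A * B / (z * (z - 1)) + (C / z^2 + (A + B - C + 1) / (z - 1)^2) / 2
     - (C / z + (A + B - C + 1) / (z - 1))^2 / 4"

text \<open>The invariant of a Heun equation, with \<open>Q\<close> for the value of
  \<open>Q0\<close>. A finite singular point contributes a double pole with coefficient (1 - M)/4;
  the coefficient of x in the last numerator makes x^2 times the invariant tend to (1 - Mi)/4 at
  infinity.\<close>

definition heun_inv ::
  "complex \<Rightarrow> complex \<Rightarrow> complex \<Rightarrow> complex \<Rightarrow> complex \<Rightarrow> complex \<Rightarrow> complex \<Rightarrow> complex" where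
  "heun_inv t M0 M1 Mt Mi Q x =
     ((1 - M0) / x^2 + (1 - M1) / (x - 1)^2 + (1 - Mt) / (x - t)^2) / 4
     + ((M0 + M1 + Mt - Mi - 2) / 4 * x
        + (- Q + (t + 1) * (Mi + 2 - 2 * M0) - M1 * (2 * t - 1) + Mt * (t - 2)) / 12)
       / (x * (x - 1) * (x - t))"

text \<open>\<open>Q0\<close> is the accessory parameter rescaled and shifted so that exponent
  differences enter the invariant through their squares only. The double poles agree by 1 - (1 -
  p)^2 = 2 p - p^2, the cross terms of the square go into the numerator over x (x - 1) (x -
  t).\<close>

lemma heun_inv_eq:
  assumes "x \<noteq> 0" "x \<noteq> 1" "x \<noteq> t"
  shows "heun_inv t ((1 - c)^2) ((1 - d)^2) ((c + d - a - b)^2) ((b - a)^2) (Q0 t (q, a, b, c, d)) x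
    = (a * b * x - q) / (x * (x - 1) * (x - t))
      + (c / x^2 + d / (x - 1)^2 + (a + b - c - d + 1) / (x - t)^2) / 2
      - (c / x + d / (x - 1) + (a + b - c - d + 1) / (x - t))^2 / 4"
proof -
  define y z where "y = x - 1" and "z = x - t"
  define e where "e = a + b - c - d + 1"
  define W where "W = a * b * x - q"
  have nz: "x \<noteq> 0" "y \<noteq> 0" "z \<noteq> 0" using assms by (auto simp: y_def z_def)
  have lin: "((1 - c)^2 + (1 - d)^2 + (c + d - a - b)^2 - (b - a)^2 - 2) / 4 * x
        + (- Q0 t (q, a, b, c, d) + (t + 1) * ((b - a)^2 + 2 - 2 * (1 - c)^2)
           - (1 - d)^2 * (2 * t - 1) + (c + d - a - b)^2 * (t - 2)) / 12
      = W - (c * d * z + c * e * y + d * e * x) / 2"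
    unfolding Q0_def e_0.simps e_1.simps e_t.simps e_inf.simps accessory.simps y_def z_def W_def e_def
    by (simp add: field_simps power2_eq_square)
  have split: "(W - (c * d * z + c * e * y + d * e * x) / 2) / (x * y * z)
      = W / (x * y * z) - (c / x * (d / y) + c / x * (e / z) + d / y * (e / z)) / 2"
    using nz by (simp add: field_simps)
  have dbl: "(1 - (1 - p)^2) / v^2 = 2 * (p / v^2) - (p / v)^2" for p v :: complex
    by (simp add: power_divide power2_eq_square algebra_simps diff_divide_distrib add_divide_distrib)
  have et: "c + d - a - b = 1 - e" by (simp add: e_def)
  define cx dy ez cxx dyy ezz where "cx = c / x" "dy = d / y" "ez = e / z"
    "cxx = c / x^2" "dyy = d / y^2" "ezz = e / z^2"
  show ?thesis
    unfolding heun_inv_def lin unfolding et dbl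
    unfolding y_def[symmetric] z_def[symmetric] e_def[symmetric] W_def[symmetric] split
    unfolding cx_dy_ez_cxx_dyy_ezz_def[symmetric]
    by (simp add: field_simps power2_eq_square)
qed

text \<open>\<open>D\<close>, \<open>N\<close>, \<open>N'\<close> are phi', phi''/phi' and the
  derivative of the latter, so that N' - N^2/2 is the Schwarzian; being quantified, they may be
  given in whatever closed form suits the covering. Nonvanishing of \<open>D\<close> says that phi
  ramifies only over 0, 1, infinity or at points of \<open>Z\<close>.\<close>

definition pullback_inv :: "ratfun \<Rightarrow> hg_params \<Rightarrow> complex set \<Rightarrow> (complex \<Rightarrow> complex) \<Rightarrow> bool" where
  "pullback_inv \<phi> p Z I \<longleftrightarrow>
     (\<exists>D N N'. \<forall>x. x \<notin> Z \<longrightarrow> poly (snd \<phi>) x \<noteq> 0 \<longrightarrow> rf_eval \<phi> x \<noteq> 0 \<longrightarrow> rf_eval \<phi> x \<noteq> 1 \<longrightarrow>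
        (rf_eval \<phi> has_field_derivative D x) (at x) \<and> D x \<noteq> 0 \<and>
        (D has_field_derivative N x * D x) (at x) \<and>
        (N has_field_derivative N' x) (at x) \<and>
        I x = (D x)^2 * hg_inv p (rf_eval \<phi> x) + (N' x - (N x)^2 / 2) / 2)"

text \<open>One such point excludes the vacuous case of \<open>pullback_inv\<close> (a constant phi
  = 0, say) and shows that phi, phi - 1 and phi' are nonzero rational functions, hence admissible
  factors of a radical.\<close>

definition regular_point :: "ratfun \<Rightarrow> complex set \<Rightarrow> complex \<Rightarrow> bool" where
  "regular_point \<phi> Z x \<longleftrightarrow> x \<notin> Z \<and> poly (snd \<phi>) x \<noteq> 0 \<and> rf_eval \<phi> x \<noteq> 0 \<and> rf_eval \<phi> x \<noteq> 1"

section \<open>Pulling back solutions with an explicit radical prefactor\<close>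

lemma rf_eval_deriv:
  assumes "poly G x \<noteq> 0"
  shows "(rf_eval (F, G) has_field_derivative
           rf_eval (pderiv F * G - F * pderiv G, G * G) x) (at x)"
proof -
  have "((\<lambda>x. poly F x / poly G x) has_field_derivative
          (poly (pderiv F) x * poly G x - poly F x * poly (pderiv G) x) / (poly G x * poly G x)) (at x)"
    by (rule DERIV_divide[OF poly_DERIV poly_DERIV assms])
  thus ?thesis by (simp add: rf_eval_def[abs_def])
qed

lemma log_branch_deriv:
  assumes "open U" "x \<in> U" "L holomorphic_on U" "\<And>z. z \<in> U \<Longrightarrow> exp (L z) = g z"
    and "(g has_field_derivative g') (at x)"
  shows "(L has_field_derivative g' / g x) (at x)"
proof -
  have L: "(L has_field_derivative deriv L x) (at x)"
    using assms(1-3) holomorphic_derivI by blast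
  have "((\<lambda>z. exp (L z)) has_field_derivative exp (L x) * deriv L x) (at x)"
    using DERIV_chain2[OF DERIV_exp L] by simp
  hence "(g has_field_derivative exp (L x) * deriv L x) (at x)"
    by (rule has_field_derivative_transform_within_open[OF _ assms(1,2)]) (use assms(4) in auto)
  hence "g' = exp (L x) * deriv L x" using assms(5) DERIV_unique by blast
  hence "deriv L x = g' / g x"
    using assms(2,4) by (metis exp_not_eq_zero nonzero_mult_div_cancel_left)
  thus ?thesis using L by simp
qed

text \<open>\<open>E\<close> is the value of the prefactor, \<open>T\<close> its logarithmic
  derivative, and \<open>y0\<close>, \<open>y1\<close>, \<open>y2\<close> are y, y', y'' at phi(x).
  The choice of \<open>T\<close> cancels the coefficient of \<open>y1\<close>; the coefficient of
  \<open>y0\<close> that remains is the difference of the two invariants.\<close>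

lemma liouville_identity:
  fixes T T' :: complex
  assumes T: "T = (D * p - N - P) / 2" and T': "T' = (N * D * p + D^2 * p' - N' - P') / 2"
    and Q: "Q - P' / 2 - P^2 / 4 = D^2 * (q - p' / 2 - p^2 / 4) + (N' - N^2 / 2) / 2"
    and y2: "y2 + p * y1 + q * y0 = 0"
  shows "E * T * (T * y0 + D * y1) + E * (T' * y0 + T * (D * y1) + N * D * y1 + D * (D * y2))
           + P * (E * (T * y0 + D * y1)) + Q * (E * y0) = 0"
proof -
  have y2': "y2 = - (p * y1) - q * y0" using y2 by (simp add: algebra_simps add_eq_0_iff2)
  have Q': "Q = P' / 2 + P^2 / 4 + D^2 * (q - p' / 2 - p^2 / 4) + (N' - N^2 / 2) / 2"
    using Q by (simp add: algebra_simps)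
  show ?thesis unfolding y2' Q' T T' by (simp add: field_simps power2_eq_square)
qed

text \<open>With p and P the first-order coefficients of the two equations, the six factors multiply
  to the square root of exp(int p(phi) phi') / (phi' exp(int P)), which is the prefactor matching
  the first-order terms.\<close>

lemma pulls_back_if_pullback_inv:
  assumes inv: "pullback_inv (F, G) (A, B, C) {0, 1, t} I"
    and I: "\<And>x. x \<noteq> 0 \<Longrightarrow> x \<noteq> 1 \<Longrightarrow> x \<noteq> t \<Longrightarrow> I x = (a * b * x - q) / (x * (x - 1) * (x - t))
      + (c / x^2 + d / (x - 1)^2 + (a + b - c - d + 1) / (x - t)^2) / 2
      - (c / x + d / (x - 1) + (a + b - c - d + 1) / (x - t))^2 / 4"
  shows "pulls_back (F, G)
     [((F, G), C / 2), ((F - G, G), (A + B - C + 1) / 2),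
      ((pderiv F * G - F * pderiv G, G * G), - 1 / 2),
      (([:0, 1:], 1), - c / 2), (([:-1, 1:], 1), - d / 2),
      (([:-t, 1:], 1), - (a + b - c - d + 1) / 2)] (A, B, C) t (q, a, b, c, d)"
  unfolding pulls_back_def
proof (intro allI impI)
  fix U V y \<theta>
  define f where "f = rf_eval (F, G)"
  define J where "J = pderiv F * G - F * pderiv G"
  define \<Delta> where "\<Delta> = A + B - C + 1"
  define e where "e = a + b - c - d + 1"
  assume U: "open U" "U \<inter> {0, 1, t} = {}" "U \<subseteq> rf_domain (F, G)"
    and UV: "rf_eval (F, G) ` U \<subseteq> V" and hg: "hg_solution (A, B, C) V y"
    and br: "radical_branch [((F, G), C / 2), ((F - G, G), (A + B - C + 1) / 2),
      ((pderiv F * G - F * pderiv G, G * G), - 1 / 2),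
      (([:0, 1:], 1), - c / 2), (([:-1, 1:], 1), - d / 2),
      (([:-t, 1:], 1), - (a + b - c - d + 1) / 2)] U \<theta>" (is "radical_branch ?fs U \<theta>")
  have V: "V \<inter> {0, 1} = {}" "open V" "y holomorphic_on V"
    and ode: "\<And>z. z \<in> V \<Longrightarrow>
      deriv (deriv y) z + (C / z + \<Delta> / (z - 1)) * deriv y z + A * B / (z * (z - 1)) * y z = 0"
    using hg by (auto simp: ode2_solution_def \<Delta>_def)
  have Ux: "x \<noteq> 0" "x \<noteq> 1" "x \<noteq> t" "poly G x \<noteq> 0" "f x \<in> V" "f x \<noteq> 0" "f x \<noteq> 1" if "x \<in> U" for x
    using U UV V(1) that by (auto simp: rf_domain_def f_def)
  obtain D N N' where *: "\<forall>x. x \<notin> {0, 1, t} \<longrightarrow> poly (snd (F, G)) x \<noteq> 0 \<longrightarrow> f x \<noteq> 0 \<longrightarrow> f x \<noteq> 1 \<longrightarrow>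
        (f has_field_derivative D x) (at x) \<and> D x \<noteq> 0 \<and>
        (D has_field_derivative N x * D x) (at x) \<and>
        (N has_field_derivative N' x) (at x) \<and>
        I x = (D x)^2 * hg_inv (A, B, C) (f x) + (N' x - (N x)^2 / 2) / 2"
    using inv unfolding pullback_inv_def f_def by blast
  have DN: "(f has_field_derivative D x) (at x)" "D x \<noteq> 0"
      "(D has_field_derivative N x * D x) (at x)" "(N has_field_derivative N' x) (at x)"
      "I x = (D x)^2 * hg_inv (A, B, C) (f x) + (N' x - (N x)^2 / 2) / 2" if "x \<in> U" for x
    using *[rule_format, of x] Ux[OF that] by auto
  have len: "length ?fs = 6" by simp
  obtain L where L: "\<And>i x. i < 6 \<Longrightarrow> x \<in> U \<Longrightarrow> exp (L i x) = rf_eval (fst (?fs ! i)) x"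
      "\<And>i. i < 6 \<Longrightarrow> L i holomorphic_on U"
      "\<And>x. x \<in> U \<Longrightarrow> \<theta> x = (\<Prod>i<6. exp (snd (?fs ! i) * L i x))"
    using br[unfolded radical_branch_def len] by blast
  have six: "{..<6::nat} = {0, 1, 2, 3, 4, 5}" by auto
  define E where "E = (\<lambda>x. exp (C / 2 * L 0 x + \<Delta> / 2 * L 1 x - L 2 x / 2
      - c / 2 * L 3 x - d / 2 * L 4 x - e / 2 * L 5 x))"
  have \<theta>E: "\<theta> x = E x" if "x \<in> U" for x
    unfolding L(3)[OF that] six E_def \<Delta>_def e_def
    by (simp add: exp_add[symmetric] field_simps)
  have Ji: "rf_eval (J, G * G) x = D x" if "x \<in> U" for x
    using DERIV_unique[OF DN(1)[OF that]] rf_eval_deriv[OF Ux(4)[OF that], of F]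
    unfolding J_def f_def by metis
  have L0: "(L 0 has_field_derivative D x / f x) (at x)" if "x \<in> U" for x
    by (rule log_branch_deriv[OF U(1) that])
       (use L(1)[of 0] L(2)[of 0] DN(1)[OF that] in \<open>auto simp: f_def\<close>)
  have FG: "rf_eval (F - G, G) x = f x - 1" if "x \<in> U" for x
    using Ux(4)[OF that] by (simp add: rf_eval_def f_def field_simps)
  have L1: "(L 1 has_field_derivative D x / (f x - 1)) (at x)" if "x \<in> U" for x
    by (rule log_branch_deriv[OF U(1) that, where g = "\<lambda>x. f x - 1"])
       (use L(1)[of 1] L(2)[of 1] FG in \<open>auto intro!: derivative_eq_intros DN(1)[OF that]\<close>)
  have L2: "(L 2 has_field_derivative N x) (at x)" if "x \<in> U" for x
  proof -
    have "(L 2 has_field_derivative N x * D x / D x) (at x)"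
      by (rule log_branch_deriv[OF U(1) that])
         (use L(1)[of 2] L(2)[of 2] Ji DN(3)[OF that] in \<open>auto simp: J_def\<close>)
    thus ?thesis using DN(2)[OF that] by simp
  qed
  have L3: "(L 3 has_field_derivative 1 / x) (at x)" if "x \<in> U" for x
    by (rule log_branch_deriv[OF U(1) that, where g = "\<lambda>x. x"])
       (use L(1)[of 3] L(2)[of 3] in \<open>auto intro!: derivative_eq_intros simp: rf_eval_def\<close>)
  have L4: "(L 4 has_field_derivative 1 / (x - 1)) (at x)" if "x \<in> U" for x
    by (rule log_branch_deriv[OF U(1) that, where g = "\<lambda>x. x - 1"])
       (use L(1)[of 4] L(2)[of 4] in \<open>auto intro!: derivative_eq_intros simp: rf_eval_def\<close>)
  have L5: "(L 5 has_field_derivative 1 / (x - t)) (at x)" if "x \<in> U" for x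
    by (rule log_branch_deriv[OF U(1) that, where g = "\<lambda>x. x - t"])
       (use L(1)[of 5] L(2)[of 5] in \<open>auto intro!: derivative_eq_intros simp: rf_eval_def\<close>)
  define P where "P = (\<lambda>x. c / x + d / (x - 1) + e / (x - t))"
  define P' where "P' = (\<lambda>x. - c / x^2 - d / (x - 1)^2 - e / (x - t)^2)"
  define p where "p = (\<lambda>z. C / z + \<Delta> / (z - 1))"
  define p' where "p' = (\<lambda>z. - C / z^2 - \<Delta> / (z - 1)^2)"
  \<comment> \<open>The logarithmic derivative of \<open>E\<close>, with \<open>T'\<close> its own
    derivative.\<close>
  define T where "T = (\<lambda>x. (D x * p (f x) - N x - P x) / 2)"
  define T' where "T' = (\<lambda>x. (N x * D x * p (f x) + (D x)^2 * p' (f x) - N' x - P' x) / 2)"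
  have dE: "(E has_field_derivative E x * T x) (at x)" if "x \<in> U" for x
    unfolding E_def T_def p_def P_def
    by (auto intro!: derivative_eq_intros L0[OF that] L1[OF that, unfolded One_nat_def] L2[OF that] L3[OF that] L4[OF that]
          L5[OF that] simp: field_simps)
  have dP: "(P has_field_derivative P' x) (at x)" if "x \<in> U" for x
    unfolding P_def P'_def using Ux[OF that]
    by (auto intro!: derivative_eq_intros simp: power2_eq_square)
  have dp: "(p has_field_derivative p' z) (at z)" if "z \<noteq> 0" "z \<noteq> 1" for z
    unfolding p_def p'_def using that
    by (auto intro!: derivative_eq_intros simp: power2_eq_square)
  have dpf: "((\<lambda>x. p (f x)) has_field_derivative p' (f x) * D x) (at x)" if "x \<in> U" for x
    by (rule DERIV_chain2[OF dp DN(1)]) (use Ux that in auto)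
  have dT: "(T has_field_derivative T' x) (at x)" if "x \<in> U" for x
    unfolding T_def T'_def
    by (auto intro!: derivative_eq_intros dpf[OF that] DN(3,4)[OF that] dP[OF that] simp: field_simps power2_eq_square)
  have dy: "((\<lambda>x. y (f x)) has_field_derivative deriv y (f x) * D x) (at x)" if "x \<in> U" for x
    by (rule DERIV_chain2[OF holomorphic_derivI[OF V(3,2) Ux(5)] DN(1)]) (rule that)+
  have dy': "((\<lambda>x. deriv y (f x)) has_field_derivative deriv (deriv y) (f x) * D x) (at x)"
    if "x \<in> U" for x
    by (rule DERIV_chain2[OF holomorphic_derivI[OF holomorphic_deriv[OF V(3,2)] V(2) Ux(5)] DN(1)])
       (rule that)+
  define Y where "Y = (\<lambda>x. \<theta> x * y (rf_eval (F, G) x))"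
  define Y1 where "Y1 = (\<lambda>x. E x * (T x * y (f x) + D x * deriv y (f x)))"
  define Y2 where "Y2 = (\<lambda>x. E x * T x * (T x * y (f x) + D x * deriv y (f x))
     + E x * (T' x * y (f x) + T x * (D x * deriv y (f x)) + N x * D x * deriv y (f x)
              + D x * (D x * deriv (deriv y) (f x))))"
  have dY: "(Y has_field_derivative Y1 x) (at x)" if "x \<in> U" for x
  proof (rule has_field_derivative_transform_within_open[OF _ U(1) that])
    show "((\<lambda>x. E x * y (f x)) has_field_derivative Y1 x) (at x)"
      unfolding Y1_def
      by (auto intro!: derivative_eq_intros dE[OF that] dy[OF that] simp: field_simps)
  qed (simp add: Y_def \<theta>E f_def)
  have dY1: "(Y1 has_field_derivative Y2 x) (at x)" if "x \<in> U" for x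
    unfolding Y1_def Y2_def
    by (auto intro!: derivative_eq_intros dE[OF that] dT[OF that] dy[OF that] dy'[OF that]
          DN(3)[OF that] simp: algebra_simps)
  have "deriv Y x = Y1 x" if "x \<in> U" for x using dY[OF that] by (rule DERIV_imp_deriv)
  hence "(deriv Y has_field_derivative Y2 x) (at x)" if "x \<in> U" for x
    using has_field_derivative_transform_within_open[OF dY1[OF that] U(1) that] by auto
  hence Y2: "deriv (deriv Y) x = Y2 x" if "x \<in> U" for x using that by (auto intro: DERIV_imp_deriv)
  have "deriv (deriv Y) x + P x * deriv Y x
      + (a * b * x - q) / (x * (x - 1) * (x - t)) * Y x = 0" if x: "x \<in> U" for x
  proof -
    have "I x = (a * b * x - q) / (x * (x - 1) * (x - t)) - P' x / 2 - (P x)^2 / 4"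
      unfolding I[OF Ux(1-3)[OF x]] P'_def P_def e_def by (simp add: field_simps)
    moreover have "hg_inv (A, B, C) (f x)
        = A * B / (f x * (f x - 1)) - p' (f x) / 2 - (p (f x))^2 / 4"
      unfolding p'_def p_def \<Delta>_def by (simp add: field_simps)
    ultimately have "(a * b * x - q) / (x * (x - 1) * (x - t)) - P' x / 2 - (P x)^2 / 4
        = (D x)^2 * (A * B / (f x * (f x - 1)) - p' (f x) / 2 - (p (f x))^2 / 4)
          + (N' x - (N x)^2 / 2) / 2"
      using DN(5)[OF x] by metis
    moreover have "deriv (deriv y) (f x) + p (f x) * deriv y (f x)
        + A * B / (f x * (f x - 1)) * y (f x) = 0"
      using ode[OF Ux(5)[OF x]] by (simp add: p_def)
    moreover have "deriv Y x = E x * (T x * y (f x) + D x * deriv y (f x))"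
      using DERIV_imp_deriv[OF dY[OF x]] by (simp add: Y1_def)
    moreover have "Y x = E x * y (f x)" using x by (simp add: Y_def \<theta>E f_def)
    ultimately show ?thesis
      unfolding Y2[OF x] Y2_def
      by (simp only:) (rule liouville_identity[OF fun_cong[OF T_def] fun_cong[OF T'_def]])
  qed
  moreover have "Y holomorphic_on U"
    using dY U(1) by (auto simp: holomorphic_on_open)
  ultimately show "heun_solution t (q, a, b, c, d) U (\<lambda>x. \<theta> x * y (rf_eval (F, G) x))"
    using U unfolding Y_def P_def e_def by (simp add: ode2_solution_def)
qed

lemma is_pullback_if_pullback_inv:
  assumes inv: "pullback_inv \<phi> p {0, 1, t} (heun_inv t ((e_0 h)^2) ((e_1 h)^2) ((e_t h)^2) ((e_inf h)^2) (Q0 t h))"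
    and reg: "regular_point \<phi> {0, 1, t} x0"
  shows "is_pullback \<phi> p t h"
proof -
  obtain F G A B C where \<phi>: "\<phi> = (F, G)" and p: "p = (A, B, C)" by (metis prod.exhaust)
  obtain q a b c d where h: "h = (q, a, b, c, d)" by (metis prod.exhaust)
  define J where "J = pderiv F * G - F * pderiv G"
  have x0: "x0 \<notin> {0, 1, t}" "poly G x0 \<noteq> 0" "rf_eval \<phi> x0 \<noteq> 0" "rf_eval \<phi> x0 \<noteq> 1"
    using reg by (auto simp: regular_point_def \<phi>)
  then obtain d0 where d0: "(rf_eval (F, G) has_field_derivative d0) (at x0)" "d0 \<noteq> 0"
    using inv unfolding pullback_inv_def \<phi> by auto
  have "rf_eval (J, G * G) x0 \<noteq> 0"
    using DERIV_unique[OF d0(1) rf_eval_deriv[OF x0(2)]] d0(2) by (simp add: J_def)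
  hence J: "J \<noteq> 0" by (auto simp: rf_eval_def)
  have G: "G \<noteq> 0" using x0 by auto
  have F: "F \<noteq> 0" "F - G \<noteq> 0" using x0 G by (auto simp: rf_eval_def \<phi>)
  have "rf_nonconstant \<phi>"
    using J by (auto simp: rf_nonconstant_def \<phi> J_def pderiv_smult mult.commute)
  moreover have "pulls_back \<phi> [((F, G), C / 2), ((F - G, G), (A + B - C + 1) / 2),
      ((J, G * G), - 1 / 2), (([:0, 1:], 1), - c / 2), (([:-1, 1:], 1), - d / 2),
      (([:-t, 1:], 1), - (a + b - c - d + 1) / 2)] p t h"
    unfolding \<phi> p h J_def
    by (rule pulls_back_if_pullback_inv[OF inv[unfolded \<phi> p]])
       (simp add: h heun_inv_eq)
  moreover have "radical_wf [((F, G), C / 2), ((F - G, G), (A + B - C + 1) / 2),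
      ((J, G * G), - 1 / 2), (([:0, 1:], 1), - c / 2), (([:-1, 1:], 1), - d / 2),
      (([:-t, 1:], 1), - (a + b - c - d + 1) / 2)]"
    using J G F by (simp add: radical_wf_def rf_wf_def)
  ultimately show ?thesis unfolding is_pullback_def using G by (auto simp: rf_wf_def \<phi>)
qed

section \<open>Moebius transformations\<close>

text \<open>The numerator of the invariant over 12 (x (x - 1) (x - t))^2. As a polynomial in x it
  has degree at most 4, which is the weight used in the next substitutions.\<close>

definition heun_num ::
  "complex \<Rightarrow> complex \<Rightarrow> complex \<Rightarrow> complex \<Rightarrow> complex \<Rightarrow> complex \<Rightarrow> complex \<Rightarrow> complex" where
  "heun_num t M0 M1 Mt Mi Q x =
     3 * ((1 - M0) * ((x - 1) * (x - t))^2 + (1 - M1) * (x * (x - t))^2 + (1 - Mt) * (x * (x - 1))^2)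
     + (3 * (M0 + M1 + Mt - Mi - 2) * x
        - Q + (t + 1) * (Mi + 2 - 2 * M0) - M1 * (2 * t - 1) + Mt * (t - 2)) * (x * (x - 1) * (x - t))"

lemma heun_inv_num:
  assumes "x \<noteq> 0" "x \<noteq> 1" "x \<noteq> t"
  shows "heun_inv t M0 M1 Mt Mi Q x = heun_num t M0 M1 Mt Mi Q x / (12 * (x * (x - 1) * (x - t))^2)"
proof -
  define y z L where "y = x - 1" and "z = x - t"
    and "L = 3 * (M0 + M1 + Mt - Mi - 2) * x
        - Q + (t + 1) * (Mi + 2 - 2 * M0) - M1 * (2 * t - 1) + Mt * (t - 2)"
  have nz: "x \<noteq> 0" "y \<noteq> 0" "z \<noteq> 0" using assms by (auto simp: y_def z_def)
  have L: "(M0 + M1 + Mt - Mi - 2) / 4 * x + (- Q + (t + 1) * (Mi + 2 - 2 * M0) - M1 * (2 * t - 1) + Mt * (t - 2)) / 12 = L / 12"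
    by (simp add: L_def field_simps)
  define a b c where "a = 1 - M0" and "b = 1 - M1" and "c = 1 - Mt"
  show ?thesis
    unfolding heun_inv_def heun_num_def L L_def[symmetric]
    unfolding y_def[symmetric] z_def[symmetric] a_def[symmetric] b_def[symmetric] c_def[symmetric]
    using nz by (simp add: field_simps power2_eq_square)
qed

text \<open>Homogenization in degree 4. It is applied with y = x and s = 1/x or s = t/x, where
  \<open>y * s\<close> is constant, so that no nested fraction has to be expanded.\<close>

lemma heun_num_homogeneous:
  fixes y s :: complex
  shows "y^4 * heun_num t M0 M1 Mt Mi Q s
     = 3 * ((1 - M0) * ((y * s - y) * (y * s - y * t))^2 + (1 - M1) * ((y * s) * (y * s - y * t))^2
            + (1 - Mt) * ((y * s) * (y * s - y))^2)
       + (3 * (M0 + M1 + Mt - Mi - 2) * (y * s) + y * (- Q + (t + 1) * (Mi + 2 - 2 * M0)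
            - M1 * (2 * t - 1) + Mt * (t - 2))) * ((y * s) * (y * s - y) * (y * s - y * t))"
proof -
  define L where "L = - Q + (t + 1) * (Mi + 2 - 2 * M0) - M1 * (2 * t - 1) + Mt * (t - 2)"
  define k where "k = 3 * (M0 + M1 + Mt - Mi - 2)"
  have k: "k * s - Q + (t + 1) * (Mi + 2 - 2 * M0) - M1 * (2 * t - 1) + Mt * (t - 2) = k * s + L"
    by (simp add: L_def)
  have hom: "y^4 * (3 * (a * (P * R)^2 + b * (s * R)^2 + c * (s * P)^2) + (k * s + L) * (s * P * R))
     = 3 * (a * ((y * P) * (y * R))^2 + b * ((y * s) * (y * R))^2 + c * ((y * s) * (y * P))^2)
       + (k * (y * s) + y * L) * ((y * s) * (y * P) * (y * R))" for a b c P R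
    by (simp add: power2_eq_square power4_eq_xxxx algebra_simps)
  have f: "y * s - y = y * (s - 1)" "y * s - y * t = y * (s - t)" by (simp_all add: algebra_simps)
  show ?thesis unfolding heun_num_def k_def[symmetric] k f L_def[symmetric] hom ..
qed

text \<open>The substitution 1 - x exchanges 0 and 1 and has derivative -1. The cubic under the
  accessory term changes sign, and so does \<open>Q\<close>.\<close>

lemma heun_inv_one_minus:
  "heun_inv (1 - t) M1 M0 Mt Mi (- Q) x = heun_inv t M0 M1 Mt Mi Q (1 - x)"
proof -
  have sq: "(1 - x - 1)^2 = x^2" "(1 - x)^2 = (x - 1)^2" "(1 - x - t)^2 = (x - (1 - t))^2"
    and D: "(1 - x) * (1 - x - 1) * (1 - x - t) = - (x * (x - 1) * (x - (1 - t)))"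
    by (simp_all add: power2_eq_square algebra_simps)
  define w where "w = 1 / (x * (x - 1) * (x - (1 - t)))"
  have w: "y / (x * (x - 1) * (x - (1 - t))) = y * w"
    "y / - (x * (x - 1) * (x - (1 - t))) = - y * w" for y by (simp_all add: w_def)
  show ?thesis unfolding heun_inv_def sq D w
    by (simp add: algebra_simps add_divide_distrib diff_divide_distrib)
qed

text \<open>The substitution 1/x exchanges 0 and infinity. Here \<open>Q\<close> is divided by t
  while \<open>J1\<close> gets multiplied by t, so that their product survives.\<close>

lemma heun_inv_inverse:
  assumes "x \<noteq> 0" "x \<noteq> 1" "t \<noteq> 0" "x \<noteq> 1 / t"
  shows "heun_inv (1 / t) Mi M1 Mt M0 (Q / t) x = (- 1 / x^2)^2 * heun_inv t M0 M1 Mt Mi Q (1 / x)"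
proof -
  have e: "x * (1 / x) = 1" using assms by simp
  have t2: "t^2 * heun_num (1 / t) Mi M1 Mt M0 (Q / t) x
     = 3 * ((1 - Mi) * ((x - 1) * (t * x - 1))^2 + (1 - M1) * (x * (t * x - 1))^2
         + (1 - Mt) * (t * (x * (x - 1)))^2)
       + (3 * (Mi + M1 + Mt - M0 - 2) * (t * x) - Q + (1 + t) * (M0 + 2 - 2 * Mi)
          - M1 * (2 - t) + Mt * (1 - 2 * t)) * (x * (x - 1) * (t * x - 1))"
  proof -
    define s where "s = 1 / t"
    have Q: "Q / t = s * Q" and ts: "t * s = 1" using assms by (simp_all add: s_def)
    define P where "P = x - 1"
    have *: "t^2 * (3 * (a * (P * R)^2 + b * (x * R)^2 + c * (x * P)^2) + L * (x * P * R))
      = 3 * (a * (P * (t * R))^2 + b * (x * (t * R))^2 + c * (t * (x * P))^2)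
        + (t * L) * (x * P * (t * R))" for a b c R L
      by (simp add: power2_eq_square algebra_simps)
    have R: "t * (x - s) = t * x - 1" using ts by (simp add: algebra_simps)
    have "t * (3 * (Mi + M1 + Mt - M0 - 2) * x - s * Q + (s + 1) * (M0 + 2 - 2 * Mi)
          - M1 * (2 * s - 1) + Mt * (s - 2))
      = 3 * (Mi + M1 + Mt - M0 - 2) * (t * x) - (t * s) * Q + (t * s + t) * (M0 + 2 - 2 * Mi)
          - M1 * (2 * (t * s) - t) + Mt * ((t * s) - 2 * t)"
      by (simp add: algebra_simps)
    thus ?thesis unfolding heun_num_def Q s_def[symmetric] P_def[symmetric] * R by (simp add: ts)
  qed
  have n: "t^2 * heun_num (1 / t) Mi M1 Mt M0 (Q / t) x = x^4 * heun_num t M0 M1 Mt Mi Q (1 / x)"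
    unfolding t2 heun_num_homogeneous e by (simp add: power2_eq_square algebra_simps)
  have "1 / x \<noteq> 0" "1 / x \<noteq> 1" "1 / x \<noteq> t" using assms by (auto simp: field_simps)
  note e = heun_inv_num[OF this] heun_inv_num[OF assms(1,2,4)]
  have d: "1 / x * (1 / x - 1) * (1 / x - t) = (x - 1) * (x * t - 1) / x^3"
    "x * (x - 1) * (x - 1 / t) = x * (x - 1) * (x * t - 1) / t"
    using assms by (simp_all add: field_simps power3_eq_cube)
  have nz: "x - 1 \<noteq> 0" "x * t - 1 \<noteq> 0" using assms by (auto simp: field_simps)
  define A B u v where "A = heun_num (1 / t) Mi M1 Mt M0 (Q / t) x" and
    "B = heun_num t M0 M1 Mt Mi Q (1 / x)" and "u = x - 1" and "v = x * t - 1"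
  have A: "A = x^4 * B / t^2" using n assms by (simp add: A_def B_def field_simps)
  show ?thesis unfolding e d A_def[symmetric] B_def[symmetric] unfolding A
    using assms nz unfolding u_def[symmetric] v_def[symmetric]
    by (simp add: power_divide power_mult_distrib field_simps)
qed

text \<open>The substitution t/x is a double transposition of the singular points, so it preserves
  their cross-ratio t; it preserves \<open>Q\<close> too.\<close>

lemma heun_inv_swap_0i_1t:
  assumes "x \<noteq> 0" "x \<noteq> 1" "x \<noteq> t" "t \<noteq> 0"
  shows "heun_inv t Mi Mt M1 M0 Q x = (- t / x^2)^2 * heun_inv t M0 M1 Mt Mi Q (t / x)"
proof -
  have e: "x * (t / x) = t" using assms by simp
  have n: "t^2 * heun_num t Mi Mt M1 M0 Q x = x^4 * heun_num t M0 M1 Mt Mi Q (t / x)"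
    unfolding heun_num_homogeneous e unfolding heun_num_def by (simp add: power2_eq_square algebra_simps)
  have "t / x \<noteq> 0" "t / x \<noteq> 1" "t / x \<noteq> t" using assms by (auto simp: field_simps)
  note e = heun_inv_num[OF this] heun_inv_num[OF assms(1-3)]
  have d: "t / x * (t / x - 1) * (t / x - t) = t^2 * (x - 1) * (x - t) / x^3"
    using assms by (simp_all add: field_simps power3_eq_cube power2_eq_square)
  have nz: "x - 1 \<noteq> 0" "x - t \<noteq> 0" using assms by (auto simp: field_simps)
  define A B u v where "A = heun_num t Mi Mt M1 M0 Q x" and
    "B = heun_num t M0 M1 Mt Mi Q (t / x)" and "u = x - 1" and "v = x - t"
  have A: "A = x^4 * B / t^2" using n assms by (simp add: A_def B_def field_simps)
  show ?thesis unfolding e d A_def[symmetric] B_def[symmetric] unfolding A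
    using assms nz unfolding u_def[symmetric] v_def[symmetric]
    by (simp add: power_divide power_mult_distrib field_simps)
qed

section \<open>Moebius substitution in the covering\<close>

lemma pullback_invI:
  assumes "\<And>x. x \<notin> Z \<Longrightarrow> poly (snd \<phi>) x \<noteq> 0 \<Longrightarrow> rf_eval \<phi> x \<noteq> 0 \<Longrightarrow> rf_eval \<phi> x \<noteq> 1 \<Longrightarrow>
        (rf_eval \<phi> has_field_derivative D x) (at x) \<and> D x \<noteq> 0 \<and>
        (D has_field_derivative N x * D x) (at x) \<and>
        (N has_field_derivative N' x) (at x) \<and>
        I x = (D x)^2 * hg_inv p (rf_eval \<phi> x) + (N' x - (N x)^2 / 2) / 2"
  shows "pullback_inv \<phi> p Z I"
  unfolding pullback_inv_def using assms by blast

definition mob_poly :: "nat \<Rightarrow> complex \<Rightarrow> complex \<Rightarrow> complex \<Rightarrow> complex \<Rightarrow> complex poly \<Rightarrow> complex poly" where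
  "mob_poly n a b c d F = (\<Sum>i\<le>n. smult (coeff F i) ([:b, a:] ^ i * [:d, c:] ^ (n - i)))"

lemma poly_mob_poly:
  assumes "degree F \<le> n" "c * x + d \<noteq> 0"
  shows "poly (mob_poly n a b c d F) x = (c * x + d) ^ n * poly F ((a * x + b) / (c * x + d))"
proof -
  have "poly F ((a * x + b) / (c * x + d)) = (\<Sum>i\<le>n. coeff F i * ((a * x + b) / (c * x + d)) ^ i)"
    unfolding poly_altdef using assms(1)
    by (intro sum.mono_neutral_left) (auto simp: coeff_eq_0)
  hence "(c * x + d) ^ n * poly F ((a * x + b) / (c * x + d))
      = (\<Sum>i\<le>n. coeff F i * ((c * x + d) ^ n * ((a * x + b) / (c * x + d)) ^ i))"
    by (simp add: sum_distrib_left mult_ac)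
  also have "\<dots> = (\<Sum>i\<le>n. coeff F i * ((a * x + b) ^ i * (c * x + d) ^ (n - i)))"
    using assms(2) by (intro sum.cong refl) (simp add: power_divide power_diff)
  finally show ?thesis
    by (simp add: mob_poly_def poly_sum algebra_simps)
qed

text \<open>Numerator and denominator are homogenized in the same degree \<open>n\<close>, so that
  the powers of c x + d cancel in the quotient.\<close>

definition mob_ratfun :: "complex \<Rightarrow> complex \<Rightarrow> complex \<Rightarrow> complex \<Rightarrow> ratfun \<Rightarrow> ratfun" where
  "mob_ratfun a b c d \<phi> = (let n = max (degree (fst \<phi>)) (degree (snd \<phi>))
     in (mob_poly n a b c d (fst \<phi>), mob_poly n a b c d (snd \<phi>)))"

lemma mob_ratfun:
  assumes "c * x + d \<noteq> 0"
  shows "poly (snd (mob_ratfun a b c d \<phi>)) x = 0 \<longleftrightarrow> poly (snd \<phi>) ((a * x + b) / (c * x + d)) = 0"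
    and "rf_eval (mob_ratfun a b c d \<phi>) x = rf_eval \<phi> ((a * x + b) / (c * x + d))"
  using assms by (simp_all add: mob_ratfun_def Let_def rf_eval_def poly_mob_poly)

lemma regular_point_mob:
  assumes "regular_point \<phi> Z ((a * x + b) / (c * x + d))" "x \<notin> Z'" "c * x + d \<noteq> 0"
  shows "regular_point (mob_ratfun a b c d \<phi>) Z' x"
  using assms by (simp add: regular_point_def mob_ratfun)

text \<open>The Schwarzian of a Moebius transformation is zero. By the chain rule the invariant of
  the composed covering is therefore the old one at the transformed point, times the square of the
  derivative.\<close>

lemma pullback_inv_mob:
  assumes inv: "pullback_inv \<phi> p Z I" and det: "a * d - b * c \<noteq> 0"
    and Z': "\<And>x. x \<notin> Z' \<Longrightarrow> c * x + d \<noteq> 0 \<and> (a * x + b) / (c * x + d) \<notin> Z"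
    and I': "\<And>x. x \<notin> Z' \<Longrightarrow>
      I' x = ((a * d - b * c) / (c * x + d)^2)^2 * I ((a * x + b) / (c * x + d))"
  shows "pullback_inv (mob_ratfun a b c d \<phi>) p Z' I'"
proof -
  define \<mu> where "\<mu> = (\<lambda>x. (a * x + b) / (c * x + d))"
  define \<mu>1 where "\<mu>1 = (\<lambda>x. (a * d - b * c) / (c * x + d)^2)"
  \<comment> \<open>\<open>\<nu>\<close> is the logarithmic derivative of \<open>\<mu>1\<close>, and
    \<open>\<nu>1\<close> is the derivative of \<open>\<nu>\<close>; the vanishing Schwarzian is the
    identity \<open>\<nu>1\<close> = \<open>\<nu>\<close>^2/2 below.\<close>
  define \<nu> where "\<nu> = (\<lambda>x. - 2 * c / (c * x + d))"
  define \<nu>1 where "\<nu>1 = (\<lambda>x. 2 * c^2 / (c * x + d)^2)"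
  let ?\<psi> = "mob_ratfun a b c d \<phi>"
  obtain D N N' where *: "\<And>x. x \<notin> Z \<Longrightarrow> poly (snd \<phi>) x \<noteq> 0 \<Longrightarrow> rf_eval \<phi> x \<noteq> 0 \<Longrightarrow> rf_eval \<phi> x \<noteq> 1 \<Longrightarrow>
        (rf_eval \<phi> has_field_derivative D x) (at x) \<and> D x \<noteq> 0 \<and>
        (D has_field_derivative N x * D x) (at x) \<and>
        (N has_field_derivative N' x) (at x) \<and>
        I x = (D x)^2 * hg_inv p (rf_eval \<phi> x) + (N' x - (N x)^2 / 2) / 2"
    using inv unfolding pullback_inv_def by blast
  have "(rf_eval ?\<psi> has_field_derivative D (\<mu> x) * \<mu>1 x) (at x) \<and> D (\<mu> x) * \<mu>1 x \<noteq> 0 \<and>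
      ((\<lambda>x. D (\<mu> x) * \<mu>1 x) has_field_derivative
         (N (\<mu> x) * \<mu>1 x + \<nu> x) * (D (\<mu> x) * \<mu>1 x)) (at x) \<and>
      ((\<lambda>x. N (\<mu> x) * \<mu>1 x + \<nu> x) has_field_derivative
         N' (\<mu> x) * (\<mu>1 x)^2 + N (\<mu> x) * (\<nu> x * \<mu>1 x) + \<nu>1 x) (at x) \<and>
      I' x = (D (\<mu> x) * \<mu>1 x)^2 * hg_inv p (rf_eval ?\<psi> x)
        + (N' (\<mu> x) * (\<mu>1 x)^2 + N (\<mu> x) * (\<nu> x * \<mu>1 x) + \<nu>1 x
            - (N (\<mu> x) * \<mu>1 x + \<nu> x)^2 / 2) / 2"
    if x: "x \<notin> Z'" "poly (snd ?\<psi>) x \<noteq> 0" "rf_eval ?\<psi> x \<noteq> 0" "rf_eval ?\<psi> x \<noteq> 1" for x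
  proof -
    have nz: "c * x + d \<noteq> 0" and "\<mu> x \<notin> Z" using Z'[OF x(1)] by (auto simp: \<mu>_def)
    with x have \<mu>x: "\<mu> x \<notin> Z" "poly (snd \<phi>) (\<mu> x) \<noteq> 0" "rf_eval \<phi> (\<mu> x) \<noteq> 0" "rf_eval \<phi> (\<mu> x) \<noteq> 1"
      by (simp_all add: mob_ratfun \<mu>_def)
    note D = *[OF \<mu>x]
    have d\<mu>: "(\<mu> has_field_derivative \<mu>1 x) (at x)"
      unfolding \<mu>_def \<mu>1_def using nz
      by (auto intro!: derivative_eq_intros simp: field_simps power2_eq_square)
    have dy: "((\<lambda>x. c * x + d) has_field_derivative c) (at x)"
      by (auto intro!: derivative_eq_intros)
    have d\<mu>1: "(\<mu>1 has_field_derivative \<nu> x * \<mu>1 x) (at x)"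
    proof -
      have y: "(0 * y^2 - (a * d - b * c) * (2 * (c * y))) / (y^2 * y^2)
        = - 2 * c / y * ((a * d - b * c) / y^2)" if "y \<noteq> 0" for y
        using that by (simp add: power2_eq_square divide_simps)
      show ?thesis unfolding \<mu>1_def \<nu>_def y[OF nz, symmetric]
        using nz by (intro DERIV_divide DERIV_const DERIV_cong[OF DERIV_power[OF dy]]) auto
    qed
    have d\<nu>: "(\<nu> has_field_derivative \<nu>1 x) (at x)"
    proof -
      have y: "(0 * y - (- 2 * c) * c) / (y * y) = 2 * c^2 / y^2" for y
        by (simp add: power2_eq_square)
      show ?thesis unfolding \<nu>1_def \<nu>_def y[symmetric]
        using nz by (intro DERIV_divide DERIV_const dy) auto
    qed
    have opn: "open {x. c * x + d \<noteq> 0}"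
      by (intro open_Collect_neq continuous_intros)
    have 1: "(rf_eval ?\<psi> has_field_derivative D (\<mu> x) * \<mu>1 x) (at x)"
    proof (rule has_field_derivative_transform_within_open[OF _ opn])
      show "((\<lambda>x. rf_eval \<phi> (\<mu> x)) has_field_derivative D (\<mu> x) * \<mu>1 x) (at x)"
        by (rule DERIV_chain2[OF _ d\<mu>]) (use D in blast)
    qed (use nz in \<open>auto simp: mob_ratfun \<mu>_def\<close>)
    have dD: "((\<lambda>x. D (\<mu> x)) has_field_derivative N (\<mu> x) * D (\<mu> x) * \<mu>1 x) (at x)"
      by (rule DERIV_chain2[OF _ d\<mu>]) (use D in blast)
    have dN: "((\<lambda>x. N (\<mu> x)) has_field_derivative N' (\<mu> x) * \<mu>1 x) (at x)"
      by (rule DERIV_chain2[OF _ d\<mu>]) (use D in blast)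
    have 2: "((\<lambda>x. D (\<mu> x) * \<mu>1 x) has_field_derivative
         (N (\<mu> x) * \<mu>1 x + \<nu> x) * (D (\<mu> x) * \<mu>1 x)) (at x)"
      by (rule DERIV_cong[OF DERIV_mult[OF dD d\<mu>1]]) (simp add: algebra_simps)
    have 3: "((\<lambda>x. N (\<mu> x) * \<mu>1 x + \<nu> x) has_field_derivative
         N' (\<mu> x) * (\<mu>1 x)^2 + N (\<mu> x) * (\<nu> x * \<mu>1 x) + \<nu>1 x) (at x)"
      by (rule DERIV_cong[OF DERIV_add[OF DERIV_mult[OF dN d\<mu>1] d\<nu>]])
         (simp add: algebra_simps power2_eq_square)
    have schw: "\<nu>1 x = (\<nu> x)^2 / 2" by (simp add: \<nu>1_def \<nu>_def power_divide power_mult_distrib)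
    have ev: "rf_eval ?\<psi> x = rf_eval \<phi> (\<mu> x)" using nz by (simp add: mob_ratfun \<mu>_def)
    have "I' x = (\<mu>1 x)^2 * I (\<mu> x)" using I'[OF x(1)] by (simp add: \<mu>1_def \<mu>_def)
    hence I: "I' x = (\<mu>1 x)^2 * ((D (\<mu> x))^2 * hg_inv p (rf_eval \<phi> (\<mu> x))
        + (N' (\<mu> x) - (N (\<mu> x))^2 / 2) / 2)" using D by simp
    define u v w n n' k where "u = D (\<mu> x)" "v = \<mu>1 x" "w = hg_inv p (rf_eval \<phi> (\<mu> x))"
      "n = N (\<mu> x)" "n' = N' (\<mu> x)" "k = \<nu> x"
    have 4: "I' x = (D (\<mu> x) * \<mu>1 x)^2 * hg_inv p (rf_eval ?\<psi> x)
        + (N' (\<mu> x) * (\<mu>1 x)^2 + N (\<mu> x) * (\<nu> x * \<mu>1 x) + \<nu>1 x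
            - (N (\<mu> x) * \<mu>1 x + \<nu> x)^2 / 2) / 2"
      unfolding I ev schw u_v_w_n_n'_k_def[symmetric] by (simp add: power2_eq_square field_simps)
    have "\<mu>1 x \<noteq> 0" using nz det by (simp add: \<mu>1_def)
    thus ?thesis using 1 2 3 4 D by auto
  qed
  thus ?thesis
    by (rule pullback_invI[where D = "\<lambda>x. D (\<mu> x) * \<mu>1 x" and N = "\<lambda>x. N (\<mu> x) * \<mu>1 x + \<nu> x"
          and N' = "\<lambda>x. N' (\<mu> x) * (\<mu>1 x)^2 + N (\<mu> x) * (\<nu> x * \<mu>1 x) + \<nu>1 x"])
qed

text \<open>A single covering serves every member of the family. The functions \<open>m0\<close>,
  ..., \<open>mi\<close> are exponent differences rather than their squares, because the Heun
  parameters are continuous functions of the former and roots would have to be chosen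
  continuously.\<close>

definition realizable ::
  "hg_sing set \<Rightarrow> (hg_sing \<Rightarrow> complex) \<Rightarrow> complex \<Rightarrow> (hg_params \<Rightarrow> complex) \<Rightarrow> (hg_params \<Rightarrow> complex)
    \<Rightarrow> (hg_params \<Rightarrow> complex) \<Rightarrow> (hg_params \<Rightarrow> complex) \<Rightarrow> (hg_params \<Rightarrow> complex) \<Rightarrow> bool" where
  "realizable S \<epsilon> t m0 m1 mt mi r \<longleftrightarrow>
     continuous_on (hg_family S \<epsilon>) m0 \<and> continuous_on (hg_family S \<epsilon>) m1 \<and>
     continuous_on (hg_family S \<epsilon>) mt \<and> continuous_on (hg_family S \<epsilon>) mi \<and>
     continuous_on (hg_family S \<epsilon>) r \<and>
     (\<exists>\<phi>. (\<exists>x. regular_point \<phi> {0, 1, t} x) \<and> (\<forall>p \<in> hg_family S \<epsilon>. pullback_inv \<phi> p {0, 1, t}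
        (heun_inv t ((m0 p)^2) ((m1 p)^2) ((mt p)^2) ((mi p)^2) (r p))))"

lemma realizable_mob:
  assumes R: "realizable S \<epsilon> t m0 m1 mt mi r" and det: "a * d - b * c \<noteq> 0"
    and Z': "\<And>x. x \<notin> {0, 1, t'} \<Longrightarrow> c * x + d \<noteq> 0 \<and> (a * x + b) / (c * x + d) \<notin> {0, 1, t}"
    and surj: "\<And>y. y \<notin> {0, 1, t} \<Longrightarrow> \<exists>x. x \<notin> {0, 1, t'} \<and> (a * x + b) / (c * x + d) = y"
    and cont: "continuous_on (hg_family S \<epsilon>) n0" "continuous_on (hg_family S \<epsilon>) n1"
      "continuous_on (hg_family S \<epsilon>) nt" "continuous_on (hg_family S \<epsilon>) ni"
      "continuous_on (hg_family S \<epsilon>) r'"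
    and I': "\<And>x p. x \<notin> {0, 1, t'} \<Longrightarrow> p \<in> hg_family S \<epsilon> \<Longrightarrow>
      heun_inv t' ((n0 p)^2) ((n1 p)^2) ((nt p)^2) ((ni p)^2) (r' p) x
      = ((a * d - b * c) / (c * x + d)^2)^2
        * heun_inv t ((m0 p)^2) ((m1 p)^2) ((mt p)^2) ((mi p)^2) (r p) ((a * x + b) / (c * x + d))"
  shows "realizable S \<epsilon> t' n0 n1 nt ni r'"
proof -
  obtain \<phi> y where y: "regular_point \<phi> {0, 1, t} y" and P: "\<And>p. p \<in> hg_family S \<epsilon> \<Longrightarrow>
      pullback_inv \<phi> p {0, 1, t} (heun_inv t ((m0 p)^2) ((m1 p)^2) ((mt p)^2) ((mi p)^2) (r p))"
    using R unfolding realizable_def by blast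
  have y01t: "y \<notin> {0, 1, t}" using y unfolding regular_point_def by (rule conjunct1)
  \<comment> \<open>The regular point of \<open>\<phi>\<close> is carried back along the
    transformation.\<close>
  obtain x where x: "x \<notin> {0, 1, t'}" "(a * x + b) / (c * x + d) = y"
    using surj[OF y01t] by (elim exE conjE)
  have "regular_point (mob_ratfun a b c d \<phi>) {0, 1, t'} x"
    by (rule regular_point_mob[OF _ x(1)]) (use y x(2) Z'[OF x(1)] in simp_all)
  moreover have "pullback_inv (mob_ratfun a b c d \<phi>) p {0, 1, t'}
      (heun_inv t' ((n0 p)^2) ((n1 p)^2) ((nt p)^2) ((ni p)^2) (r' p))"
    if "p \<in> hg_family S \<epsilon>" for p
    by (rule pullback_inv_mob[OF P[OF that] det Z' I'[OF _ that]])
  ultimately show ?thesis unfolding realizable_def using cont by blast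
qed

text \<open>Keeps only the values at one member of a realizable family. Squares suffice here, since
  signs are adjusted at the very end.\<close>

definition attained ::
  "complex \<Rightarrow> complex \<Rightarrow> complex \<Rightarrow> complex \<Rightarrow> complex \<Rightarrow> complex \<Rightarrow> bool" where
  "attained t M0 M1 Mt Mi Q \<longleftrightarrow> (\<exists>S \<epsilon> m0 m1 mt mi r p. S \<noteq> {} \<and> realizable S \<epsilon> t m0 m1 mt mi r \<and>
     p \<in> hg_family S \<epsilon> \<and> M0 = (m0 p)^2 \<and> M1 = (m1 p)^2 \<and> Mt = (mt p)^2 \<and> Mi = (mi p)^2 \<and> Q = r p)"

lemma attainedI:
  assumes "realizable S \<epsilon> t m0 m1 mt mi r" "S \<noteq> {}" "p \<in> hg_family S \<epsilon>"
    "M0 = (m0 p)^2" "M1 = (m1 p)^2" "Mt = (mt p)^2" "Mi = (mi p)^2" "Q = r p"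
  shows "attained t M0 M1 Mt Mi Q"
  unfolding attained_def using assms by blast

lemma attainedE:
  assumes "attained t M0 M1 Mt Mi Q"
  obtains S \<epsilon> m0 m1 mt mi r p where "S \<noteq> {}" "realizable S \<epsilon> t m0 m1 mt mi r"
     "p \<in> hg_family S \<epsilon>" "M0 = (m0 p)^2" "M1 = (m1 p)^2" "Mt = (mt p)^2" "Mi = (mi p)^2" "Q = r p"
  using assms unfolding attained_def by blast

lemma attained_one_minus:
  assumes "attained t M0 M1 Mt Mi Q"
  shows "attained (1 - t) M1 M0 Mt Mi (- Q)"
proof -
  obtain S \<epsilon> m0 m1 mt mi r p where A: "S \<noteq> {}" "realizable S \<epsilon> t m0 m1 mt mi r"
     "p \<in> hg_family S \<epsilon>" "M0 = (m0 p)^2" "M1 = (m1 p)^2" "Mt = (mt p)^2" "Mi = (mi p)^2" "Q = r p"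
    using attainedE[OF assms] by blast
  have "realizable S \<epsilon> (1 - t) m1 m0 mt mi (\<lambda>p. - r p)"
  proof (rule realizable_mob[OF A(2), where a = "-1" and b = 1 and c = 0 and d = 1])
    show "\<exists>x. x \<notin> {0, 1, 1 - t} \<and> (- 1 * x + 1) / (0 * x + 1) = y" if "y \<notin> {0, 1, t}" for y
      using that by (intro exI[of _ "1 - y"]) (auto simp: algebra_simps)
    show "heun_inv (1 - t) ((m1 q)^2) ((m0 q)^2) ((mt q)^2) ((mi q)^2) (- r q) x
      = ((- 1 * 1 - 1 * 0) / (0 * x + 1)^2)^2
        * heun_inv t ((m0 q)^2) ((m1 q)^2) ((mt q)^2) ((mi q)^2) (r q) ((- 1 * x + 1) / (0 * x + 1))"
      for x q by (simp add: heun_inv_one_minus)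
  qed (use A(2) in \<open>auto simp: realizable_def algebra_simps intro!: continuous_intros\<close>)
  thus ?thesis by (rule attainedI[OF _ A(1,3)]) (simp_all add: A)
qed

lemma attained_inverse:
  assumes "attained t M0 M1 Mt Mi Q" and t: "t \<noteq> 0"
  shows "attained (1 / t) Mi M1 Mt M0 (Q / t)"
proof -
  obtain S \<epsilon> m0 m1 mt mi r p where A: "S \<noteq> {}" "realizable S \<epsilon> t m0 m1 mt mi r"
     "p \<in> hg_family S \<epsilon>" "M0 = (m0 p)^2" "M1 = (m1 p)^2" "Mt = (mt p)^2" "Mi = (mi p)^2" "Q = r p"
    using attainedE[OF assms(1)] by blast
  have "realizable S \<epsilon> (1 / t) mi m1 mt m0 (\<lambda>p. r p / t)"
  proof (rule realizable_mob[OF A(2), where a = 0 and b = 1 and c = 1 and d = 0])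
    show "\<exists>x. x \<notin> {0, 1, 1 / t} \<and> (0 * x + 1) / (1 * x + 0) = y" if "y \<notin> {0, 1, t}" for y
      using that by (intro exI[of _ "1 / y"]) (auto simp: field_simps)
    show "heun_inv (1 / t) ((mi q)^2) ((m1 q)^2) ((mt q)^2) ((m0 q)^2) (r q / t) x
      = ((0 * 0 - 1 * 1) / (1 * x + 0)^2)^2
        * heun_inv t ((m0 q)^2) ((m1 q)^2) ((mt q)^2) ((mi q)^2) (r q) ((0 * x + 1) / (1 * x + 0))"
      if "x \<notin> {0, 1, 1 / t}" for x q
      using that t by (simp add: heun_inv_inverse)
  qed (use A(2) t in \<open>auto simp: realizable_def field_simps intro!: continuous_intros\<close>)
  thus ?thesis by (rule attainedI[OF _ A(1,3)]) (simp_all add: A)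
qed

lemma attained_swap_0i_1t:
  assumes "attained t M0 M1 Mt Mi Q" and t: "t \<noteq> 0"
  shows "attained t Mi Mt M1 M0 Q"
proof -
  obtain S \<epsilon> m0 m1 mt mi r p where A: "S \<noteq> {}" "realizable S \<epsilon> t m0 m1 mt mi r"
     "p \<in> hg_family S \<epsilon>" "M0 = (m0 p)^2" "M1 = (m1 p)^2" "Mt = (mt p)^2" "Mi = (mi p)^2" "Q = r p"
    using attainedE[OF assms(1)] by blast
  have "realizable S \<epsilon> t mi mt m1 m0 r"
  proof (rule realizable_mob[OF A(2), where a = 0 and b = t and c = 1 and d = 0])
    show "\<exists>x. x \<notin> {0, 1, t} \<and> (0 * x + t) / (1 * x + 0) = y" if "y \<notin> {0, 1, t}" for y
      using that t by (intro exI[of _ "t / y"]) (auto simp: field_simps)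
    show "heun_inv t ((mi q)^2) ((mt q)^2) ((m1 q)^2) ((m0 q)^2) (r q) x
      = ((0 * 0 - t * 1) / (1 * x + 0)^2)^2
        * heun_inv t ((m0 q)^2) ((m1 q)^2) ((mt q)^2) ((mi q)^2) (r q) ((0 * x + t) / (1 * x + 0))"
      if "x \<notin> {0, 1, t}" for x q
      using that t by (simp add: heun_inv_swap_0i_1t)
  qed (use A(2) t in \<open>auto simp: realizable_def field_simps\<close>)
  thus ?thesis by (rule attainedI[OF _ A(1,3)]) (simp_all add: A)
qed

text \<open>The previous double transposition conjugated by 1 - x. The two generate the Klein
  four-group on 0, 1, t, infinity, all with the same t and the same \<open>Q\<close>.\<close>

lemma attained_swap_0t_1i:
  assumes "attained t M0 M1 Mt Mi Q" and t: "t \<noteq> 1"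
  shows "attained t Mt Mi M0 M1 Q"
proof -
  have "attained (1 - t) Mi Mt M0 M1 (- Q)"
    using attained_swap_0i_1t[OF attained_one_minus[OF assms(1)]] t by simp
  from attained_one_minus[OF this] show ?thesis by simp
qed

lemma square_eq_sign:
  fixes x y :: complex
  assumes "x^2 = y^2"
  obtains s where "s^2 = 1" "x = s * y"
  using assms by (metis power2_eq_iff mult_1 mult_minus1 power2_minus one_power2)

text \<open>The signs relating the exponent differences of \<open>h\<close> to those of the realized
  family at \<open>p0\<close> are chosen once and kept for all parameters. Hence \<open>H\<close> is
  continuous and goes through \<open>h\<close> at \<open>p0\<close>.\<close>

lemma specialization_if_attained:
  assumes "attained t ((e_0 h)^2) ((e_1 h)^2) ((e_t h)^2) ((e_inf h)^2) (Q0 t h)"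
  shows "specialization_of_parametric_pullback t h"
proof -
  obtain S \<epsilon> m0 m1 mt mi r p0 where A: "S \<noteq> {}" "realizable S \<epsilon> t m0 m1 mt mi r"
     "p0 \<in> hg_family S \<epsilon>" "(e_0 h)^2 = (m0 p0)^2" "(e_1 h)^2 = (m1 p0)^2" "(e_t h)^2 = (mt p0)^2"
     "(e_inf h)^2 = (mi p0)^2" "Q0 t h = r p0"
    using attainedE[OF assms(1)] by blast
  obtain s0 where s0: "s0^2 = 1" "e_0 h = s0 * m0 p0" using square_eq_sign[OF A(4)] by blast
  obtain s1 where s1: "s1^2 = 1" "e_1 h = s1 * m1 p0" using square_eq_sign[OF A(5)] by blast
  obtain st where st: "st^2 = 1" "e_t h = st * mt p0" using square_eq_sign[OF A(6)] by blast
  obtain si where si: "si^2 = 1" "e_inf h = si * mi p0" using square_eq_sign[OF A(7)] by blast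
  \<comment> \<open>This inverts the passage from Heun parameters to exponent differences and
    \<open>Q0\<close>: \<open>s\<close> is a + b, its splitting uses b - a = \<open>Ei\<close>, and
    the first entry solves \<open>Q0\<close> = \<open>r p\<close> for the accessory
    parameter.\<close>
  define H :: "hg_params \<Rightarrow> heun_params" where
    "H = (\<lambda>p. let E0 = s0 * m0 p; E1 = s1 * m1 p; Et = st * mt p; Ei = si * mi p;
              s = 2 - E0 - E1 - Et
         in ((r p + 6 * (E0 - 1) * (E1 * t + Et) - (Ei^2 - 2 * (E0 - 1) * (E0 - 2)) * (t + 1)
               + E1^2 * (2 * t - 1) - Et^2 * (t - 2)) / 12,
             (s - Ei) / 2, (s + Ei) / 2, 1 - E0, 1 - E1))"
  have e: "e_0 (H p) = s0 * m0 p" "e_1 (H p) = s1 * m1 p" "e_t (H p) = st * mt p"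
    "e_inf (H p) = si * mi p" for p
    by (simp_all add: H_def Let_def field_simps)
  have q: "Q0 t (H p) = r p" for p
  proof -
    have a: "12 * accessory (H p) = r p + 6 * (s0 * m0 p - 1) * (s1 * m1 p * t + st * mt p)
        - ((si * mi p)^2 - 2 * (s0 * m0 p - 1) * (s0 * m0 p - 2)) * (t + 1)
        + (s1 * m1 p)^2 * (2 * t - 1) - (st * mt p)^2 * (t - 2)"
      by (simp add: H_def Let_def)
    show ?thesis unfolding Q0_def e a by simp
  qed
  obtain \<phi> x where x: "regular_point \<phi> {0, 1, t} x" and P: "\<And>p. p \<in> hg_family S \<epsilon> \<Longrightarrow>
      pullback_inv \<phi> p {0, 1, t} (heun_inv t ((m0 p)^2) ((m1 p)^2) ((mt p)^2) ((mi p)^2) (r p))"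
    and cont: "continuous_on (hg_family S \<epsilon>) m0" "continuous_on (hg_family S \<epsilon>) m1"
     "continuous_on (hg_family S \<epsilon>) mt" "continuous_on (hg_family S \<epsilon>) mi"
     "continuous_on (hg_family S \<epsilon>) r"
    using A(2) unfolding realizable_def by blast
  have "is_pullback \<phi> p t (H p)" if "p \<in> hg_family S \<epsilon>" for p
  proof (rule is_pullback_if_pullback_inv[OF _ x])
    have "(e_0 (H p))^2 = (m0 p)^2" "(e_1 (H p))^2 = (m1 p)^2" "(e_t (H p))^2 = (mt p)^2"
      "(e_inf (H p))^2 = (mi p)^2"
      unfolding e power_mult_distrib s0(1) s1(1) st(1) si(1) by simp_all
    thus "pullback_inv \<phi> p {0, 1, t} (heun_inv t ((e_0 (H p))^2) ((e_1 (H p))^2) ((e_t (H p))^2)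
        ((e_inf (H p))^2) (Q0 t (H p)))"
      using P[OF that] by (simp add: q)
  qed
  moreover have "continuous_on (hg_family S \<epsilon>) H"
    unfolding H_def Let_def by (intro continuous_intros cont) auto
  ultimately have "parametric_pullback \<phi> S \<epsilon> t H"
    using A(1) by (simp add: parametric_pullback_def)
  moreover have "h = H p0"
  proof -
    obtain q a b c d where h: "h = (q, a, b, c, d)" by (metis prod.exhaust)
    have c: "c = 1 - s0 * m0 p0" and d: "d = 1 - s1 * m1 p0"
      using s0(2) s1(2) by (simp_all add: h algebra_simps)
    have ab: "a + b = 2 - s0 * m0 p0 - s1 * m1 p0 - st * mt p0" "b - a = si * mi p0"
      using st(2) si(2) by (simp_all add: h c d algebra_simps)
    have "b = ((a + b) + (b - a)) / 2" "a = ((a + b) - (b - a)) / 2" by simp_all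
    hence b: "b = (2 - s0 * m0 p0 - s1 * m1 p0 - st * mt p0 + si * mi p0) / 2"
      "a = (2 - s0 * m0 p0 - s1 * m1 p0 - st * mt p0 - si * mi p0) / 2"
      unfolding ab by simp_all
    have "12 * q = r p0 + 6 * (s0 * m0 p0 - 1) * (s1 * m1 p0 * t + st * mt p0)
        - ((si * mi p0)^2 - 2 * (s0 * m0 p0 - 1) * (s0 * m0 p0 - 2)) * (t + 1)
        + (s1 * m1 p0)^2 * (2 * t - 1) - (st * mt p0)^2 * (t - 2)"
      using A(8) unfolding Q0_def s0(2) s1(2) st(2) si(2) by (simp add: h algebra_simps)
    thus ?thesis unfolding h H_def Let_def by (simp add: b c d field_simps)
  qed
  ultimately show ?thesis unfolding specialization_of_parametric_pullback_def using A(3) by blast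
qed

section \<open>Coverings with prescribed ramification\<close>

definition has_log_deriv :: "(complex \<Rightarrow> complex) \<Rightarrow> complex \<Rightarrow> complex \<Rightarrow> bool" where
  "has_log_deriv h l x \<longleftrightarrow> (h has_field_derivative h x * l) (at x)"

lemma log_deriv_const: "has_log_deriv (\<lambda>x. c) 0 x"
  by (simp add: has_log_deriv_def)

lemma log_deriv_linear: "x \<noteq> w \<Longrightarrow> has_log_deriv (\<lambda>x. x - w) (1 / (x - w)) x"
  by (auto simp: has_log_deriv_def intro!: derivative_eq_intros)

lemma log_deriv_poly: "poly f x \<noteq> 0 \<Longrightarrow> has_log_deriv (poly f) (poly (pderiv f) x / poly f x) x"
  by (simp add: has_log_deriv_def poly_DERIV)

lemma log_deriv_mult:
  "has_log_deriv f k x \<Longrightarrow> has_log_deriv g l x \<Longrightarrow> has_log_deriv (\<lambda>x. f x * g x) (k + l) x"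
  unfolding has_log_deriv_def by (rule DERIV_cong[OF DERIV_mult]) (auto simp: algebra_simps)

lemma log_deriv_divide:
  "has_log_deriv f k x \<Longrightarrow> has_log_deriv g l x \<Longrightarrow> g x \<noteq> 0 \<Longrightarrow>
     has_log_deriv (\<lambda>x. f x / g x) (k - l) x"
  unfolding has_log_deriv_def
  by (rule DERIV_cong[OF DERIV_divide]) (auto simp: field_simps)

lemma log_deriv_power:
  assumes "has_log_deriv f k x"
  shows "has_log_deriv (\<lambda>x. f x ^ n) (of_nat n * k) x"
proof (induction n)
  case 0
  show ?case using log_deriv_const[of 1] by simp
next
  case (Suc n)
  from log_deriv_mult[OF assms Suc] show ?case by (simp add: algebra_simps)
qed

lemma log_deriv_unique:
  assumes "has_log_deriv h k x" "(h has_field_derivative d) (at x)"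
  shows "d = h x * k"
  using assms DERIV_unique unfolding has_log_deriv_def by blast

text \<open>The exponent of x - w in the factor belonging to the fibre over \<open>z\<close>, for a
  point w over \<open>z'\<close> with multiplicity \<open>m\<close>.\<close>

definition over :: "hg_sing \<Rightarrow> hg_sing \<Rightarrow> nat \<Rightarrow> nat" where
  "over z z' m = (if z' = z then m else 0)"

text \<open>The order of phi - 1 at a point over the given value.\<close>

fun one_inf_order :: "hg_sing \<Rightarrow> nat \<Rightarrow> complex" where
  "one_inf_order HG_Zero m = 0"
| "one_inf_order HG_One m = of_nat m"
| "one_inf_order HG_Infinity m = - of_nat m"

text \<open>One minus the sum of the local exponents of y(phi) without prefactor, that is, the
  residue of its first-order coefficient: the exponents are 0 and m e0 over 0, 0 and m e1 over 1,
  and m A, m B over infinity, where A + B = 1 - e0 - e1.\<close>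

fun res_coeff :: "complex \<Rightarrow> complex \<Rightarrow> hg_sing \<Rightarrow> nat \<Rightarrow> complex" where
  "res_coeff e0 e1 HG_Zero m = 1 - of_nat m * e0"
| "res_coeff e0 e1 HG_One m = 1 - of_nat m * e1"
| "res_coeff e0 e1 HG_Infinity m = 1 + of_nat m * (e0 + e1 - 1)"

text \<open>Let u = phi'/phi and v = phi'/(phi - 1). Without prefactor, y(phi) satisfies Y'' + L Y'
  + A B u v Y = 0 with L = C u + E v - phi''/phi', and the right-hand side is the invariant of that
  equation for L2 = -L'. The bracket on the left is the derivative of N.\<close>

lemma invariant_of_log_derivs:
  fixes u v N L L2 :: complex
  assumes "N = C * u + E * v - L"
  shows "A * B * (u * v) + (C * u^2 + E * v^2) / 2 - (C * u + E * v)^2 / 4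
      + (C * (u * N - u^2) + E * (v * N - v^2) + L2 - N^2 / 2) / 2
    = L2 / 2 - L^2 / 4 + A * B * (u * v)"
  unfolding assms by (simp add: power2_eq_square field_simps)

text \<open>The finite singular point \<open>wi\<close> lies over \<open>zi\<close> with multiplicity \<open>mi\<close>; the assumption
  \<open>deriv\<close> says that the logarithmic derivative of \<open>\<phi> - 1\<close> vanishes only over 0.\<close>
locale covering =
  fixes g f :: "complex poly" and k0 k1 :: nat and c0 c1 \<kappa> :: complex
    and w1 w2 w3 :: complex and z1 z2 z3 :: hg_sing and m1 m2 m3 :: nat
  assumes nz: "g \<noteq> 0" "f \<noteq> 0" "c0 \<noteq> 0" "c1 \<noteq> 0" "\<kappa> \<noteq> 0"
    and k: "k0 \<ge> 2" "k1 \<ge> 2"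
    and w: "w1 \<noteq> w2" "w1 \<noteq> w3" "w2 \<noteq> w3"
    and factor: "\<And>x. c0 * poly g x ^ k0 * (x - w1) ^ over HG_Zero z1 m1 *
          (x - w2) ^ over HG_Zero z2 m2 * (x - w3) ^ over HG_Zero z3 m3
        = (x - w1) ^ over HG_Infinity z1 m1 * (x - w2) ^ over HG_Infinity z2 m2 *
          (x - w3) ^ over HG_Infinity z3 m3
        + c1 * poly f x ^ k1 * (x - w1) ^ over HG_One z1 m1 *
          (x - w2) ^ over HG_One z2 m2 * (x - w3) ^ over HG_One z3 m3"
    and deriv: "\<And>x. of_nat k1 * poly (pderiv f) x * ((x - w1) * (x - w2) * (x - w3))
        + poly f x * (one_inf_order z1 m1 * ((x - w2) * (x - w3))
            + one_inf_order z2 m2 * ((x - w1) * (x - w3)) + one_inf_order z3 m3 * ((x - w1) * (x - w2)))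
        = \<kappa> * poly g x ^ (k0 - 1) * ((x - w1) ^ over HG_Zero z1 m1 *
          (x - w2) ^ over HG_Zero z2 m2 * (x - w3) ^ over HG_Zero z3 m3)"
begin

definition B0 :: "complex \<Rightarrow> complex" where
  "B0 x = (x - w1) ^ over HG_Zero z1 m1 * (x - w2) ^ over HG_Zero z2 m2 * (x - w3) ^ over HG_Zero z3 m3"

definition B1 :: "complex \<Rightarrow> complex" where
  "B1 x = (x - w1) ^ over HG_One z1 m1 * (x - w2) ^ over HG_One z2 m2 * (x - w3) ^ over HG_One z3 m3"

definition Gp :: "complex poly" where
  "Gp = [:-w1, 1:] ^ over HG_Infinity z1 m1 * [:-w2, 1:] ^ over HG_Infinity z2 m2 *
     [:-w3, 1:] ^ over HG_Infinity z3 m3"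

definition Kp :: "complex poly" where
  "Kp = smult c1 (f ^ k1 * [:-w1, 1:] ^ over HG_One z1 m1 * [:-w2, 1:] ^ over HG_One z2 m2 *
     [:-w3, 1:] ^ over HG_One z3 m3)"

definition \<phi> :: ratfun where "\<phi> = (Gp + Kp, Gp)"

definition S :: "complex \<Rightarrow> complex" where "S x = (x - w1) * (x - w2) * (x - w3)"

text \<open>The product u v = phi'^2 / (phi (phi - 1)) multiplied by \<open>S\<close>^2. It is a
  polynomial because \<open>k0\<close> and \<open>k1\<close> are at least 2.\<close>

definition W :: "complex \<Rightarrow> complex" where
  "W x = \<kappa>^2 * (c1 / c0) * poly f x ^ (k1 - 2) * poly g x ^ (k0 - 2) * B0 x * B1 x"

lemma poly_G: "poly Gp x = (x - w1) ^ over HG_Infinity z1 m1 * (x - w2) ^ over HG_Infinity z2 m2 *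
          (x - w3) ^ over HG_Infinity z3 m3"
  and poly_K: "poly Kp x = c1 * poly f x ^ k1 * B1 x"
  and poly_F: "poly (Gp + Kp) x = c0 * poly g x ^ k0 * B0 x"
proof -
  show G: "poly Gp x = (x - w1) ^ over HG_Infinity z1 m1 * (x - w2) ^ over HG_Infinity z2 m2 *
          (x - w3) ^ over HG_Infinity z3 m3" by (simp add: Gp_def)
  show K: "poly Kp x = c1 * poly f x ^ k1 * B1 x" by (simp add: Kp_def B1_def mult.assoc)
  show "poly (Gp + Kp) x = c0 * poly g x ^ k0 * B0 x"
    using factor[of x] by (simp add: G K B0_def B1_def mult.assoc)
qed

lemma ex_regular_point: "\<exists>x. regular_point \<phi> {w1, w2, w3} x"
proof -
  define P where "P = f * g * [:-w1, 1:] * [:-w2, 1:] * [:-w3, 1:]"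
  have "P \<noteq> 0" using nz unfolding P_def mult_eq_0_iff by simp
  hence "finite {x. poly P x = 0}" by (rule poly_roots_finite)
  then obtain x where "x \<notin> {x. poly P x = 0}"
    using ex_new_if_finite[OF infinite_UNIV_char_0] by blast
  hence x: "poly f x \<noteq> 0" "poly g x \<noteq> 0" "x \<noteq> w1" "x \<noteq> w2" "x \<noteq> w3"
    unfolding P_def mem_Collect_eq poly_mult mult_eq_0_iff by auto
  have G: "poly Gp x \<noteq> 0" using x by (simp add: poly_G)
  have "poly (Gp + Kp) x \<noteq> 0" using x nz by (simp only: poly_F) (simp add: B0_def)
  moreover have "poly Kp x \<noteq> 0" using x nz by (simp only: poly_K) (simp add: B1_def)
  ultimately show ?thesis using x G
    by (auto simp: regular_point_def \<phi>_def rf_eval_def divide_simps)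
qed

text \<open>At a zero of \<open>g\<close> the pulled-back exponent difference is k0 (1 - C) = 1, and
  C k0 = k0 - 1 makes the contribution of \<open>g\<close> cancel in C u + E v - phi''/phi'. If
  \<open>g\<close> is constant there are no such points and the exponent difference at z = 0 may
  stay free. The same holds for \<open>f\<close> and z = 1.\<close>

lemma pullback_inv_covering:
  assumes e0: "of_nat k0 * (1 - C) = 1 \<or> pderiv g = 0"
    and e1: "of_nat k1 * (C - A - B) = 1 \<or> pderiv f = 0"
  defines "l \<equiv> res_coeff (1 - C) (C - A - B)"
  shows "pullback_inv \<phi> (A, B, C) {w1, w2, w3}
    (\<lambda>x. (l z1 m1 / (x - w1)^2 + l z2 m2 / (x - w2)^2 + l z3 m3 / (x - w3)^2) / 2
       - (l z1 m1 / (x - w1) + l z2 m2 / (x - w2) + l z3 m3 / (x - w3))^2 / 4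
       + A * B * (W x / (S x)^2))"
proof -
  define E where "E = A + B - C + 1"
  \<comment> \<open>This is phi' = v (phi - 1), with v in the factored form provided by
    \<open>deriv\<close> and phi - 1 = \<open>Kp\<close> / \<open>Gp\<close>; no derivative of
    \<open>f\<close> or \<open>g\<close> is left in it.\<close>
  define D where "D = (\<lambda>x. \<kappa> * poly g x ^ (k0 - 1) * B0 x / (poly f x * S x) * (poly Kp x / poly Gp x))"
  define L where "L = (\<lambda>x. l z1 m1 / (x - w1) + l z2 m2 / (x - w2) + l z3 m3 / (x - w3))"
  define L2 where "L2 = (\<lambda>x. l z1 m1 / (x - w1)^2 + l z2 m2 / (x - w2)^2 + l z3 m3 / (x - w3)^2)"
  define F where "F = rf_eval \<phi>"
  define N where "N = (\<lambda>x. C * (D x / F x) + E * (D x / (F x - 1)) - L x)"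
  define N' where "N' = (\<lambda>x. C * (D x / F x * N x - (D x / F x)^2)
     + E * (D x / (F x - 1) * N x - (D x / (F x - 1))^2) + L2 x)"
  have main: "(F has_field_derivative D x) (at x) \<and> D x \<noteq> 0 \<and>
        (D has_field_derivative N x * D x) (at x) \<and>
        (N has_field_derivative N' x) (at x) \<and>
        L2 x / 2 - (L x)^2 / 4 + A * B * (W x / (S x)^2)
          = (D x)^2 * hg_inv (A, B, C) (F x) + (N' x - (N x)^2 / 2) / 2"
    if x: "x \<notin> {w1, w2, w3}" "poly Gp x \<noteq> 0" "F x \<noteq> 0" "F x \<noteq> 1" for x
  proof -
    have xw: "x \<noteq> w1" "x \<noteq> w2" "x \<noteq> w3" using x by auto
    have F: "F y = poly (Gp + Kp) y / poly Gp y" for y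
      by (simp add: F_def \<phi>_def rf_eval_def)
    have F1: "F y = 1 + poly Kp y / poly Gp y" if "poly Gp y \<noteq> 0" for y
      using that by (simp add: F field_simps)
    have "poly (Gp + Kp) x \<noteq> 0" "poly Kp x \<noteq> 0"
      using x(2,3,4) F[of x] F1[OF x(2)] by auto
    hence gf: "poly g x \<noteq> 0" "poly f x \<noteq> 0" unfolding poly_F poly_K using k by (auto simp: power_0_left)
    have S0: "S x \<noteq> 0" and B: "B0 x \<noteq> 0" "B1 x \<noteq> 0" using xw by (simp_all add: S_def B0_def B1_def)
    have dG: "has_log_deriv (poly Gp) (of_nat (over HG_Infinity z1 m1) / (x - w1)
        + of_nat (over HG_Infinity z2 m2) / (x - w2) + of_nat (over HG_Infinity z3 m3) / (x - w3)) x"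
      unfolding poly_G[abs_def]
      using log_deriv_mult[OF log_deriv_mult[OF log_deriv_power[OF log_deriv_linear[OF xw(1)]]
        log_deriv_power[OF log_deriv_linear[OF xw(2)]]] log_deriv_power[OF log_deriv_linear[OF xw(3)]]]
      by simp
    have dB0: "has_log_deriv B0 (of_nat (over HG_Zero z1 m1) / (x - w1)
        + of_nat (over HG_Zero z2 m2) / (x - w2) + of_nat (over HG_Zero z3 m3) / (x - w3)) x"
      unfolding B0_def[abs_def]
      using log_deriv_mult[OF log_deriv_mult[OF log_deriv_power[OF log_deriv_linear[OF xw(1)]]
        log_deriv_power[OF log_deriv_linear[OF xw(2)]]] log_deriv_power[OF log_deriv_linear[OF xw(3)]]]
      by simp
    have dB1: "has_log_deriv B1 (of_nat (over HG_One z1 m1) / (x - w1)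
        + of_nat (over HG_One z2 m2) / (x - w2) + of_nat (over HG_One z3 m3) / (x - w3)) x"
      unfolding B1_def[abs_def]
      using log_deriv_mult[OF log_deriv_mult[OF log_deriv_power[OF log_deriv_linear[OF xw(1)]]
        log_deriv_power[OF log_deriv_linear[OF xw(2)]]] log_deriv_power[OF log_deriv_linear[OF xw(3)]]]
      by simp
    have dS: "has_log_deriv S (1 / (x - w1) + 1 / (x - w2) + 1 / (x - w3)) x"
      unfolding S_def[abs_def]
      using log_deriv_mult[OF log_deriv_mult[OF log_deriv_linear[OF xw(1)]
        log_deriv_linear[OF xw(2)]] log_deriv_linear[OF xw(3)]]
      by simp
    define fl gl where "fl = poly (pderiv f) x / poly f x" and "gl = poly (pderiv g) x / poly g x"
    define v where "v = of_nat k1 * fl + one_inf_order z1 m1 / (x - w1)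
        + one_inf_order z2 m2 / (x - w2) + one_inf_order z3 m3 / (x - w3)"
    define u where "u = of_nat k0 * gl
        + of_nat (over HG_Zero z1 m1) / (x - w1) - of_nat (over HG_Infinity z1 m1) / (x - w1)
        + of_nat (over HG_Zero z2 m2) / (x - w2) - of_nat (over HG_Infinity z2 m2) / (x - w2)
        + of_nat (over HG_Zero z3 m3) / (x - w3) - of_nat (over HG_Infinity z3 m3) / (x - w3)"
    have s: "one_inf_order z m = of_nat (over HG_One z m) - of_nat (over HG_Infinity z m)" for z m
      by (cases z) (simp_all add: over_def)
    have KG: "has_log_deriv (\<lambda>y. poly Kp y / poly Gp y) v x"
    proof -
      have "has_log_deriv (poly Kp) (of_nat k1 * fl + (of_nat (over HG_One z1 m1) / (x - w1)
        + of_nat (over HG_One z2 m2) / (x - w2) + of_nat (over HG_One z3 m3) / (x - w3))) x"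
        unfolding poly_K[abs_def] fl_def
        using log_deriv_mult[OF log_deriv_mult[OF log_deriv_const[of c1]
            log_deriv_power[OF log_deriv_poly[OF gf(2)]]] dB1] by simp
      from log_deriv_divide[OF this dG x(2)] show ?thesis
        by (simp add: v_def s diff_divide_distrib algebra_simps)
    qed
    have FG: "has_log_deriv F u x"
    proof -
      have "has_log_deriv (poly (Gp + Kp)) (of_nat k0 * gl + (of_nat (over HG_Zero z1 m1) / (x - w1)
        + of_nat (over HG_Zero z2 m2) / (x - w2) + of_nat (over HG_Zero z3 m3) / (x - w3))) x"
        unfolding poly_F[abs_def] gl_def
        using log_deriv_mult[OF log_deriv_mult[OF log_deriv_const[of c0]
            log_deriv_power[OF log_deriv_poly[OF gf(1)]]] dB0] by simp
      from log_deriv_divide[OF this dG x(2)] show ?thesis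
        unfolding F[abs_def] by (simp add: u_def algebra_simps)
    qed
    have vS: "v = \<kappa> * poly g x ^ (k0 - 1) * B0 x / (poly f x * S x)"
    proof -
      have "v * (poly f x * S x) = of_nat k1 * poly (pderiv f) x * S x
        + poly f x * (one_inf_order z1 m1 * ((x - w2) * (x - w3))
            + one_inf_order z2 m2 * ((x - w1) * (x - w3)) + one_inf_order z3 m3 * ((x - w1) * (x - w2)))"
        using xw gf by (simp add: v_def fl_def S_def divide_simps) (simp add: algebra_simps)
      also have "\<dots> = \<kappa> * poly g x ^ (k0 - 1) * B0 x"
        unfolding S_def deriv B0_def ..
      finally show ?thesis using gf S0 by (simp add: field_simps)
    qed
    have Dx: "D x = v * (F x - 1)" unfolding D_def vS F1[OF x(2)] by simp
    have opn: "open {y. poly Gp y \<noteq> 0}"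
      by (intro open_Collect_neq continuous_intros)
    have dF: "(F has_field_derivative D x) (at x)"
    proof (rule has_field_derivative_transform_within_open[OF _ opn])
      show "((\<lambda>y. 1 + poly Kp y / poly Gp y) has_field_derivative D x) (at x)"
        using DERIV_add[OF DERIV_const[of 1] KG[unfolded has_log_deriv_def]]
        by (rule DERIV_cong) (simp add: Dx F1[OF x(2)])
    qed (use x F1 in auto)
    have Du: "D x = u * F x" using log_deriv_unique[OF FG dF] by simp
    have v0: "v \<noteq> 0" unfolding vS using gf S0 B nz by simp
    have D0: "D x \<noteq> 0" using Dx v0 x by simp
    have uv: "D x / F x = u" "D x / (F x - 1) = v"
      using x(3,4) Du Dx by (simp, metis eq_iff_diff_eq_0 nonzero_mult_div_cancel_right)
    have NL: "N x = C * u + E * v - L x" unfolding N_def uv ..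
    have dD: "has_log_deriv D (of_nat (k0 - 1) * gl + (of_nat (over HG_Zero z1 m1) / (x - w1)
        + of_nat (over HG_Zero z2 m2) / (x - w2) + of_nat (over HG_Zero z3 m3) / (x - w3))
        - (fl + (1 / (x - w1) + 1 / (x - w2) + 1 / (x - w3))) + v) x"
    proof -
      have "poly f x * S x \<noteq> 0" using gf S0 by simp
      from log_deriv_mult[OF log_deriv_divide[OF log_deriv_mult[OF log_deriv_mult[OF
            log_deriv_const[of \<kappa>] log_deriv_power[OF log_deriv_poly[OF gf(1)], of "k0 - 1"]] dB0]
            log_deriv_mult[OF log_deriv_poly[OF gf(2)] dS] this] KG]
      show ?thesis unfolding D_def gl_def fl_def by simp
    qed
    \<comment> \<open>The residues of C u + E v - L and of D'/D at a singular point agree, whichever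
      fibre the point lies in. In D'/D they come from \<open>B0\<close>, \<open>S\<close> and
      v.\<close>
    have pt: "C * (of_nat (over HG_Zero z m) - of_nat (over HG_Infinity z m)) + E * one_inf_order z m
        - l z m = of_nat (over HG_Zero z m) - 1 + one_inf_order z m" for z m
      by (cases z) (simp_all add: over_def l_def E_def algebra_simps)
    have Nx: "N x = of_nat (k0 - 1) * gl + (of_nat (over HG_Zero z1 m1) / (x - w1)
        + of_nat (over HG_Zero z2 m2) / (x - w2) + of_nat (over HG_Zero z3 m3) / (x - w3))
        - (fl + (1 / (x - w1) + 1 / (x - w2) + 1 / (x - w3))) + v"
    proof -
      have 1: "C * (of_nat k0 * gl) = of_nat (k0 - 1) * gl"
        using e0
      proof
        assume "of_nat k0 * (1 - C) = 1"
        hence "C * of_nat k0 = of_nat (k0 - 1)" using k by (simp add: of_nat_diff algebra_simps)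
        thus ?thesis by (simp add: mult.assoc[symmetric])
      qed (simp add: gl_def)
      have 2: "E * (of_nat k1 * fl) = of_nat k1 * fl - fl"
        using e1
      proof
        assume "of_nat k1 * (C - A - B) = 1"
        hence "E * of_nat k1 = of_nat k1 - 1" by (simp add: E_def algebra_simps)
        thus ?thesis by (simp add: mult.assoc[symmetric] left_diff_distrib)
      qed (simp add: fl_def)
      have 3: "C * (of_nat (over HG_Zero z m) / y - of_nat (over HG_Infinity z m) / y)
          + E * (one_inf_order z m / y) - l z m / y
        = of_nat (over HG_Zero z m) / y - 1 / y + one_inf_order z m / y" for z m y
        using pt[of z m] by (metis (no_types, opaque_lifting) add_divide_distrib diff_divide_distrib times_divide_eq_right)
      have "N x = C * u + E * v - L x" by (rule NL)
      also have "\<dots> = C * (of_nat k0 * gl) + E * (of_nat k1 * fl)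
        + (C * (of_nat (over HG_Zero z1 m1) / (x - w1) - of_nat (over HG_Infinity z1 m1) / (x - w1))
          + E * (one_inf_order z1 m1 / (x - w1)) - l z1 m1 / (x - w1))
        + (C * (of_nat (over HG_Zero z2 m2) / (x - w2) - of_nat (over HG_Infinity z2 m2) / (x - w2))
          + E * (one_inf_order z2 m2 / (x - w2)) - l z2 m2 / (x - w2))
        + (C * (of_nat (over HG_Zero z3 m3) / (x - w3) - of_nat (over HG_Infinity z3 m3) / (x - w3))
          + E * (one_inf_order z3 m3 / (x - w3)) - l z3 m3 / (x - w3))"
        unfolding u_def v_def L_def by (simp add: distrib_left right_diff_distrib)
      finally show ?thesis unfolding 1 2 3 v_def by simp
    qed
    have dDx: "(D has_field_derivative N x * D x) (at x)"
      using dD unfolding Nx[symmetric] has_log_deriv_def by (simp add: mult.commute)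
    have dL: "(L has_field_derivative - L2 x) (at x)"
      unfolding L_def L2_def using xw
      by (auto intro!: derivative_eq_intros simp: power2_eq_square)
    have quot: "(N x * D x * b - D x * D x) / (b * b) = D x / b * N x - (D x / b)^2" if "b \<noteq> 0" for b
      using that by (simp add: power2_eq_square field_simps)
    have du: "((\<lambda>y. D y / F y) has_field_derivative u * N x - u^2) (at x)"
      using DERIV_divide[OF dDx dF x(3)] unfolding quot[OF x(3)] uv .
    have dF1: "((\<lambda>y. F y - 1) has_field_derivative D x) (at x)"
      using DERIV_diff[OF dF DERIV_const[of 1]] by simp
    have F1x: "F x - 1 \<noteq> 0" using x by simp
    have dv: "((\<lambda>y. D y / (F y - 1)) has_field_derivative v * N x - v^2) (at x)"
      using DERIV_divide[OF dDx dF1 F1x] unfolding quot[OF F1x] uv .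
    have dN: "(N has_field_derivative N' x) (at x)"
      unfolding N_def[abs_def]
      by (rule DERIV_cong[OF DERIV_diff[OF DERIV_add[OF DERIV_cmult[OF du] DERIV_cmult[OF dv]] dL]])
         (unfold N'_def uv, simp)
    \<comment> \<open>Since u/v = (phi - 1)/phi, the product is v^2 (phi - 1)/phi, and both factors
      are known in factored form.\<close>
    have uvW: "u * v = W x / (S x)^2"
    proof -
      obtain a b where ab: "k0 = 2 + a" "k1 = 2 + b"
        using k le_Suc_ex by blast
      have KF: "(F x - 1) / F x = c1 * poly f x ^ k1 * B1 x / (c0 * poly g x ^ k0 * B0 x)"
        using x(2) unfolding F1[OF x(2)] unfolding poly_F[symmetric] poly_K[symmetric] by (simp add: field_simps)
      have "u * v = v^2 * ((F x - 1) / F x)"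
        using Du Dx x(3) by (simp add: power2_eq_square field_simps)
      also have "\<dots> = W x / (S x)^2"
        unfolding KF vS W_def unfolding ab using gf B S0 nz
        by (simp add: power_add power_mult_distrib power_divide power2_eq_square field_simps)
      finally show ?thesis .
    qed
    have "(D x)^2 * hg_inv (A, B, C) (F x)
       = A * B * (u * v) + (C * u^2 + E * v^2) / 2 - (C * u + E * v)^2 / 4"
      unfolding uv[symmetric] E_def[symmetric] hg_inv.simps using x(3) F1x
      by (simp add: E_def power_divide power2_eq_square algebra_simps add_divide_distrib)
    hence "(D x)^2 * hg_inv (A, B, C) (F x) + (N' x - (N x)^2 / 2) / 2
        = L2 x / 2 - (L x)^2 / 4 + A * B * (u * v)"
      using invariant_of_log_derivs[of "N x" C u E v "L x" A B "L2 x"]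
      unfolding N'_def uv by (simp add: NL)
    thus ?thesis using dF D0 dDx dN uvW by simp
  qed
  show ?thesis
  proof (rule pullback_invI[where D = D and N = N and N' = N'])
    fix x
    assume "x \<notin> {w1, w2, w3}" "poly (snd \<phi>) x \<noteq> 0" "rf_eval \<phi> x \<noteq> 0" "rf_eval \<phi> x \<noteq> 1"
    moreover from this(2) have "poly Gp x \<noteq> 0" by (simp add: \<phi>_def)
    ultimately show "(rf_eval \<phi> has_field_derivative D x) (at x) \<and> D x \<noteq> 0 \<and>
        (D has_field_derivative N x * D x) (at x) \<and>
        (N has_field_derivative N' x) (at x) \<and>
        (l z1 m1 / (x - w1)^2 + l z2 m2 / (x - w2)^2 + l z3 m3 / (x - w3)^2) / 2
         - (l z1 m1 / (x - w1) + l z2 m2 / (x - w2) + l z3 m3 / (x - w3))^2 / 4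
         + A * B * (W x / (S x)^2)
        = (D x)^2 * hg_inv (A, B, C) (rf_eval \<phi> x) + (N' x - (N x)^2 / 2) / 2"
      using main[of x] unfolding F_def L_def L2_def by blast
  qed
qed

text \<open>The affine map w1 + s x carries 0, 1, t to the three finite singular points, and
  \<open>y1\<close>, \<open>y2\<close>, \<open>y3\<close> are its distances from them. The
  numerators are compared after a scaling by s, so that only s and s t, differences of singular
  points, occur in the hypothesis.\<close>

lemma heun_num_affine:
  fixes l1 l2 l3 M1 M2 M3 M4 w s t x r AB \<omega> :: complex
  defines "y1 \<equiv> s * x" and "y2 \<equiv> s * (x - 1)" and "y3 \<equiv> s * (x - t)"
  assumes nz: "s \<noteq> 0" "x \<noteq> 0" "x \<noteq> 1" "x \<noteq> t"
    and eq: "6 * (l1 * (y2 * y3)^2 + l2 * (y1 * y3)^2 + l3 * (y1 * y2)^2)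
        - 3 * (l1 * (y2 * y3) + l2 * (y1 * y3) + l3 * (y1 * y2))^2 + 12 * AB * \<omega>
      = 3 * ((1 - M1) * (y2 * y3)^2 + (1 - M2) * (y1 * y3)^2 + (1 - M3) * (y1 * y2)^2)
        + (3 * (M1 + M2 + M3 - M4 - 2) * y1 - s * r + (s * t + s) * (M4 + 2 - 2 * M1)
           - M2 * (2 * (s * t) - s) + M3 * (s * t - 2 * s)) * (y1 * y2 * y3)"
  shows "heun_inv t M1 M2 M3 M4 r x
    = s^2 * ((l1 / y1^2 + l2 / y2^2 + l3 / y3^2) / 2 - (l1 / y1 + l2 / y2 + l3 / y3)^2 / 4
        + AB * (\<omega> / (y1 * y2 * y3)^2))"
proof -
  define D where "D = x * (x - 1) * (x - t)"
  have D: "y1 * y2 * y3 = s^3 * D" by (simp add: y1_def y2_def y3_def D_def power3_eq_cube mult_ac)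
  have y: "y1 \<noteq> 0" "y2 \<noteq> 0" "y3 \<noteq> 0" using nz by (simp_all add: y1_def y2_def y3_def)
  have D0: "D \<noteq> 0" using nz by (simp add: D_def)
  have "(l1 / y1^2 + l2 / y2^2 + l3 / y3^2) / 2 - (l1 / y1 + l2 / y2 + l3 / y3)^2 / 4
        + AB * (\<omega> / (y1 * y2 * y3)^2)
      = (6 * (l1 * (y2 * y3)^2 + l2 * (y1 * y3)^2 + l3 * (y1 * y2)^2)
        - 3 * (l1 * (y2 * y3) + l2 * (y1 * y3) + l3 * (y1 * y2))^2 + 12 * AB * \<omega>)
        / (12 * (y1 * y2 * y3)^2)"
  proof -
    have "l1 / y1 + l2 / y2 + l3 / y3
        = (l1 * (y2 * y3) + l2 * (y1 * y3) + l3 * (y1 * y2)) / (y1 * y2 * y3)"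
      unfolding add_divide_distrib using y by simp
    moreover have "l1 / y1^2 + l2 / y2^2 + l3 / y3^2
        = (l1 * (y2 * y3)^2 + l2 * (y1 * y3)^2 + l3 * (y1 * y2)^2) / (y1 * y2 * y3)^2"
      unfolding add_divide_distrib power_mult_distrib using y by simp
    moreover have "n / Y^2 / 2 - (m / Y)^2 / 4 + AB * (\<omega> / Y^2) = (6 * n - 3 * m^2 + 12 * AB * \<omega>) / (12 * Y^2)"
      for n m Y :: complex
      by (simp add: power_divide add_divide_distrib diff_divide_distrib mult.commute)
    ultimately show ?thesis by (simp only:)
  qed
  also have "\<dots> = s^4 * heun_num t M1 M2 M3 M4 r x / (12 * (s^3 * D)^2)"
  proof -
    have "s^4 * heun_num t M1 M2 M3 M4 r x
      = 3 * ((1 - M1) * (y2 * y3)^2 + (1 - M2) * (y1 * y3)^2 + (1 - M3) * (y1 * y2)^2)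
        + (3 * (M1 + M2 + M3 - M4 - 2) * y1 - s * r + (s * t + s) * (M4 + 2 - 2 * M1)
           - M2 * (2 * (s * t) - s) + M3 * (s * t - 2 * s)) * (y1 * y2 * y3)"
    proof -
      define a b c where "a = 1 - M1" and "b = 1 - M2" and "c = 1 - M3"
      define K where "K = 3 * (M1 + M2 + M3 - M4 - 2) * x
        - r + (t + 1) * (M4 + 2 - 2 * M1) - M2 * (2 * t - 1) + M3 * (t - 2)"
      have "3 * (M1 + M2 + M3 - M4 - 2) * y1 - s * r + (s * t + s) * (M4 + 2 - 2 * M1)
           - M2 * (2 * (s * t) - s) + M3 * (s * t - 2 * s) = s * K"
        by (simp add: K_def y1_def algebra_simps)
      moreover have "y2 * y3 = s^2 * ((x - 1) * (x - t))" "y1 * y3 = s^2 * (x * (x - t))"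
        "y1 * y2 = s^2 * (x * (x - 1))"
        by (simp_all add: y1_def y2_def y3_def power2_eq_square)
      moreover have "heun_num t M1 M2 M3 M4 r x = 3 * (a * ((x - 1) * (x - t))^2
          + b * (x * (x - t))^2 + c * (x * (x - 1))^2) + K * D"
        by (simp add: heun_num_def K_def D_def a_def b_def c_def)
      ultimately show ?thesis
        unfolding a_def[symmetric] b_def[symmetric] c_def[symmetric] D
        by (simp add: power_mult_distrib distrib_left eval_nat_numeral mult_ac)
    qed
    thus ?thesis unfolding eq D by simp
  qed
  finally show ?thesis
    using nz D0 unfolding heun_inv_num[OF nz(2-4)] D_def[symmetric]
    by (simp add: power_mult_distrib field_simps eval_nat_numeral)
qed

text \<open>The assumption \<open>ident\<close> compares numerators of the pulled-back and of the
  Heun invariant, so a covering is settled by one polynomial identity in x. Infinity lies over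
  \<open>zi\<close> with multiplicity \<open>mi\<close>, which enters through the Heun side;
  \<open>r\<close> is the resulting value of \<open>Q0\<close>.\<close>

lemma attained_covering:
  fixes zi :: hg_sing and mi :: nat and r :: "hg_params \<Rightarrow> complex"
  defines "M \<equiv> \<lambda>p z m. (of_nat m * hg_exp_diff p z)^2"
    and "l \<equiv> \<lambda>p. res_coeff (hg_exp_diff p HG_Zero) (hg_exp_diff p HG_One)"
  assumes fam: "T \<noteq> {}" "p0 \<in> hg_family T \<epsilon>"
    and e0: "\<And>p. p \<in> hg_family T \<epsilon> \<Longrightarrow> of_nat k0 * hg_exp_diff p HG_Zero = 1 \<or> pderiv g = 0"
    and e1: "\<And>p. p \<in> hg_family T \<epsilon> \<Longrightarrow> of_nat k1 * hg_exp_diff p HG_One = 1 \<or> pderiv f = 0"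
    and cont: "continuous_on (hg_family T \<epsilon>) r"
    and ident: "\<And>p x. p \<in> hg_family T \<epsilon> \<Longrightarrow>
      6 * (l p z1 m1 * ((x - w2) * (x - w3))^2 + l p z2 m2 * ((x - w1) * (x - w3))^2
           + l p z3 m3 * ((x - w1) * (x - w2))^2)
      - 3 * (l p z1 m1 * ((x - w2) * (x - w3)) + l p z2 m2 * ((x - w1) * (x - w3))
           + l p z3 m3 * ((x - w1) * (x - w2)))^2
      + 3 * ((1 - hg_exp_diff p HG_Zero - hg_exp_diff p HG_One)^2 - (hg_exp_diff p HG_Infinity)^2) * W x
      = 3 * ((1 - M p z1 m1) * ((x - w2) * (x - w3))^2 + (1 - M p z2 m2) * ((x - w1) * (x - w3))^2
           + (1 - M p z3 m3) * ((x - w1) * (x - w2))^2)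
        + (3 * (M p z1 m1 + M p z2 m2 + M p z3 m3 - M p zi mi - 2) * (x - w1) - (w2 - w1) * r p
           + ((w3 - w1) + (w2 - w1)) * (M p zi mi + 2 - 2 * M p z1 m1)
           - M p z2 m2 * (2 * (w3 - w1) - (w2 - w1)) + M p z3 m3 * ((w3 - w1) - 2 * (w2 - w1)))
          * ((x - w1) * (x - w2) * (x - w3))"
  shows "attained ((w3 - w1) / (w2 - w1)) (M p0 z1 m1) (M p0 z2 m2) (M p0 z3 m3) (M p0 zi mi) (r p0)"
proof -
  define s where "s = w2 - w1"
  define t where "t = (w3 - w1) / s"
  have s0: "s \<noteq> 0" using w by (simp add: s_def)
  have wt: "w2 = w1 + s" "w3 = w1 + s * t" "w3 - w1 = s * t" using s0 by (simp_all add: s_def t_def)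
  have exp_cont: "continuous_on (hg_family T \<epsilon>) (\<lambda>p. of_nat m * hg_exp_diff p z)" for z m
  proof -
    have "hg_exp_diff p HG_Zero = 1 - snd (snd p)"
      "hg_exp_diff p HG_One = snd (snd p) - fst p - fst (snd p)"
      "hg_exp_diff p HG_Infinity = fst p - fst (snd p)" for p
      by (cases p; simp)+
    thus ?thesis by (cases z) (auto intro!: continuous_intros)
  qed
  define \<psi> where "\<psi> = mob_ratfun s w1 0 1 \<phi>"
  have mem: "(s * x + w1) / (0 * x + 1) \<notin> {w1, w2, w3}" if "x \<notin> {0, 1, t}" for x
    using that s0 by (simp add: wt)
  obtain y where y: "regular_point \<phi> {w1, w2, w3} y" using ex_regular_point by blast
  have "regular_point \<psi> {0, 1, t} ((y - w1) / s)"
    unfolding \<psi>_def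
    by (rule regular_point_mob[where Z = "{w1, w2, w3}"])
       (use y s0 in \<open>auto simp: regular_point_def wt field_simps\<close>)
  moreover have "pullback_inv \<psi> p {0, 1, t}
      (heun_inv t ((of_nat m1 * hg_exp_diff p z1)^2) ((of_nat m2 * hg_exp_diff p z2)^2)
        ((of_nat m3 * hg_exp_diff p z3)^2) ((of_nat mi * hg_exp_diff p zi)^2) (r p))"
    if p: "p \<in> hg_family T \<epsilon>" for p
  proof -
    obtain A B C where ABC: "p = (A, B, C)" by (metis prod.exhaust)
    have E: "hg_exp_diff p HG_Zero = 1 - C" "hg_exp_diff p HG_One = C - A - B" by (simp_all add: ABC)
    \<comment> \<open>A + B = 1 - e0 - e1 and A - B is the exponent difference at infinity.\<close>
    have AB: "3 * ((1 - hg_exp_diff p HG_Zero - hg_exp_diff p HG_One)^2 - (hg_exp_diff p HG_Infinity)^2)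
        = 12 * (A * B)"
      by (simp add: ABC power2_eq_square algebra_simps)
    have inv: "pullback_inv \<phi> p {w1, w2, w3}
      (\<lambda>x. (l p z1 m1 / (x - w1)^2 + l p z2 m2 / (x - w2)^2 + l p z3 m3 / (x - w3)^2) / 2
       - (l p z1 m1 / (x - w1) + l p z2 m2 / (x - w2) + l p z3 m3 / (x - w3))^2 / 4
       + A * B * (W x / (S x)^2))"
      unfolding l_def ABC hg_exp_diff.simps by (rule pullback_inv_covering) (use e0[OF p] e1[OF p] in \<open>simp_all add: ABC\<close>)
    show ?thesis
      unfolding \<psi>_def
    proof (rule pullback_inv_mob[OF inv])
      fix x assume x: "x \<notin> {0, 1, t}"
      have sub: "s * x + w1 - w1 = s * x" "s * x + w1 - w2 = s * (x - 1)" "s * x + w1 - w3 = s * (x - t)"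
        by (simp_all add: wt algebra_simps)
      have \<mu>: "(s * x + w1) / (0 * x + 1) = s * x + w1" "((s * 1 - w1 * 0) / (0 * x + 1)^2)^2 = s^2" by simp_all
      show "heun_inv t ((of_nat m1 * hg_exp_diff p z1)^2) ((of_nat m2 * hg_exp_diff p z2)^2)
        ((of_nat m3 * hg_exp_diff p z3)^2) ((of_nat mi * hg_exp_diff p zi)^2) (r p) x
        = ((s * 1 - w1 * 0) / (0 * x + 1)^2)^2 *
          ((l p z1 m1 / ((s * x + w1) / (0 * x + 1) - w1)^2 + l p z2 m2 / ((s * x + w1) / (0 * x + 1) - w2)^2
             + l p z3 m3 / ((s * x + w1) / (0 * x + 1) - w3)^2) / 2
          - (l p z1 m1 / ((s * x + w1) / (0 * x + 1) - w1) + l p z2 m2 / ((s * x + w1) / (0 * x + 1) - w2)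
             + l p z3 m3 / ((s * x + w1) / (0 * x + 1) - w3))^2 / 4
          + A * B * (W ((s * x + w1) / (0 * x + 1)) / (S ((s * x + w1) / (0 * x + 1)))^2))"
        unfolding \<mu> S_def sub
        by (rule heun_num_affine[OF s0])
           (use x ident[OF p, of "s * x + w1", unfolded AB sub M_def s_def[symmetric] wt(3)] in auto)
    qed (use s0 mem in auto)
  qed
  ultimately have "realizable T \<epsilon> t (\<lambda>p. of_nat m1 * hg_exp_diff p z1) (\<lambda>p. of_nat m2 * hg_exp_diff p z2)
      (\<lambda>p. of_nat m3 * hg_exp_diff p z3) (\<lambda>p. of_nat mi * hg_exp_diff p zi) r"
    unfolding realizable_def using exp_cont cont by blast
  thus ?thesis
    unfolding t_def s_def M_def by (rule attainedI[OF _ fam]) simp_all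
qed

end

section \<open>Identifying a Heun equation from its invariants\<close>

definition K1 :: "complex \<Rightarrow> complex \<Rightarrow> complex \<Rightarrow> complex \<Rightarrow> complex \<Rightarrow> complex" where
  "K1 t M0 M1 Mt Mi = (t^2 - t + 1) / (t * (t - 1)) * ((M0 - M1) * (Mt - Mi) * t - (M0 - Mt) * (M1 - Mi))"

definition K2 :: "complex \<Rightarrow> complex \<Rightarrow> complex \<Rightarrow> complex \<Rightarrow> complex \<Rightarrow> complex" where
  "K2 t M0 M1 Mt Mi = ((M0 * Mt + M1 * Mi) * t^2 - (M0 * Mi + M1 * Mt) * t + M0 * M1 + Mt * Mi) / (t^2 - t + 1)
     + M0 * Mi + M1 * Mt"

lemma K1_one_minus: "K1 (1 - t) M1 M0 Mt Mi = K1 t M0 M1 Mt Mi"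
proof -
  have "(1 - t)^2 - (1 - t) + 1 = t^2 - t + 1" "(1 - t) * (1 - t - 1) = t * (t - 1)"
    by (simp_all add: power2_eq_square algebra_simps)
  moreover have "(M1 - M0) * (Mt - Mi) * (1 - t) - (M1 - Mt) * (M0 - Mi)
      = (M0 - M1) * (Mt - Mi) * t - (M0 - Mt) * (M1 - Mi)"
    by (simp add: algebra_simps)
  ultimately show ?thesis unfolding K1_def by (simp only:)
qed

lemma K2_one_minus: "K2 (1 - t) M1 M0 Mt Mi = K2 t M0 M1 Mt Mi" if "t^2 - t + 1 \<noteq> 0"
proof -
  define d where "d = t^2 - t + 1"
  have 1: "(1 - t)^2 - (1 - t) + 1 = d"
    by (simp add: d_def power2_eq_square algebra_simps)
  have "(M1 * Mt + M0 * Mi) * (1 - t)^2 - (M1 * Mi + M0 * Mt) * (1 - t) + M1 * M0 + Mt * Mi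
        + (M1 * Mi + M0 * Mt) * d
      = (M0 * Mt + M1 * Mi) * t^2 - (M0 * Mi + M1 * Mt) * t + M0 * M1 + Mt * Mi + (M0 * Mi + M1 * Mt) * d"
    by (simp add: d_def power2_eq_square algebra_simps)
  hence "((M1 * Mt + M0 * Mi) * (1 - t)^2 - (M1 * Mi + M0 * Mt) * (1 - t) + M1 * M0 + Mt * Mi) / d
        + (M1 * Mi + M0 * Mt)
      = ((M0 * Mt + M1 * Mi) * t^2 - (M0 * Mi + M1 * Mt) * t + M0 * M1 + Mt * Mi) / d + (M0 * Mi + M1 * Mt)"
    using that d_def by (simp add: divide_simps)
  thus ?thesis unfolding K2_def 1 d_def[symmetric] by (simp add: add.assoc)
qed

lemma J1_one_minus: "J1 (1 - t) = - J1 t"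
proof -
  have "(1 - t + 1) * (1 - t - 2) * (2 * (1 - t) - 1) * ((1 - t)^2 - (1 - t) + 1)
    = - ((t + 1) * (t - 2) * (2 * t - 1) * (t^2 - t + 1))" "(1 - t)^2 * (1 - t - 1)^2 = t^2 * (t - 1)^2"
    by (simp_all add: power2_eq_square algebra_simps)
  thus ?thesis unfolding J1_def by simp
qed

lemma K1_inverse: "K1 (1 / t) Mi M1 Mt M0 = K1 t M0 M1 Mt Mi" if "t \<noteq> 0" "t \<noteq> 1"
proof -
  define A B n y where "A = (M0 - M1) * (Mt - Mi)" and "B = (M0 - Mt) * (M1 - Mi)"
    and "n = t^2 - t + 1" and "y = t - 1"
  have e: "(Mi - M1) * (Mt - M0) = B" "(Mi - Mt) * (M1 - M0) = A" by (simp_all add: A_def B_def algebra_simps)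
  have "(1 / t)^2 - 1 / t + 1 = n / t^2" "1 / t * (1 / t - 1) = - y / t^2"
    using that by (simp_all add: n_def y_def field_simps power2_eq_square)
  hence f: "((1 / t)^2 - 1 / t + 1) / (1 / t * (1 / t - 1)) = - n / y"
    using that by simp
  have "- n / y * (B * (1 / t) - A) = n / (t * y) * (A * t - B)"
    using that y_def by (simp add: divide_simps) (simp add: algebra_simps)
  thus ?thesis
    unfolding K1_def A_def[symmetric] B_def[symmetric] e f n_def[symmetric] y_def[symmetric] .
qed

lemma K2_inverse: "K2 (1 / t) Mi M1 Mt M0 = K2 t M0 M1 Mt Mi" if "t \<noteq> 0" "t^2 - t + 1 \<noteq> 0"
proof -
  define n X where "n = t^2 - t + 1"
    and "X = (M0 * Mt + M1 * Mi) * t^2 - (M0 * Mi + M1 * Mt) * t + M0 * M1 + Mt * Mi"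
  have 1: "(1 / t)^2 - 1 / t + 1 = n / t^2"
    using that by (simp add: n_def field_simps power2_eq_square)
  have 2: "(Mi * Mt + M1 * M0) * (1 / t)^2 - (Mi * M0 + M1 * Mt) * (1 / t) + Mi * M1 + Mt * M0 = X / t^2"
    using that by (simp add: X_def field_simps power2_eq_square)
  have "X / t^2 / (n / t^2) = X / n" using that by simp
  thus ?thesis
    unfolding K2_def 1 2 unfolding X_def[symmetric] n_def[symmetric] by (simp add: mult.commute)
qed

lemma J1_inverse: "J1 (1 / t) = t * J1 t" if "t \<noteq> 0" "t \<noteq> 1"
proof -
  define a b c n y where "a = t + 1" and "b = t - 2" and "c = 2 * t - 1" and "n = t^2 - t + 1" and "y = t - 1"
  have e: "1 / t + 1 = a / t" "1 / t - 2 = - c / t" "2 * (1 / t) - 1 = - b / t"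
      "(1 / t)^2 - 1 / t + 1 = n / t^2" "1 / t - 1 = - y / t"
    using that by (simp_all add: a_def b_def c_def n_def y_def field_simps power2_eq_square)
  have "a / t * (- c / t) * (- b / t) * (n / t^2) / ((1 / t)^2 * (- y / t)^2)
    = t * (a * b * c * n / (t^2 * y^2))"
    using that unfolding y_def by (simp add: divide_simps eval_nat_numeral) (simp add: algebra_simps)
  thus ?thesis
    unfolding J1_def e a_def[symmetric] b_def[symmetric] c_def[symmetric] n_def[symmetric] y_def[symmetric] .
qed

text \<open>With denominators cleared, the difference of the two sides splits into six factors
  linear in t, one for each element of the orbit of s under the anharmonic group.\<close>

lemma jinv_eq_cases:
  assumes "jinv t = jinv s" "t \<noteq> 0" "t \<noteq> 1" "s \<noteq> 0" "s \<noteq> 1"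
  shows "t \<in> {s, 1 - s, 1 / s, 1 - 1 / s, 1 / (1 - s), 1 - 1 / (1 - s)}"
proof -
  have "(t^2 - t + 1)^3 * (s^2 * (s - 1)^2) = (s^2 - s + 1)^3 * (t^2 * (t - 1)^2)"
    using assms by (simp add: jinv_def frac_eq_eq)
  moreover have "(t^2 - t + 1)^3 * (s^2 * (s - 1)^2) - (s^2 - s + 1)^3 * (t^2 * (t - 1)^2)
     = (t - s) * (t - (1 - s)) * (t * s - 1) * (t * s - (s - 1)) * (t * (1 - s) - 1) * (t * (1 - s) + s)"
    by algebra
  ultimately have "(t - s) * (t - (1 - s)) * (t * s - 1) * (t * s - (s - 1)) * (t * (1 - s) - 1) * (t * (1 - s) + s) = 0"
    by simp
  hence "t = s \<or> t = 1 - s \<or> t * s = 1 \<or> t * s = s - 1 \<or> t * (1 - s) = 1 \<or> t * (1 - s) = - s"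
    by (auto simp: add_eq_0_iff2)
  thus ?thesis using assms(4,5) by (auto simp: field_simps)
qed

text \<open>The maps 1 - r and 1/r generate the anharmonic group.\<close>

lemma jinv_induct:
  assumes "jinv t = jinv s" "t \<noteq> 0" "t \<noteq> 1" "s \<noteq> 0" "s \<noteq> 1" and P: "P s"
    and 1: "\<And>r. r \<noteq> 0 \<Longrightarrow> r \<noteq> 1 \<Longrightarrow> P r \<Longrightarrow> P (1 - r)"
    and 2: "\<And>r. r \<noteq> 0 \<Longrightarrow> r \<noteq> 1 \<Longrightarrow> P r \<Longrightarrow> P (1 / r)"
  shows "P t"
proof -
  have a: "P (1 - s)" using 1[OF assms(4,5) P] .
  have b: "P (1 / s)" using 2[OF assms(4,5) P] .
  have c: "P (1 - 1 / s)" using 1[OF _ _ b] assms by simp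
  have d: "P (1 / (1 - s))" using 2[OF _ _ a] assms by simp
  have e: "P (1 - 1 / (1 - s))" using 1[OF _ _ d] assms by simp
  show ?thesis using jinv_eq_cases[OF assms(1-5)] P a b c d e by auto
qed

lemma mset3_cases:
  assumes "mset [b', c', d'] = mset [b, c, d]"
  shows "(b', c', d') \<in> {(b, c, d), (b, d, c), (c, b, d), (c, d, b), (d, b, c), (d, c, b)}"
  using assms by (auto simp: add_eq_conv_ex add_mset_eq_single)

text \<open>In each case the remaining three entries are listed in the order produced by the element
  of the Klein four-group that brings \<open>a'\<close> to the front. All cases are then
  relabellings of the first one.\<close>

lemma mset4_cases:
  assumes "mset [a', b', c', d'] = mset [a, b, c, d]"
  obtains "a' = a" "mset [b', c', d'] = mset [b, c, d]" | "a' = b" "mset [b', c', d'] = mset [a, d, c]"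
    | "a' = c" "mset [b', c', d'] = mset [d, a, b]" | "a' = d" "mset [b', c', d'] = mset [c, b, a]"
proof -
  have "a' \<in> set_mset (mset [a, b, c, d])" using assms[symmetric] by simp
  hence "a' = a \<or> a' = b \<or> a' = c \<or> a' = d" by auto
  thus ?thesis using assms that by (auto simp: add_mset_commute)
qed

lemma pairing_permutes:
  fixes a b c d :: complex
  assumes "mset [a', b', c', d'] = mset [a, b, c, d]"
  defines "A \<equiv> a * b + c * d" and "B \<equiv> a * c + b * d" and "C \<equiv> a * d + b * c"
  shows "(a' * b' + c' * d', a' * c' + b' * d', a' * d' + b' * c')
    \<in> {(A, B, C), (A, C, B), (B, A, C), (B, C, A), (C, A, B), (C, B, A)}"
proof (cases rule: mset4_cases[OF assms(1)])
  case 1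
  from mset3_cases[OF 1(2)] show ?thesis
    unfolding 1(1) A_def B_def C_def by (elim insertE emptyE) (simp_all add: mult.commute add.commute)
next
  case 2
  from mset3_cases[OF 2(2)] show ?thesis
    unfolding 2(1) A_def B_def C_def by (elim insertE emptyE) (simp_all add: mult.commute add.commute)
next
  case 3
  from mset3_cases[OF 3(2)] show ?thesis
    unfolding 3(1) A_def B_def C_def by (elim insertE emptyE) (simp_all add: mult.commute add.commute)
next
  case 4
  from mset3_cases[OF 4(2)] show ?thesis
    unfolding 4(1) A_def B_def C_def by (elim insertE emptyE) (simp_all add: mult.commute add.commute)
qed

text \<open>Permutations of four numbers act on the three pairings, with the Klein four-group as
  kernel. Coincident pairings cause no further freedom: A = B, for instance, means (a - d) (b - c) =
  0, and the additional permutation then exchanges equal numbers.\<close>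

lemma klein_arrangement:
  fixes a b c d :: complex
  assumes m: "mset [a', b', c', d'] = mset [a, b, c, d]"
    and A: "a' * b' + c' * d' = a * b + c * d" and B: "a' * c' + b' * d' = a * c + b * d"
    and C: "a' * d' + b' * c' = a * d + b * c"
  shows "(a', b', c', d') \<in> {(a, b, c, d), (b, a, d, c), (c, d, a, b), (d, c, b, a)}"
proof -
  have aux: "(a', b', c', d') \<in> {(a, b, c, d), (b, a, d, c), (c, d, a, b), (d, c, b, a)}"
    if a': "a' = a" and m: "mset [b', c', d'] = mset [b, c, d]"
      and A: "a' * b' + c' * d' = a * b + c * d" and B: "a' * c' + b' * d' = a * c + b * d"
      and C: "a' * d' + b' * c' = a * d + b * c" for a b c d :: complex
  proof -
    have AB: "(a - d) * (b - c) = 0 \<longleftrightarrow> a * b + c * d = a * c + b * d"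
      and AC: "(a - c) * (b - d) = 0 \<longleftrightarrow> a * b + c * d = a * d + b * c"
      and BC: "(a - b) * (c - d) = 0 \<longleftrightarrow> a * c + b * d = a * d + b * c"
      by (auto simp: algebra_simps)
    show ?thesis
      using mset3_cases[OF m]
    proof (elim insertE emptyE)
      assume "(b', c', d') = (b, d, c)"
      hence "(a - b) * (c - d) = 0" using B BC a' by (simp add: mult.commute)
      thus ?thesis using \<open>(b', c', d') = (b, d, c)\<close> a' by auto
    next
      assume "(b', c', d') = (c, b, d)"
      hence "(a - d) * (b - c) = 0" using A AB a' by (simp add: mult.commute)
      thus ?thesis using \<open>(b', c', d') = (c, b, d)\<close> a' by auto
    next
      assume *: "(b', c', d') = (c, d, b)"
      hence "(a - d) * (b - c) = 0" "(a - b) * (c - d) = 0" "(a - c) * (b - d) = 0"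
        using A B C AB BC AC a' by (simp_all add: mult.commute add.commute)
      thus ?thesis using * a' by auto
    next
      assume *: "(b', c', d') = (d, b, c)"
      hence "(a - d) * (b - c) = 0" "(a - b) * (c - d) = 0" "(a - c) * (b - d) = 0"
        using A B C AB BC AC a' by (simp_all add: mult.commute add.commute)
      thus ?thesis using * a' by auto
    next
      assume "(b', c', d') = (d, c, b)"
      hence "(a - c) * (b - d) = 0" using A AC a' by (simp add: mult.commute)
      thus ?thesis using \<open>(b', c', d') = (d, c, b)\<close> a' by auto
    qed (use a' in auto)
  qed
  show ?thesis
  proof (cases rule: mset4_cases[OF m])
    case 1 thus ?thesis using aux[OF 1 A B C] by blast
  next
    case 2 thus ?thesis using aux[OF 2] A B C by (auto simp: algebra_simps)
  next
    case 3 thus ?thesis using aux[OF 3] A B C by (auto simp: algebra_simps)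
  next
    case 4 thus ?thesis using aux[OF 4] A B C by (auto simp: algebra_simps)
  qed
qed

lemma attained_klein:
  assumes att: "attained t D0 D1 Dt Di Q" and t: "t \<noteq> 0" "t \<noteq> 1"
    and "mset [M0, M1, Mt, Mi] = mset [D0, D1, Dt, Di]"
    and "M0 * M1 + Mt * Mi = D0 * D1 + Dt * Di" "M0 * Mt + M1 * Mi = D0 * Dt + D1 * Di"
      "M0 * Mi + M1 * Mt = D0 * Di + D1 * Dt"
  shows "attained t M0 M1 Mt Mi Q"
proof -
  have "attained t Di Dt D1 D0 Q" "attained t Dt Di D0 D1 Q"
    using attained_swap_0i_1t[OF att t(1)] attained_swap_0t_1i[OF att t(2)] .
  moreover from attained_swap_0t_1i[OF this(1) t(2)] have "attained t D1 D0 Di Dt Q" .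
  ultimately show ?thesis using att klein_arrangement[OF assms(4-7)] by auto
qed

lemma HE_mset:
  assumes "HE h a b c d"
  shows "mset [(e_0 h)^2, (e_1 h)^2, (e_t h)^2, (e_inf h)^2] = mset [a^2, b^2, c^2, d^2]"
proof -
  obtain es where es: "mset es = mset [e_0 h, e_1 h, e_t h, e_inf h]"
    "list_all2 (\<lambda>e r. e = r \<or> e = - r) es [a, b, c, d]"
    using assms unfolding HE_def by blast
  have "map (\<lambda>x. x^2) es = [a^2, b^2, c^2, d^2]"
    using es(2) by (auto simp: list_all2_Cons2)
  moreover have "mset (map (\<lambda>x. x^2) es) = mset (map (\<lambda>x. x^2) [e_0 h, e_1 h, e_t h, e_inf h])"
    using es(1) by (metis mset_map)
  ultimately show ?thesis by simp
qed

lemma k1_K1: "k1 t h = K1 t ((e_0 h)^2) ((e_1 h)^2) ((e_t h)^2) ((e_inf h)^2)"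
  by (simp add: k1_def K1_def)

lemma k2_K2: "k2 t h = K2 t ((e_0 h)^2) ((e_1 h)^2) ((e_t h)^2) ((e_inf h)^2)"
  by (simp add: k2_def K2_def)

text \<open>\<open>K1\<close>, \<open>K2\<close> and \<open>J1\<close> times \<open>Q0\<close> are
  constant along the orbit of t, hence a family found at the normal form s yields one at t. That
  \<open>J1\<close> stays nonzero allows \<open>Q0\<close> to be recovered from \<open>Q1\<close>
  later.\<close>

lemma attained_orbit:
  assumes att: "attained s D0 D1 Dt Di Q" and j: "jinv t = jinv s"
    and t: "t \<noteq> 0" "t \<noteq> 1" and s: "s \<noteq> 0" "s \<noteq> 1" and J1: "J1 s \<noteq> 0"
  shows "J1 t \<noteq> 0 \<and> (\<exists>M0 M1 Mt Mi Q'. attained t M0 M1 Mt Mi Q' \<and> J1 t * Q' = J1 s * Q \<and>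
      mset [M0, M1, Mt, Mi] = mset [D0, D1, Dt, Di] \<and>
      K1 t M0 M1 Mt Mi = K1 s D0 D1 Dt Di \<and> K2 t M0 M1 Mt Mi = K2 s D0 D1 Dt Di)" (is "?P t")
proof (rule jinv_induct[OF j t s, where P = ?P])
  show "?P s" using att J1 by blast
next
  fix r assume r: "r \<noteq> 0" "r \<noteq> 1" "?P r"
  then obtain M0 M1 Mt Mi Q' where M: "attained r M0 M1 Mt Mi Q'" "J1 r * Q' = J1 s * Q"
      "mset [M0, M1, Mt, Mi] = mset [D0, D1, Dt, Di]"
      "K1 r M0 M1 Mt Mi = K1 s D0 D1 Dt Di" "K2 r M0 M1 Mt Mi = K2 s D0 D1 Dt Di" by blast
  have J: "J1 r \<noteq> 0" using r by blast
  hence d: "r^2 - r + 1 \<noteq> 0" by (auto simp: J1_def)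
  have "mset [M1, M0, Mt, Mi] = mset [D0, D1, Dt, Di]" using M(3) by (simp add: add_mset_commute)
  moreover have "J1 (1 - r) * - Q' = J1 s * Q" using M(2) by (simp add: J1_one_minus)
  moreover have "J1 (1 - r) \<noteq> 0" using J by (simp add: J1_one_minus)
  ultimately show "?P (1 - r)"
    using attained_one_minus[OF M(1)] K1_one_minus[of r M1 M0 Mt Mi] K2_one_minus[OF d, of M1 M0 Mt Mi] M(4,5)
    by metis
  have "mset [Mi, M1, Mt, M0] = mset [D0, D1, Dt, Di]" using M(3) by (simp add: add_mset_commute)
  moreover have "J1 (1 / r) * (Q' / r) = J1 s * Q" using M(2) r by (simp add: J1_inverse)
  moreover have "J1 (1 / r) \<noteq> 0" using J r by (simp add: J1_inverse)
  ultimately show "?P (1 / r)"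
    using attained_inverse[OF M(1) r(1)] K1_inverse[OF r(1,2), of Mi M1 Mt M0] K2_inverse[OF r(1) d, of Mi M1 Mt M0] M(4,5)
    by metis
qed

section \<open>Recovering the arrangement of the exponent differences from k1 and k2\<close>

lemma K1_pairings:
  "K1 t M0 M1 Mt Mi = (t^2 - t + 1) / (t * (t - 1)) *
     ((M0 * Mt + M1 * Mi) * t + (M0 * Mi + M1 * Mt) * (1 - t) - (M0 * M1 + Mt * Mi))"
  unfolding K1_def by (rule arg_cong[of _ _ "(*) _"]) (simp add: algebra_simps)

lemma K2_pairings:
  assumes "t^2 - t + 1 \<noteq> 0"
  shows "(t^2 - t + 1) * K2 t M0 M1 Mt Mi =
     (M0 * Mt + M1 * Mi) * t^2 + (M0 * Mi + M1 * Mt) * (t - 1)^2 + (M0 * M1 + Mt * Mi)"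
proof -
  define n where "n = t^2 - t + 1"
  have "n \<noteq> 0" using assms by (simp add: n_def)
  hence n: "n * (X / n + b + c) = X + (b + c) * n" for X b c :: complex
    by (simp add: distrib_left mult.commute)
  show ?thesis
    unfolding K2_def n_def[symmetric] n unfolding n_def by (simp add: power2_eq_square algebra_simps)
qed

lemma J1_nonzero:
  assumes "J1 t \<noteq> 0"
  shows "t + 1 \<noteq> 0" "t - 2 \<noteq> 0" "2 * t - 1 \<noteq> 0" "t^2 - t + 1 \<noteq> 0"
  using assms by (auto simp: J1_def)

lemma K1_eqD:
  assumes "K1 t M0 M1 Mt Mi = K1 t N0 N1 Nt Ni" "t \<noteq> 0" "t \<noteq> 1" "t^2 - t + 1 \<noteq> 0"
  shows "(M0 * Mt + M1 * Mi) * t + (M0 * Mi + M1 * Mt) * (1 - t) - (M0 * M1 + Mt * Mi)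
    = (N0 * Nt + N1 * Ni) * t + (N0 * Ni + N1 * Nt) * (1 - t) - (N0 * N1 + Nt * Ni)"
  using assms unfolding K1_pairings by simp

text \<open>For fixed t, k1 and k2 are linear in the three pairings, whose sum is determined by the
  multiset of squares. The system for the differences of pairings has determinant (t + 1) (t - 2) (2
  t - 1), a factor of \<open>J1\<close>; so the pairings agree, and the Klein four-group does the
  rest.\<close>

lemma specialization_by_k1_k2:
  assumes t: "t \<noteq> 0" "t \<noteq> 1" and s: "s \<noteq> 0" "s \<noteq> 1" "J1 s \<noteq> 0"
    and att: "attained s D0 D1 Dt Di Q"
    and ent: "entry_k2 t h j (\<delta>1, \<delta>2, \<delta>3, \<delta>4) q1 k k'"
    and inv: "jinv s = j" "J1 s * Q = q1" "K1 s D0 D1 Dt Di = k" "K2 s D0 D1 Dt Di = k'"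
    and ms: "mset [\<delta>1^2, \<delta>2^2, \<delta>3^2, \<delta>4^2] = mset [D0, D1, Dt, Di]"
  shows "specialization_of_parametric_pullback t h"
proof -
  let ?M0 = "(e_0 h)^2" and ?M1 = "(e_1 h)^2" and ?Mt = "(e_t h)^2" and ?Mi = "(e_inf h)^2"
  have h: "jinv t = jinv s" "HE h \<delta>1 \<delta>2 \<delta>3 \<delta>4" "J1 t * Q0 t h = J1 s * Q"
    "K1 t ?M0 ?M1 ?Mt ?Mi = K1 s D0 D1 Dt Di" "K2 t ?M0 ?M1 ?Mt ?Mi = K2 s D0 D1 Dt Di"
    using ent inv by (auto simp: entry_k2_def Q1_def k1_K1 k2_K2)
  obtain N0 N1 Nt Ni Q' where J: "J1 t \<noteq> 0" and N: "attained t N0 N1 Nt Ni Q'" "J1 t * Q' = J1 s * Q"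
      "mset [N0, N1, Nt, Ni] = mset [D0, D1, Dt, Di]"
      "K1 t N0 N1 Nt Ni = K1 s D0 D1 Dt Di" "K2 t N0 N1 Nt Ni = K2 s D0 D1 Dt Di"
    using attained_orbit[OF att h(1) t s] by blast
  have Q: "Q' = Q0 t h" using N(2) h(3) J by (metis mult_left_cancel)
  have m: "mset [?M0, ?M1, ?Mt, ?Mi] = mset [N0, N1, Nt, Ni]"
    using HE_mset[OF h(2)] ms N(3) by simp
  note nz = J1_nonzero[OF J]
  define A B C A' B' C' where "A = ?M0 * ?M1 + ?Mt * ?Mi" "B = ?M0 * ?Mt + ?M1 * ?Mi" "C = ?M0 * ?Mi + ?M1 * ?Mt"
    "A' = N0 * N1 + Nt * Ni" "B' = N0 * Nt + N1 * Ni" "C' = N0 * Ni + N1 * Nt"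
  note ABC = A_B_C_A'_B'_C'_def
  define a b c where "a = A - A'" "b = B - B'" "c = C - C'"
  have "K1 t ?M0 ?M1 ?Mt ?Mi = K1 t N0 N1 Nt Ni" using h(4) N(4) by simp
  from K1_eqD[OF this t nz(4)] have 1: "b * t + c * (1 - t) - a = 0"
    unfolding ABC[symmetric] a_b_c_def by (simp add: algebra_simps)
  have "B * t^2 + C * (t - 1)^2 + A = B' * t^2 + C' * (t - 1)^2 + A'"
    using K2_pairings[OF nz(4), of N0 N1 Nt Ni] K2_pairings[OF nz(4), of ?M0 ?M1 ?Mt ?Mi] h(5) N(5)
    unfolding ABC[symmetric] by simp
  hence 2: "b * t^2 + c * (t - 1)^2 + a = 0"
    unfolding a_b_c_def by (simp add: algebra_simps)
  have "A + B + C = A' + B' + C'"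
    using pairing_permutes[OF m] unfolding ABC[symmetric]
    by (elim insertE emptyE) (simp_all add: algebra_simps)
  hence c: "c = - a - b" unfolding a_b_c_def by (simp add: algebra_simps)
  have 3: "a * (t - 2) + b * (2 * t - 1) = 0"
    using 1 unfolding c by (simp add: algebra_simps)
  have 4: "a * (t - 2) * (- t) + b * (2 * t - 1) = 0"
    using 2 unfolding c by (simp add: algebra_simps power2_eq_square)
  have "a * ((t - 2) * (t + 1))
      = (a * (t - 2) + b * (2 * t - 1)) - (a * (t - 2) * (- t) + b * (2 * t - 1))"
    by (simp add: algebra_simps)
  hence "a * ((t - 2) * (t + 1)) = 0" unfolding 3 4 by simp
  hence a: "a = 0" using nz by simp
  hence b: "b = 0" using 3 nz by simp
  have "attained t ?M0 ?M1 ?Mt ?Mi (Q0 t h)"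
    using attained_klein[OF N(1) t m] a b c unfolding Q ABC[symmetric] by (simp add: a_b_c_def)
  thus ?thesis by (rule specialization_if_attained)
qed

text \<open>With two equal squares, two of the pairings have the same value y, and only the position
  of the third value x is open. For x different from y, \<open>K1\<close> has equal values at two
  positions only if t is -1, 2 or 1/2.\<close>

lemma pairings_by_K1:
  fixes x y A B C t :: complex
  assumes t: "t + 1 \<noteq> 0" "t - 2 \<noteq> 0" "2 * t - 1 \<noteq> 0"
    and M: "(A, B, C) \<in> {(x, y, y), (y, x, y), (y, y, x)}"
    and N: "(A', B', C') \<in> {(x, y, y), (y, x, y), (y, y, x)}"
    and eq: "B * t + C * (1 - t) - A = B' * t + C' * (1 - t) - A'"
  shows "A = A' \<and> B = B' \<and> C = C'"
proof -
  have 1: "y * t + y * (1 - t) - x = x * t + y * (1 - t) - y \<longleftrightarrow> (x - y) * (t + 1) = 0"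
    by (auto simp: algebra_simps)
  have 2: "y * t + y * (1 - t) - x = y * t + x * (1 - t) - y \<longleftrightarrow> (x - y) * (t - 2) = 0"
    by (auto simp: algebra_simps)
  have 3: "x * t + y * (1 - t) - y = y * t + x * (1 - t) - y \<longleftrightarrow> (x - y) * (2 * t - 1) = 0"
    by (auto simp: algebra_simps)
  show ?thesis
  proof (cases "x = y")
    case True thus ?thesis using M N by auto
  next
    case False
    hence 4: "y * t + y * (1 - t) - x \<noteq> x * t + y * (1 - t) - y"
      "y * t + y * (1 - t) - x \<noteq> y * t + x * (1 - t) - y"
      "x * t + y * (1 - t) - y \<noteq> y * t + x * (1 - t) - y"
      unfolding 1 2 3 using t by simp_all
    show ?thesis using M N
      by (elim insertE emptyE) (use eq 4 4[symmetric] in auto)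
  qed
qed

lemma specialization_by_k1:
  assumes t: "t \<noteq> 0" "t \<noteq> 1" and s: "s \<noteq> 0" "s \<noteq> 1" "J1 s \<noteq> 0"
    and att: "attained s D D Dt Di Q"
    and ent: "entry t h j (\<delta>1, \<delta>2, \<delta>3, \<delta>4) q1 k"
    and inv: "jinv s = j" "J1 s * Q = q1" "K1 s D D Dt Di = k"
    and ms: "mset [\<delta>1^2, \<delta>2^2, \<delta>3^2, \<delta>4^2] = mset [D, D, Dt, Di]"
  shows "specialization_of_parametric_pullback t h"
proof -
  let ?M0 = "(e_0 h)^2" and ?M1 = "(e_1 h)^2" and ?Mt = "(e_t h)^2" and ?Mi = "(e_inf h)^2"
  have h: "jinv t = jinv s" "HE h \<delta>1 \<delta>2 \<delta>3 \<delta>4" "J1 t * Q0 t h = J1 s * Q"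
    "K1 t ?M0 ?M1 ?Mt ?Mi = K1 s D D Dt Di"
    using ent inv by (auto simp: Q1_def k1_K1)
  obtain N0 N1 Nt Ni Q' where J: "J1 t \<noteq> 0" and N: "attained t N0 N1 Nt Ni Q'" "J1 t * Q' = J1 s * Q"
      "mset [N0, N1, Nt, Ni] = mset [D, D, Dt, Di]" "K1 t N0 N1 Nt Ni = K1 s D D Dt Di"
    using attained_orbit[OF att h(1) t s] by blast
  have Q: "Q' = Q0 t h" using N(2) h(3) J by (metis mult_left_cancel)
  have m: "mset [?M0, ?M1, ?Mt, ?Mi] = mset [N0, N1, Nt, Ni]"
    using HE_mset[OF h(2)] ms N(3) by simp
  note nz = J1_nonzero[OF J]
  have "K1 t ?M0 ?M1 ?Mt ?Mi = K1 t N0 N1 Nt Ni" using h(4) N(4) by simp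
  note eq = K1_eqD[OF this t nz(4)]
  define x y where "x = D * D + Dt * Di" "y = D * Dt + D * Di"
  have P: "(A, B, C) \<in> {(x, y, y), (y, x, y), (y, y, x)}"
    if "(A, B, C) \<in> {(D * D + Dt * Di, D * Dt + D * Di, D * Di + D * Dt),
      (D * D + Dt * Di, D * Di + D * Dt, D * Dt + D * Di),
      (D * Dt + D * Di, D * D + Dt * Di, D * Di + D * Dt),
      (D * Dt + D * Di, D * Di + D * Dt, D * D + Dt * Di),
      (D * Di + D * Dt, D * D + Dt * Di, D * Dt + D * Di),
      (D * Di + D * Dt, D * Dt + D * Di, D * D + Dt * Di)}" for A B C
    using that by (elim insertE emptyE) (simp_all add: x_y_def add.commute)
  have mM: "mset [?M0, ?M1, ?Mt, ?Mi] = mset [D, D, Dt, Di]" using m N(3) by simp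
  have "?M0 * ?M1 + ?Mt * ?Mi = N0 * N1 + Nt * Ni \<and> ?M0 * ?Mt + ?M1 * ?Mi = N0 * Nt + N1 * Ni
      \<and> ?M0 * ?Mi + ?M1 * ?Mt = N0 * Ni + N1 * Nt"
    by (rule pairings_by_K1[OF nz(1-3) P[OF pairing_permutes[OF mM]] P[OF pairing_permutes[OF N(3)]] eq])
  hence "attained t ?M0 ?M1 ?Mt ?Mi (Q0 t h)"
    using attained_klein[OF N(1) t m] unfolding Q by blast
  thus ?thesis by (rule specialization_if_attained)
qed

text \<open>\<open>T\<close> collects the free exponent differences; one at z = 0 or z = 1 can be
  free when \<open>g\<close> or \<open>f\<close> is constant. The value of \<open>Q0\<close> is
  sought in the form qa + qb e1^2 + qc e_inf^2, and the identity must hold on the whole family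
  because the covering is common to it.\<close>

lemma (in covering) attained_free:
  assumes T: "HG_Infinity \<in> T" "HG_Zero \<in> T \<Longrightarrow> pderiv g = 0" "HG_One \<in> T \<Longrightarrow> pderiv f = 0"
    and ident: "\<And>e x. (HG_Zero \<notin> T \<Longrightarrow> e HG_Zero = 1 / of_nat k0) \<Longrightarrow> (HG_One \<notin> T \<Longrightarrow> e HG_One = 1 / of_nat k1) \<Longrightarrow>
      6 * (res_coeff (e HG_Zero) (e HG_One) z1 m1 * ((x - w2) * (x - w3))^2
           + res_coeff (e HG_Zero) (e HG_One) z2 m2 * ((x - w1) * (x - w3))^2
           + res_coeff (e HG_Zero) (e HG_One) z3 m3 * ((x - w1) * (x - w2))^2)
      - 3 * (res_coeff (e HG_Zero) (e HG_One) z1 m1 * ((x - w2) * (x - w3))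
           + res_coeff (e HG_Zero) (e HG_One) z2 m2 * ((x - w1) * (x - w3))
           + res_coeff (e HG_Zero) (e HG_One) z3 m3 * ((x - w1) * (x - w2)))^2
      + 3 * ((1 - e HG_Zero - e HG_One)^2 - (e HG_Infinity)^2) * (\<kappa>^2 * (c1 / c0) * poly f x ^ (k1 - 2) * poly g x ^ (k0 - 2)
          * ((x - w1) ^ over HG_Zero z1 m1 * (x - w2) ^ over HG_Zero z2 m2 * (x - w3) ^ over HG_Zero z3 m3)
          * ((x - w1) ^ over HG_One z1 m1 * (x - w2) ^ over HG_One z2 m2 * (x - w3) ^ over HG_One z3 m3))
      = 3 * ((1 - (of_nat m1 * e z1)^2) * ((x - w2) * (x - w3))^2
           + (1 - (of_nat m2 * e z2)^2) * ((x - w1) * (x - w3))^2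
           + (1 - (of_nat m3 * e z3)^2) * ((x - w1) * (x - w2))^2)
        + (3 * ((of_nat m1 * e z1)^2 + (of_nat m2 * e z2)^2 + (of_nat m3 * e z3)^2
               - (of_nat mi * e zi)^2 - 2) * (x - w1)
           - (w2 - w1) * (qa + qb * (e HG_One)^2 + qc * (e HG_Infinity)^2)
           + ((w3 - w1) + (w2 - w1)) * ((of_nat mi * e zi)^2 + 2 - 2 * (of_nat m1 * e z1)^2)
           - (of_nat m2 * e z2)^2 * (2 * (w3 - w1) - (w2 - w1))
           + (of_nat m3 * e z3)^2 * ((w3 - w1) - 2 * (w2 - w1)))
          * ((x - w1) * (x - w2) * (x - w3))"
    and e: "HG_Zero \<notin> T \<Longrightarrow> e HG_Zero = 1 / of_nat k0" "HG_One \<notin> T \<Longrightarrow> e HG_One = 1 / of_nat k1"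
    and "s = (w3 - w1) / (w2 - w1)" "M1 = (of_nat m1 * e z1)^2" "M2 = (of_nat m2 * e z2)^2"
      "M3 = (of_nat m3 * e z3)^2" "M4 = (of_nat mi * e zi)^2"
      "Q = qa + qb * (e HG_One)^2 + qc * (e HG_Infinity)^2"
  shows "attained s M1 M2 M3 M4 Q"
proof -
  have fam: "HG_Zero \<notin> T \<Longrightarrow> hg_exp_diff p HG_Zero = 1 / of_nat k0"
      "HG_One \<notin> T \<Longrightarrow> hg_exp_diff p HG_One = 1 / of_nat k1" if "p \<in> hg_family T e" for p
    using that e by (auto simp: hg_family_def)
  \<comment> \<open>Prescribed exponent differences give C, the sum A + B = \<open>a\<close> and the
    difference A - B.\<close>
  define p0 :: hg_params where "p0 = (let a = 1 - e HG_Zero - e HG_One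
    in ((a + e HG_Infinity) / 2, (a - e HG_Infinity) / 2, 1 - e HG_Zero))"
  have p0: "hg_exp_diff p0 = e"
  proof
    show "hg_exp_diff p0 z = e z" for z
      by (cases z) (simp_all add: p0_def Let_def field_simps)
  qed
  hence p0T: "p0 \<in> hg_family T e" by (simp add: hg_family_def)
  have k': "(of_nat k0 :: complex) \<noteq> 0" "(of_nat k1 :: complex) \<noteq> 0" using k by auto
  have "hg_exp_diff p HG_Infinity = fst p - fst (snd p)"
    "hg_exp_diff p HG_One = snd (snd p) - fst p - fst (snd p)" for p by (cases p; simp)+
  hence cont: "continuous_on (hg_family T e)
      (\<lambda>p. qa + qb * (hg_exp_diff p HG_One)^2 + qc * (hg_exp_diff p HG_Infinity)^2)"
    by (auto intro!: continuous_intros)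
  have k: "of_nat k0 * hg_exp_diff p HG_Zero = 1 \<or> pderiv g = 0"
    "of_nat k1 * hg_exp_diff p HG_One = 1 \<or> pderiv f = 0" if "p \<in> hg_family T e" for p
    using fam[OF that] T(2,3) k' by (metis nonzero_mult_div_cancel_left times_divide_eq_right mult.right_neutral)+
  have "T \<noteq> {}" using T(1) by blast
  from attained_covering[OF this p0T k cont] ident fam
  have "attained ((w3 - w1) / (w2 - w1)) ((of_nat m1 * hg_exp_diff p0 z1)^2) ((of_nat m2 * hg_exp_diff p0 z2)^2)
     ((of_nat m3 * hg_exp_diff p0 z3)^2) ((of_nat mi * hg_exp_diff p0 zi)^2)
     (qa + qb * (hg_exp_diff p0 HG_One)^2 + qc * (hg_exp_diff p0 HG_Infinity)^2)"
    unfolding W_def B0_def B1_def by blast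
  thus ?thesis unfolding p0 assms(7-) .
qed

fun exp_at :: "nat \<Rightarrow> nat \<Rightarrow> complex \<Rightarrow> hg_sing \<Rightarrow> complex" where
  "exp_at m n l HG_Zero = 1 / of_nat m"
| "exp_at m n l HG_One = 1 / of_nat n"
| "exp_at m n l HG_Infinity = l"

lemma attained_if_covering:
  fixes l s :: complex and k0 k1 :: nat
  assumes cov: "covering g f k0 k1 c0 c1 \<kappa> w1 w2 w3 z1 z2 z3 m1 m2 m3"
    and ident: "\<And>l x e0 e1. e0 = 1 / of_nat k0 \<Longrightarrow> e1 = 1 / of_nat k1 \<Longrightarrow>
      6 * (res_coeff e0 e1 z1 m1 * ((x - w2) * (x - w3))^2
           + res_coeff e0 e1 z2 m2 * ((x - w1) * (x - w3))^2
           + res_coeff e0 e1 z3 m3 * ((x - w1) * (x - w2))^2)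
      - 3 * (res_coeff e0 e1 z1 m1 * ((x - w2) * (x - w3))
           + res_coeff e0 e1 z2 m2 * ((x - w1) * (x - w3))
           + res_coeff e0 e1 z3 m3 * ((x - w1) * (x - w2)))^2
      + 3 * ((1 - e0 - e1)^2 - l^2) * (\<kappa>^2 * (c1 / c0) * poly f x ^ (k1 - 2) * poly g x ^ (k0 - 2)
          * ((x - w1) ^ over HG_Zero z1 m1 * (x - w2) ^ over HG_Zero z2 m2 * (x - w3) ^ over HG_Zero z3 m3)
          * ((x - w1) ^ over HG_One z1 m1 * (x - w2) ^ over HG_One z2 m2 * (x - w3) ^ over HG_One z3 m3))
      = 3 * ((1 - (of_nat m1 * exp_at k0 k1 l z1)^2) * ((x - w2) * (x - w3))^2
           + (1 - (of_nat m2 * exp_at k0 k1 l z2)^2) * ((x - w1) * (x - w3))^2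
           + (1 - (of_nat m3 * exp_at k0 k1 l z3)^2) * ((x - w1) * (x - w2))^2)
        + (3 * ((of_nat m1 * exp_at k0 k1 l z1)^2 + (of_nat m2 * exp_at k0 k1 l z2)^2
               + (of_nat m3 * exp_at k0 k1 l z3)^2 - (of_nat mi * exp_at k0 k1 l zi)^2 - 2) * (x - w1)
           - (w2 - w1) * (q0 + q1 * l^2)
           + ((w3 - w1) + (w2 - w1)) * ((of_nat mi * exp_at k0 k1 l zi)^2 + 2 - 2 * (of_nat m1 * exp_at k0 k1 l z1)^2)
           - (of_nat m2 * exp_at k0 k1 l z2)^2 * (2 * (w3 - w1) - (w2 - w1))
           + (of_nat m3 * exp_at k0 k1 l z3)^2 * ((w3 - w1) - 2 * (w2 - w1)))
          * ((x - w1) * (x - w2) * (x - w3))"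
    and "s = (w3 - w1) / (w2 - w1)"
    and "M1 = (of_nat m1 * exp_at k0 k1 l z1)^2" "M2 = (of_nat m2 * exp_at k0 k1 l z2)^2"
      "M3 = (of_nat m3 * exp_at k0 k1 l z3)^2" "M4 = (of_nat mi * exp_at k0 k1 l zi)^2"
  shows "attained s M1 M2 M3 M4 (q0 + q1 * l^2)"
proof -
  show ?thesis
  proof (rule covering.attained_free[OF cov, where T = "{HG_Infinity}" and qa = q0 and qb = 0 and qc = q1
        and e = "exp_at k0 k1 l" and mi = mi and zi = zi])
    fix e :: "hg_sing \<Rightarrow> complex" and x
    assume "HG_Zero \<notin> {HG_Infinity} \<Longrightarrow> e HG_Zero = 1 / of_nat k0"
      "HG_One \<notin> {HG_Infinity} \<Longrightarrow> e HG_One = 1 / of_nat k1"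
    hence e: "e HG_Zero = 1 / of_nat k0" "e HG_One = 1 / of_nat k1" by simp_all
    have "exp_at k0 k1 (e HG_Infinity) = e"
    proof
      show "exp_at k0 k1 (e HG_Infinity) z = e z" for z by (cases z) (simp_all add: e)
    qed
    note * = ident[OF e, of x "e HG_Infinity", unfolded this]
    show "6 * (res_coeff (e HG_Zero) (e HG_One) z1 m1 * ((x - w2) * (x - w3))^2
           + res_coeff (e HG_Zero) (e HG_One) z2 m2 * ((x - w1) * (x - w3))^2
           + res_coeff (e HG_Zero) (e HG_One) z3 m3 * ((x - w1) * (x - w2))^2)
      - 3 * (res_coeff (e HG_Zero) (e HG_One) z1 m1 * ((x - w2) * (x - w3))
           + res_coeff (e HG_Zero) (e HG_One) z2 m2 * ((x - w1) * (x - w3))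
           + res_coeff (e HG_Zero) (e HG_One) z3 m3 * ((x - w1) * (x - w2)))^2
      + 3 * ((1 - e HG_Zero - e HG_One)^2 - (e HG_Infinity)^2) * (\<kappa>^2 * (c1 / c0) * poly f x ^ (k1 - 2) * poly g x ^ (k0 - 2)
          * ((x - w1) ^ over HG_Zero z1 m1 * (x - w2) ^ over HG_Zero z2 m2 * (x - w3) ^ over HG_Zero z3 m3)
          * ((x - w1) ^ over HG_One z1 m1 * (x - w2) ^ over HG_One z2 m2 * (x - w3) ^ over HG_One z3 m3))
      = 3 * ((1 - (of_nat m1 * e z1)^2) * ((x - w2) * (x - w3))^2
           + (1 - (of_nat m2 * e z2)^2) * ((x - w1) * (x - w3))^2
           + (1 - (of_nat m3 * e z3)^2) * ((x - w1) * (x - w2))^2)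
        + (3 * ((of_nat m1 * e z1)^2 + (of_nat m2 * e z2)^2 + (of_nat m3 * e z3)^2
               - (of_nat mi * e zi)^2 - 2) * (x - w1)
           - (w2 - w1) * (q0 + 0 * (e HG_One)^2 + q1 * (e HG_Infinity)^2)
           + ((w3 - w1) + (w2 - w1)) * ((of_nat mi * e zi)^2 + 2 - 2 * (of_nat m1 * e z1)^2)
           - (of_nat m2 * e z2)^2 * (2 * (w3 - w1) - (w2 - w1))
           + (of_nat m3 * e z3)^2 * ((w3 - w1) - 2 * (w2 - w1)))
          * ((x - w1) * (x - w2) * (x - w3))"
      using * by (simp only: mult_zero_left add_0_right)
  qed (simp_all add: assms(3-))
qed

section \<open>Singular points and invariants in quadratic extensions\<close>

lemma sqrt_pair_products:
  fixes r c :: complex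
  assumes "r^2 = c"
  shows "(x + r) * (x - r) = x^2 - c" "(x + r) * ((x - r) * y) = (x^2 - c) * y"
    "(x + r) ^ m * (x - r) ^ m = (x^2 - c) ^ m" "(x + r) ^ m * ((x - r) ^ m * y) = (x^2 - c) ^ m * y"
proof -
  show *: "(x + r) * (x - r) = x^2 - c"
    using assms by (simp add: algebra_simps power2_eq_square)
  thus "(x + r) * ((x - r) * y) = (x^2 - c) * y"
    "(x + r) ^ m * (x - r) ^ m = (x^2 - c) ^ m" "(x + r) ^ m * ((x - r) ^ m * y) = (x^2 - c) ^ m * y"
    by (simp_all add: mult.assoc[symmetric] power_mult_distrib[symmetric])
qed

lemma sqrt_distinct:
  fixes r c :: complex
  assumes "r^2 = c" "c \<noteq> 0" "c \<noteq> 1"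
  shows "r \<noteq> 0" "r \<noteq> 1" "- r \<noteq> 1"
  using assms by (auto simp: minus_equation_iff[of r])

text \<open>Singular points -r, r, 1 give s = (1 + r)/(2 r), and changing the sign of r replaces s
  by 1 - s. Hence T = s (s - 1) is rational in c = r^2, and with it j and, for equal squares at -r
  and r, also k1. Both \<open>J1 s\<close> and \<open>Q0\<close> are odd in r, since 2 s - 1 = 1/r,
  and their product is free of r.\<close>

lemma specialization_by_k1_sqrt:
  fixes r c :: complex
  assumes t: "t \<noteq> 0" "t \<noteq> 1" and r: "r^2 = c" "c \<noteq> 0" "c \<noteq> 1"
    and T: "T = (1 - c) / (4 * c)" "T + 1 \<noteq> 0" "T - 2 \<noteq> 0"
    and att: "attained ((1 + r) / (2 * r)) D D Dt Di (r * a + r * b * m^2)"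
    and ent: "entry t h j (\<delta>1, \<delta>2, \<delta>3, \<delta>4) q1 k"
    and inv: "256 * (T + 1)^3 / T^2 = j" "(T - 2) * (T + 1) / T^2 * (a + b * m^2) = q1"
      "- ((T + 1) / T) * (D - Dt) * (D - Di) = k"
    and ms: "mset [\<delta>1^2, \<delta>2^2, \<delta>3^2, \<delta>4^2] = mset [D, D, Dt, Di]"
  shows "specialization_of_parametric_pullback t h"
proof -
  note nz = sqrt_distinct[OF r]
  define s where "s = (1 + r) / (2 * r)"
  have ss: "2 * s - 1 = 1 / r" using nz by (simp add: s_def field_simps)
  have "(2 * s - 1)^2 = 1 / c" by (simp add: ss power_divide r)
  hence "s * (s - 1) = (1 / c - 1) / 4" by (simp add: power2_eq_square algebra_simps)
  hence sT: "s * (s - 1) = T" using r(2) by (simp add: T field_simps)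
  hence e: "s^2 - s + 1 = T + 1" "(s + 1) * (s - 2) = T - 2" "s^2 * (s - 1)^2 = T^2"
    by (simp_all add: power2_eq_square algebra_simps flip: sT)
  have T0: "T \<noteq> 0" using r by (simp add: T)
  have s01: "s \<noteq> 0" "s \<noteq> 1" using sT T0 by auto
  have J: "J1 s = (T - 2) * (1 / r) * (T + 1) / T^2" unfolding J1_def e ss ..
  have ra: "r * a + r * b * m^2 = r * (a + b * m^2)" by (simp add: distrib_left mult.assoc)
  show ?thesis
  proof (rule specialization_by_k1[OF t s01 _ att[folded s_def] ent])
    show "J1 s \<noteq> 0" using nz T T0 by (simp add: J)
    show "jinv s = j" unfolding jinv_def e inv(1) ..
    show "J1 s * (r * a + r * b * m^2) = q1" 
      unfolding J inv(2)[symmetric] ra using nz(1) by simp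
    show "K1 s D D Dt Di = k" unfolding K1_def e sT inv(3)[symmetric] by simp
  qed (fact ms)
qed

text \<open>Meant for s in a quadratic field: the inverses \<open>v\<close> of s (s - 1) and
  \<open>n\<close> of s^2 - s + 1 are supplied, divisions become products, and what remains are
  polynomial identities modulo the equation of the field generator.\<close>

lemma specialization_by_k1_k2_inverses:
  assumes t: "t \<noteq> 0" "t \<noteq> 1"
    and att: "attained s D0 D1 Dt Di Q"
    and ent: "entry_k2 t h j (\<delta>1, \<delta>2, \<delta>3, \<delta>4) q1 k k'"
    and s: "s * (s - 1) = u" "u * v = 1" "(u + 1) * n = 1" "u - 2 \<noteq> 0" "2 * s - 1 \<noteq> 0"
    and J: "256 * (u + 1)^3 * v^2 = j'" "(u - 2) * (2 * s - 1) * (u + 1) * v^2 = J"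
    and inv: "j' = j" "J * Q = q1"
      "(u + 1) * v * ((D0 - D1) * (Dt - Di) * s - (D0 - Dt) * (D1 - Di)) = k"
      "((D0 * Dt + D1 * Di) * s^2 - (D0 * Di + D1 * Dt) * s + D0 * D1 + Dt * Di) * n
         + D0 * Di + D1 * Dt = k'"
    and ms: "mset [\<delta>1^2, \<delta>2^2, \<delta>3^2, \<delta>4^2] = mset [D0, D1, Dt, Di]"
  shows "specialization_of_parametric_pullback t h"
proof -
  have nz: "u \<noteq> 0" "u + 1 \<noteq> 0" using s(2,3) by auto
  have s01: "s \<noteq> 0" "s \<noteq> 1" using nz(1) s(1) by auto
  have d: "x / u = x * v" "x / u^2 = x * v^2" "x / (u + 1) = x * n" for x
    using s(2,3) nz by (simp_all add: divide_eq_eq power_mult_distrib[symmetric] mult.assoc mult.commute)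
  have e: "s^2 - s + 1 = u + 1" "(s + 1) * (s - 2) = u - 2" "s^2 * (s - 1)^2 = u^2"
    by (simp_all add: power2_eq_square algebra_simps flip: s(1))
  have J1: "J1 s = J" unfolding J1_def e d J(2) ..
  show ?thesis
  proof (rule specialization_by_k1_k2[OF t s01 _ att ent])
    have "v \<noteq> 0" using s(2) by auto
    thus "J1 s \<noteq> 0" using s nz by (simp add: J1 J(2)[symmetric])
    show "jinv s = j" unfolding jinv_def e d J(1) inv(1) ..
    show "J1 s * Q = q1" unfolding J1 inv(2) ..
    show "K1 s D0 D1 Dt Di = k" unfolding K1_def e s(1) d inv(3) ..
    show "K2 s D0 D1 Dt Di = k'" unfolding K2_def e d inv(4) ..
  qed (fact ms)
qed

lemma div_eq_mult_if: "y * z = 1 \<Longrightarrow> x / y = x * z" for x y z :: complex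
  by (metis inverse_unique divide_inverse)

section \<open>The coverings with several parameters\<close>

fun exps :: "complex \<Rightarrow> complex \<Rightarrow> complex \<Rightarrow> hg_sing \<Rightarrow> complex" where
  "exps a b c HG_Zero = a" | "exps a b c HG_One = b" | "exps a b c HG_Infinity = c"

text \<open>The covering z = x^2, branched over 0 and infinity, with 1 and -1 over 1. All three
  hypergeometric exponent differences are free.\<close>

lemma attained_square:
  "attained (-1) (\<beta>^2) (\<alpha>^2) (\<alpha>^2) (\<gamma>^2) 0"
proof -
  have "covering [:1:] [:1:] 2 2 1 1 2 0 1 (-1) HG_Zero HG_One HG_One 2 1 1"
    by (unfold_locales; (simp add: over_def)?; algebra)
  thus ?thesis
    by (rule covering.attained_free[where T = UNIV and mi = 2 and zi = HG_Infinity
      and qa = 0 and qb = 0 and qc = 0 and e = "exps (\<beta> / 2) \<alpha> (\<gamma> / 2)"];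
        (simp add: over_def)?; algebra)
qed

text \<open>The orbit is t = -1, 2, 1/2, where \<open>J1\<close> vanishes. The condition
  \<open>Q0 = 0\<close> is itself invariant under the substitutions. At each of these t,
  \<open>K1\<close> is a multiple of 2 X - Y - Z for one distinguished pairing X, so it decides
  which pairing joins \<alpha>^2 with \<alpha>^2.\<close>

lemma specialization_square:
  assumes t: "t \<noteq> 0" "t \<noteq> 1" and j: "jinv t = 1728"
    and h: "HE h \<alpha> \<alpha> \<beta> \<gamma>" "Q0 t h = 0" "k1 t h = 3 * (\<alpha>^2 - \<beta>^2) * (\<alpha>^2 - \<gamma>^2)"
  shows "specialization_of_parametric_pullback t h"
proof -
  let ?M0 = "(e_0 h)^2" and ?M1 = "(e_1 h)^2" and ?Mt = "(e_t h)^2" and ?Mi = "(e_inf h)^2"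
  have j1: "jinv (-1) = 1728" by (simp add: jinv_def)
  have js: "jinv t = jinv (-1)" using j j1 by simp
  have s: "(-1::complex) \<noteq> 1" by (simp add: minus_equation_iff)
  define P where "P = (\<lambda>r. \<exists>N0 N1 Nt Ni. attained r N0 N1 Nt Ni 0 \<and>
    mset [N0, N1, Nt, Ni] = mset [\<beta>^2, \<alpha>^2, \<alpha>^2, \<gamma>^2] \<and>
    K1 r N0 N1 Nt Ni = 3 * (\<alpha>^2 - \<beta>^2) * (\<alpha>^2 - \<gamma>^2))"
  have "P t"
  proof (rule jinv_induct[OF js t _ s])
    have "K1 (-1) (\<beta>^2) (\<alpha>^2) (\<alpha>^2) (\<gamma>^2) = 3 * (\<alpha>^2 - \<beta>^2) * (\<alpha>^2 - \<gamma>^2)"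
      by (simp add: K1_def algebra_simps)
    thus "P (-1)" unfolding P_def using attained_square by blast
  next
    fix r assume r: "r \<noteq> 0" "r \<noteq> 1" "P r"
    then obtain N0 N1 Nt Ni where N: "attained r N0 N1 Nt Ni 0"
      "mset [N0, N1, Nt, Ni] = mset [\<beta>^2, \<alpha>^2, \<alpha>^2, \<gamma>^2]"
      "K1 r N0 N1 Nt Ni = 3 * (\<alpha>^2 - \<beta>^2) * (\<alpha>^2 - \<gamma>^2)" unfolding P_def by blast
    have "mset [N1, N0, Nt, Ni] = mset [\<beta>^2, \<alpha>^2, \<alpha>^2, \<gamma>^2]"
      using N(2) by (simp add: add_mset_commute)
    thus "P (1 - r)" unfolding P_def
      using attained_one_minus[OF N(1)] N(3) K1_one_minus[of r N1 N0 Nt Ni] by auto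
    have "mset [Ni, N1, Nt, N0] = mset [\<beta>^2, \<alpha>^2, \<alpha>^2, \<gamma>^2]"
      using N(2) by (simp add: add_mset_commute)
    thus "P (1 / r)" unfolding P_def
      using attained_inverse[OF N(1) r(1)] N(3) K1_inverse[OF r(1,2), of Ni N1 Nt N0] by auto
  qed simp
  then obtain N0 N1 Nt Ni where N: "attained t N0 N1 Nt Ni 0"
      "mset [N0, N1, Nt, Ni] = mset [\<beta>^2, \<alpha>^2, \<alpha>^2, \<gamma>^2]"
      "K1 t N0 N1 Nt Ni = 3 * (\<alpha>^2 - \<beta>^2) * (\<alpha>^2 - \<gamma>^2)" unfolding P_def by blast
  have "t \<in> {-1, 1 - (-1), 1 / (-1), 1 - 1 / (-1), 1 / (1 - (-1)), 1 - 1 / (1 - (-1))}"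
    by (rule jinv_eq_cases[OF js t _ s]) simp
  hence t3: "t = -1 \<or> t = 2 \<or> t = 1 / 2" by auto
  define x y where "x = \<alpha>^2 * \<alpha>^2 + \<beta>^2 * \<gamma>^2" "y = \<alpha>^2 * \<beta>^2 + \<alpha>^2 * \<gamma>^2"
  have xy: "3 * (\<alpha>^2 - \<beta>^2) * (\<alpha>^2 - \<gamma>^2) = 3 * (x - y)"
    by (simp add: x_y_def algebra_simps)
  have P: "(A, B, C) \<in> {(x, y, y), (y, x, y), (y, y, x)}"
    if "(A, B, C) \<in> {(\<beta>^2 * \<alpha>^2 + \<alpha>^2 * \<gamma>^2, \<beta>^2 * \<alpha>^2 + \<alpha>^2 * \<gamma>^2, \<beta>^2 * \<gamma>^2 + \<alpha>^2 * \<alpha>^2),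
      (\<beta>^2 * \<alpha>^2 + \<alpha>^2 * \<gamma>^2, \<beta>^2 * \<gamma>^2 + \<alpha>^2 * \<alpha>^2, \<beta>^2 * \<alpha>^2 + \<alpha>^2 * \<gamma>^2),
      (\<beta>^2 * \<alpha>^2 + \<alpha>^2 * \<gamma>^2, \<beta>^2 * \<alpha>^2 + \<alpha>^2 * \<gamma>^2, \<beta>^2 * \<gamma>^2 + \<alpha>^2 * \<alpha>^2),
      (\<beta>^2 * \<alpha>^2 + \<alpha>^2 * \<gamma>^2, \<beta>^2 * \<gamma>^2 + \<alpha>^2 * \<alpha>^2, \<beta>^2 * \<alpha>^2 + \<alpha>^2 * \<gamma>^2),
      (\<beta>^2 * \<gamma>^2 + \<alpha>^2 * \<alpha>^2, \<beta>^2 * \<alpha>^2 + \<alpha>^2 * \<gamma>^2, \<beta>^2 * \<alpha>^2 + \<alpha>^2 * \<gamma>^2),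
      (\<beta>^2 * \<gamma>^2 + \<alpha>^2 * \<alpha>^2, \<beta>^2 * \<alpha>^2 + \<alpha>^2 * \<gamma>^2, \<beta>^2 * \<alpha>^2 + \<alpha>^2 * \<gamma>^2)}" for A B C
    using that by (elim insertE emptyE) (simp_all add: x_y_def mult.commute add.commute)
  \<comment> \<open>The pairings with the value \<open>x\<close> in the distinguished position: the
    third for t = -1, the second for t = 2, the first for t = 1/2.\<close>
  define special where "special = (if t = -1 then (y, y, x) else if t = 2 then (y, x, y) else (x, y, y))"
  have half: "(1 / 2 :: complex) \<noteq> - 1" "(2 :: complex) \<noteq> - 1" "(1 / 2 :: complex) \<noteq> 2"
    by (simp_all add: field_simps minus_equation_iff)
  have Z: "(A, B, C) = special"
    if abc: "(A, B, C) \<in> {(x, y, y), (y, x, y), (y, y, x)}"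
      and K: "(t^2 - t + 1) / (t * (t - 1)) * (B * t + C * (1 - t) - A) = 3 * (x - y)" for A B C
  proof (cases "x = y")
    case True thus ?thesis using abc by (auto simp: special_def)
  next
    case False
    from t3 have "2 * A - B - C = 2 * (x - y) \<and> special = (x, y, y) \<or>
      2 * B - A - C = 2 * (x - y) \<and> special = (y, x, y) \<or>
      2 * C - A - B = 2 * (x - y) \<and> special = (y, y, x)"
    proof (elim disjE)
      assume [simp]: "t = -1"
      have "3 * (2 * C - A - B) = 3 * (2 * (x - y))" using K by (simp add: field_simps)
      hence "2 * C - A - B = 2 * (x - y)" by (simp only: mult_cancel_left) simp
      thus ?thesis by (simp add: special_def)
    next
      assume [simp]: "t = 2"
      have "3 * (2 * B - A - C) = 3 * (2 * (x - y))" using K by (simp add: field_simps)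
      hence "2 * B - A - C = 2 * (x - y)" by (simp only: mult_cancel_left) simp
      thus ?thesis using half by (simp add: special_def)
    next
      assume [simp]: "t = 1 / 2"
      have "3 * (2 * A - B - C) = 3 * (2 * (x - y))" using K by (simp add: field_simps power2_eq_square)
      hence "2 * A - B - C = 2 * (x - y)" by (simp only: mult_cancel_left) simp
      thus ?thesis using half by (simp add: special_def)
    qed
    thus ?thesis using abc False by (elim disjE insertE emptyE) (auto simp: algebra_simps)
  qed
  have m: "mset [?M0, ?M1, ?Mt, ?Mi] = mset [\<beta>^2, \<alpha>^2, \<alpha>^2, \<gamma>^2]"
    using HE_mset[OF h(1)] by (simp add: add_mset_commute)
  have "(?M0 * ?M1 + ?Mt * ?Mi, ?M0 * ?Mt + ?M1 * ?Mi, ?M0 * ?Mi + ?M1 * ?Mt) = special"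
    by (rule Z[OF P[OF pairing_permutes[OF m]]])
       (use h(3) in \<open>simp only: k1_K1 K1_pairings xy\<close>)
  moreover have "(N0 * N1 + Nt * Ni, N0 * Nt + N1 * Ni, N0 * Ni + N1 * Nt) = special"
    by (rule Z[OF P[OF pairing_permutes[OF N(2)]]])
       (use N(3) in \<open>simp only: K1_pairings xy\<close>)
  ultimately have "attained t ?M0 ?M1 ?Mt ?Mi 0"
    using attained_klein[OF N(1) t, of ?M0 ?M1 ?Mt ?Mi] m N(2) by (metis prod.inject)
  thus ?thesis using specialization_if_attained h(2) by simp
qed

text \<open>For an equianharmonic triple 0, 1, t the polynomial x (x - 1) (x - t) differs by a
  constant from the cube of a linear polynomial with root at the barycentre (1 + t)/3. The covering
  is this cube, scaled so that 0, 1, t lie over 1.\<close>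

lemma attained_cubic:
  assumes t: "t^2 - t + 1 = 0"
  shows "attained t (\<alpha>^2) (\<alpha>^2) (\<alpha>^2) (\<beta>^2) 0"
proof -
  have nz: "t \<noteq> 0" "t \<noteq> 1" "2 * t - 1 \<noteq> 0"
    using t by (auto, algebra)
  have "covering [:-(1 + t), 3:] [:1:] 3 2 ((2 * t - 1) / 9) (3 * (2 * t - 1)) (1/3) 0 1 t
      HG_One HG_One HG_One 1 1 1"
    by (unfold_locales; (use nz in \<open>simp add: over_def\<close>)?; use t in algebra)
  note c = this
  have "3 * y / (y / 9) = 27" if "y \<noteq> 0" for y :: complex using that by simp
  note k = this[OF nz(3)]
  show ?thesis
    by (rule covering.attained_free[OF c, where T = "{HG_One, HG_Infinity}" and mi = 3 and zi = HG_Infinity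
          and qa = 0 and qb = 0 and qc = 0 and e = "exps (1/3) \<alpha> (\<beta> / 3)"],
        simp_all add: over_def k del: distrib_left_numeral right_diff_distrib_numeral)
       (use t in algebra)
qed

text \<open>Three equal squares make all three pairings equal, hence every arrangement is equivalent
  to the standard one.\<close>

lemma specialization_cubic:
  assumes t: "t \<noteq> 0" "t \<noteq> 1" and j: "jinv t = 0"
    and h: "HE h \<alpha> \<alpha> \<alpha> \<beta>" "Q0 t h = 0"
  shows "specialization_of_parametric_pullback t h"
proof -
  have "t^2 - t + 1 = 0" using j t by (simp add: jinv_def)
  note att = attained_cubic[OF this, of \<alpha> \<beta>]
  note m = HE_mset[OF h(1)]
  have "attained t ((e_0 h)^2) ((e_1 h)^2) ((e_t h)^2) ((e_inf h)^2) 0"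
    by (rule attained_klein[OF att t m];
        use pairing_permutes[OF m] in \<open>elim insertE emptyE; simp add: mult.commute add.commute\<close>)
  thus ?thesis using specialization_if_attained h(2) by simp
qed

text \<open>The covering is (1 + T3(x))/2 with the cubic Chebyshev polynomial T3 = 4 x^3 - 3 x; its
  pole of order 3 at infinity turns the free parameter \<beta>/3 into \<beta>.\<close>

lemma attained_chebyshev:
  "attained (1/4) ((1/2)^2) (\<alpha>^2) ((2 * \<alpha>)^2) (\<beta>^2) (-3/16 + 1/4 * \<alpha>^2 + 1/2 * \<beta>^2)"
proof -
  have "covering [:-1, 2:] [:1:] 2 2 (1/2) 2 (3/2) (-1) 1 (-1/2) HG_Zero HG_One HG_One 1 1 2"
    by (unfold_locales; (simp add: over_def minus_equation_iff field_simps)?; algebra)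
  thus ?thesis
    by (rule covering.attained_free[where T = "{HG_One, HG_Infinity}" and mi = 3 and zi = HG_Infinity
      and qa = "-3/16" and qb = "1/4" and qc = "9/2" and e = "exps (1/2) \<alpha> (\<beta> / 3)"];
        (simp add: over_def power_divide)?; algebra)
qed

text \<open>Here z = (3 x - 1)^3/(9 x - 1) and z - 1 = 27 x^2 (x - 1)/(9 x - 1).\<close>

lemma attained_1212:
  "attained (1/9) ((2 * \<alpha>)^2) (\<alpha>^2) (\<beta>^2) ((2 * \<beta>)^2) (-4/9 + 23/9 * \<alpha>^2 + 23/9 * \<beta>^2)"
proof -
  have "covering [:-1, 3:] [:1:] 3 2 (1/9) 3 (2/9) 0 1 (1/9) HG_One HG_One HG_Infinity 2 1 1"
    by (unfold_locales; (simp add: over_def)?; algebra)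
  thus ?thesis
    by (rule covering.attained_free[where T = "{HG_One, HG_Infinity}" and mi = 2 and zi = HG_Infinity
      and qa = "-4/9" and qb = "23/9" and qc = "23/9" and e = "exps (1/3) \<alpha> \<beta>"];
        (simp add: over_def)?; algebra)
qed

text \<open>Here z = (8 x^2 - 4 x - 1)^2/(8 x + 1) and z - 1 = 64 x^3 (x - 1)/(8 x + 1). As -1/8 =
  t/(t - 1) for t = 1/9, the value of j is that of the previous covering.\<close>

lemma attained_1313:
  "attained (-1/8) ((3 * \<alpha>)^2) (\<alpha>^2) (\<beta>^2) ((3 * \<beta>)^2) (-1/2 + 23/4 * \<alpha>^2 + 23/4 * \<beta>^2)"
proof -
  have "covering [:-1, -4, 8:] [:1:] 2 2 (1/8) 8 (3/8) 0 1 (-1/8) HG_One HG_One HG_Infinity 3 1 1"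
    by (unfold_locales; (simp add: over_def eq_divide_eq)?; algebra)
  thus ?thesis
    by (rule covering.attained_free[where T = "{HG_One, HG_Infinity}" and mi = 3 and zi = HG_Infinity
      and qa = "-1/2" and qb = "23/4" and qc = "23/4" and e = "exps (1/2) \<alpha> \<beta>"];
        (simp add: over_def)?; algebra)
qed

lemma specialization_chebyshev:
  assumes "t \<noteq> 0" "t \<noteq> 1"
    and "entry_k2 t h (35152/9) (1/2, \<alpha>, 2*\<alpha>, \<beta>)
            (5 * 7 * 13 / (2^5 * 3^2) * (4*\<alpha>^2 + 8*\<beta>^2 - 3))
            (- 13 * (\<alpha>^4 - 5/4*\<alpha>^2*\<beta>^2 + 1/16*\<beta>^2))
            (36/13*\<alpha>^4 + 5*\<alpha>^2*\<beta>^2 + 5/13*\<alpha>^2 + 9/52*\<beta>^2)"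
  shows "specialization_of_parametric_pullback t h"
  by (rule specialization_by_k1_k2[OF assms(1,2) _ _ _ attained_chebyshev[of \<alpha> \<beta>] assms(3)];
      (simp add: J1_def jinv_def K1_def K2_def power_divide power_mult_distrib)?;
      (simp add: field_simps power2_eq_square power4_eq_xxxx)?)

lemma specialization_1212:
  assumes "t \<noteq> 0" "t \<noteq> 1"
    and "entry_k2 t h (1556068/81) (\<alpha>, 2*\<alpha>, \<beta>, 2*\<beta>)
            (5 * 7 * 17 * 73 / (2^5 * 3^4) * (23*\<alpha>^2 + 23*\<beta>^2 - 4))
            (73/2 * (\<alpha>^4 - 4*\<alpha>^2*\<beta>^2 + \<beta>^4))
            (324/73 * (\<alpha>^4 + 274/81*\<alpha>^2*\<beta>^2 + \<beta>^4))"
  shows "specialization_of_parametric_pullback t h"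
  by (rule specialization_by_k1_k2[OF assms(1,2) _ _ _ attained_1212[of \<alpha> \<beta>] assms(3)];
      (simp add: J1_def jinv_def K1_def K2_def power_divide power_mult_distrib)?;
      (simp add: field_simps power2_eq_square power4_eq_xxxx)?)

lemma specialization_1313:
  assumes "t \<noteq> 0" "t \<noteq> 1"
    and "entry_k2 t h (1556068/81) (\<alpha>, 3*\<alpha>, \<beta>, 3*\<beta>)
            (5 * 7 * 17 * 73 / (2^4 * 3^4) * (23*\<alpha>^2 + 23*\<beta>^2 - 2))
            (- 73 * (\<alpha>^4 - 10*\<alpha>^2*\<beta>^2 + \<beta>^4))
            (576/73 * (\<alpha>^4 + 185/16*\<alpha>^2*\<beta>^2 + \<beta>^4))"
  shows "specialization_of_parametric_pullback t h"
  by (rule specialization_by_k1_k2[OF assms(1,2) _ _ _ attained_1313[of \<alpha> \<beta>] assms(3)];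
      (simp add: J1_def jinv_def K1_def K2_def power_divide power_mult_distrib)?;
      (simp add: field_simps power2_eq_square power4_eq_xxxx)?)

section \<open>The coverings with one parameter\<close>

text \<open>Degree 5, for hypergeometric exponent differences 1/2, 1/3, \<mu>: a simple point over 0
  gives 1/2, a double point over 1 gives 2/3, and the poles have orders 3 and 2. The constant
  \<kappa> is fixed at infinity, where x phi'/(phi - 1) tends to the pole order 2; here that limit
  is \<kappa> 8/4.\<close>

lemma attained_P25:
  fixes \<mu> :: complex
  shows "attained 5 ((1/2)^2) ((3 * \<mu>)^2) ((2/3)^2) ((2 * \<mu>)^2)
    (-1/4 + 18 * \<mu>^2)"
proof -
  have "covering [:125, -25, 8:] [:5, 4:] 2 3
    (1/3125) (1/3125) 1 0 1 5 HG_Zero HG_Infinity HG_One 1 3 2"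
    by (unfold_locales; (simp add: over_def pderiv_pCons del: mult_cancel_left mult_cancel_right)?; algebra)
  thus ?thesis
    by (rule attained_if_covering[where zi = HG_Infinity and mi = 2]; (simp add: over_def)?; algebra)
qed

lemma specialization_P25:
  assumes "t \<noteq> 0" "t \<noteq> 1"
    and "entry_k2 t h (2^4 * 3^3 * 7^3 / 5^2) (1/2, 2/3, 2*\<alpha>, 3*\<alpha>) (3^5 * 7 / (2^5 * 5^2) * (72*\<alpha>^2 - 1)) (7/3 * (81*\<alpha>^4 - 173/16*\<alpha>^2 + 1/4)) (100/189 * (81*\<alpha>^4 + 121/16*\<alpha>^2 + 1/4))"
  shows "specialization_of_parametric_pullback t h"
  by (rule specialization_by_k1_k2[OF assms(1,2) _ _ _ attained_P25[of \<alpha>] assms(3)];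
      (simp add: J1_def jinv_def K1_def K2_def power_divide power_mult_distrib)?; algebra?)

text \<open>Infinity is a double point over 1. Thus phi - 1 has a zero of order 2 there, and
  \<kappa> 32/5 = -2 is negative.\<close>

lemma attained_P26:
  fixes \<mu> :: complex
  shows "attained (25/16) ((1/3)^2) ((5 * \<mu>)^2) ((\<mu>)^2) ((2/3)^2)
    (7/36 + (-209/16) * \<mu>^2)"
proof -
  have "covering [:40, 60, -105, 32:] [:-8, 5:] 2 3
    (1/1024) (-27/1024) (-5/16) 0 1 (25/16) HG_One HG_Infinity HG_Infinity 1 5 1"
    by (unfold_locales; (simp add: over_def pderiv_pCons del: mult_cancel_left mult_cancel_right)?; algebra)
  thus ?thesis
    by (rule attained_if_covering[where zi = HG_One and mi = 2]; (simp add: over_def)?; algebra)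
qed

lemma specialization_P26:
  assumes "t \<noteq> 0" "t \<noteq> 1"
    and "entry_k2 t h (13^3 * 37^3 / (3^4 * 5^4)) (1/3, 2/3, \<alpha>, 5*\<alpha>) (7 * 13 * 17 * 37 * 41 / (2^7 * 3^6 * 5^4) * (1881*\<alpha>^2 - 28)) (- (481/400) * (25*\<alpha>^4 - 229/9*\<alpha>^2 + 4/81)) (81/481 * (25*\<alpha>^4 + 70549/729*\<alpha>^2 + 4/81))"
  shows "specialization_of_parametric_pullback t h"
  by (rule specialization_by_k1_k2[OF assms(1,2) _ _ _ attained_P26[of \<alpha>] assms(3)];
      (simp add: J1_def jinv_def K1_def K2_def power_divide power_mult_distrib)?; algebra?)

text \<open>Degree 5 with \<open>k1\<close> = 4, so the hypergeometric exponent differences are 1/2,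
  1/4, \<mu>; infinity is the simple point over 1.\<close>

lemma attained_P27:
  fixes \<mu> :: complex
  shows "attained 81 ((1/2)^2) ((2 * \<mu>)^2) ((3 * \<mu>)^2) ((1/4)^2)
    (-581/16 + 742 * \<mu>^2)"
proof -
  have "covering [:-1215, 190, 1:] [:27, 5:] 2 4
    1 1 (-5) 0 1 81 HG_Zero HG_Infinity HG_Infinity 1 2 3"
    by (unfold_locales; (simp add: over_def pderiv_pCons del: mult_cancel_left mult_cancel_right)?; algebra)
  thus ?thesis
    by (rule attained_if_covering[where zi = HG_One and mi = 1]; (simp add: over_def)?; algebra)
qed

lemma specialization_P27:
  assumes "t \<noteq> 0" "t \<noteq> 1"
    and "entry_k2 t h (6481^3 / (3^8 * 5^2)) (1/2, 1/4, 2*\<alpha>, 3*\<alpha>) (7^2 * 23 * 41 * 79 * 6481 / (2^11 * 3^8 * 5^2) * (1696*\<alpha>^2 - 83)) (- (6481/81) * (36*\<alpha>^4 - 643/256*\<alpha>^2 + 1/64)) (6400/6481 * (36*\<alpha>^4 + 52493/20480*\<alpha>^2 + 1/64))"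
  shows "specialization_of_parametric_pullback t h"
  by (rule specialization_by_k1_k2[OF assms(1,2) _ _ _ attained_P27[of \<alpha>] assms(3)];
      (simp add: J1_def jinv_def K1_def K2_def power_divide power_mult_distrib)?; algebra?)

text \<open>Degree 10 with pole orders 4, 1, 5, and exponent differences 1/2, 1/3, \<mu>; t is the
  same as in \<open>attained_P27\<close>.\<close>

lemma attained_P28:
  fixes \<mu> :: complex
  shows "attained 81 ((1/3)^2) ((4 * \<mu>)^2) ((\<mu>)^2) ((5 * \<mu>)^2)
    (-440/9 + 2553 * \<mu>^2)"
proof -
  have "covering [:52488, 218700, -13365, 4455, -135, 1:] [:3240, 945, -90, 1:] 2 3
    (-1/34012224) (-1/34012224) 5 0 1 81 HG_One HG_Infinity HG_Infinity 1 4 1"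
    by (unfold_locales; (simp add: over_def pderiv_pCons del: mult_cancel_left mult_cancel_right)?; algebra)
  thus ?thesis
    by (rule attained_if_covering[where zi = HG_Infinity and mi = 5]; (simp add: over_def)?; algebra)
qed

lemma specialization_P28:
  assumes "t \<noteq> 0" "t \<noteq> 1"
    and "entry_k2 t h (6481^3 / (3^8 * 5^2)) (1/3, \<alpha>, 4*\<alpha>, 5*\<alpha>) (7 * 23 * 41 * 79 * 6481 / (2^7 * 3^10 * 5^2) * (22977*\<alpha>^2 - 440)) (6481/144 * \<alpha>^2 * (691*\<alpha>^2 - 43/9)) (1/6481 * \<alpha>^2 * (2726825*\<alpha>^2 + 166577/9))"
  shows "specialization_of_parametric_pullback t h"
  by (rule specialization_by_k1_k2[OF assms(1,2) _ _ _ attained_P28[of \<alpha>] assms(3)];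
      (simp add: J1_def jinv_def K1_def K2_def power_divide power_mult_distrib)?; algebra?)

lemma attained_P29:
  fixes \<mu> :: complex
  shows "attained (27/2) ((2/3)^2) ((2 * \<mu>)^2) ((\<mu>)^2) ((5 * \<mu>)^2)
    (-32/9 + 270 * \<mu>^2)"
proof -
  have "covering [:216, -224, 156, -24, 1:] [:40, -16, 1:] 2 3
    (-1/3456) (-1/3456) 5 0 1 (27/2) HG_One HG_Infinity HG_Infinity 2 2 1"
    by (unfold_locales; (simp add: over_def pderiv_pCons del: mult_cancel_left mult_cancel_right)?; algebra)
  thus ?thesis
    by (rule attained_if_covering[where zi = HG_Infinity and mi = 5]; (simp add: over_def)?; algebra)
qed

lemma specialization_P29:
  assumes "t \<noteq> 0" "t \<noteq> 1"
    and "entry_k2 t h (2^6 * 7^3 * 97^3 / (3^6 * 5^4)) (2/3, \<alpha>, 2*\<alpha>, 5*\<alpha>) (2^2 * 7 * 13 * 23 * 29 * 97 / (3^8 * 5^4) * (1215*\<alpha>^2 - 16)) (679/9 * \<alpha>^2 * (17*\<alpha>^2 - 404/225)) (20/679 * \<alpha>^2 * (3775*\<alpha>^2 + 3274/9))"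
  shows "specialization_of_parametric_pullback t h"
  by (rule specialization_by_k1_k2[OF assms(1,2) _ _ _ attained_P29[of \<alpha>] assms(3)];
      (simp add: J1_def jinv_def K1_def K2_def power_divide power_mult_distrib)?; algebra?)

lemma attained_P30:
  fixes \<mu> :: complex
  shows "attained 28 ((1/2)^2) ((3 * \<mu>)^2) ((1/3)^2) ((4 * \<mu>)^2)
    (-355/36 + 410 * \<mu>^2)"
proof -
  have "covering [:-21609, 3430, -1568, 64:] [:-147, -112, 16:] 2 3
    (1/88942644) (1/88942644) 1 0 1 28 HG_Zero HG_Infinity HG_One 1 3 1"
    by (unfold_locales; (simp add: over_def pderiv_pCons del: mult_cancel_left mult_cancel_right)?; algebra)
  thus ?thesis
    by (rule attained_if_covering[where zi = HG_Infinity and mi = 4]; (simp add: over_def)?; algebra)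
qed

lemma specialization_P30:
  assumes "t \<noteq> 0" "t \<noteq> 1"
    and "entry_k2 t h (2^4 * 757^3 / (3^6 * 7^2)) (1/2, 1/3, 3*\<alpha>, 4*\<alpha>) (5^2 * 11 * 13 * 29 * 757 / (2^5 * 3^8 * 7^2) * (2952*\<alpha>^2 - 71)) (757/27 * (144*\<alpha>^4 - 715/144*\<alpha>^2 + 1/36)) (784/757 * (144*\<alpha>^4 + 131365/28224*\<alpha>^2 + 1/36))"
  shows "specialization_of_parametric_pullback t h"
  by (rule specialization_by_k1_k2[OF assms(1,2) _ _ _ attained_P30[of \<alpha>] assms(3)];
      (simp add: J1_def jinv_def K1_def K2_def power_divide power_mult_distrib)?; algebra?)

lemma attained_P31:
  fixes \<mu> :: complex
  shows "attained (32/5) ((1/2)^2) ((2/3)^2) ((\<mu>)^2) ((4 * \<mu>)^2)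
    (-323/180 + (389/5) * \<mu>^2)"
proof -
  have "covering [:45, -20, 2:] [:-6, 1:] 2 3
    (-1/135) (-4/135) 2 0 1 (32/5) HG_Zero HG_One HG_Infinity 1 2 1"
    by (unfold_locales; (simp add: over_def pderiv_pCons del: mult_cancel_left mult_cancel_right)?; algebra)
  thus ?thesis
    by (rule attained_if_covering[where zi = HG_Infinity and mi = 4]; (simp add: over_def)?; algebra)
qed

lemma specialization_P31:
  assumes "t \<noteq> 0" "t \<noteq> 1"
    and "entry_k2 t h (7^3 * 127^3 / (2^2 * 3^6 * 5^2)) (1/2, 2/3, \<alpha>, 4*\<alpha>) (7 * 11 * 37 * 59 * 127 / (2^11 * 3^8 * 5^2) * (14004*\<alpha>^2 - 323)) (- (889/216) * (4*\<alpha>^4 - 52/9*\<alpha>^2 + 1/36)) (100/889 * (4*\<alpha>^4 + 970/9*\<alpha>^2 + 1/36))"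
  shows "specialization_of_parametric_pullback t h"
  by (rule specialization_by_k1_k2[OF assms(1,2) _ _ _ attained_P31[of \<alpha>] assms(3)];
      (simp add: J1_def jinv_def K1_def K2_def power_divide power_mult_distrib)?; algebra?)

lemma attained_P32:
  fixes \<mu> :: complex
  shows "attained (32/5) ((1/3)^2) ((5 * \<mu>)^2) ((2 * \<mu>)^2) ((3 * \<mu>)^2)
    (-19/9 + (446/5) * \<mu>^2)"
proof -
  have "covering [:4096, 21120, -6720, 1520, -360, 27:] [:640, 160, -80, 9:] 2 3
    (-1/409600) (-1/409600) 1 0 1 (32/5) HG_One HG_Infinity HG_Infinity 1 5 2"
    by (unfold_locales; (simp add: over_def pderiv_pCons del: mult_cancel_left mult_cancel_right)?; algebra)
  thus ?thesis
    by (rule attained_if_covering[where zi = HG_Infinity and mi = 3]; (simp add: over_def)?; algebra)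
qed

lemma specialization_P32:
  assumes "t \<noteq> 0" "t \<noteq> 1"
    and "entry_k2 t h (7^3 * 127^3 / (2^2 * 3^6 * 5^2)) (1/3, 2*\<alpha>, 3*\<alpha>, 5*\<alpha>) (7 * 11 * 37 * 59 * 127 / (2^9 * 3^8 * 5^2) * (4014*\<alpha>^2 - 95)) (889 * \<alpha>^2 * (\<alpha>^2 - 1/162)) (36/889 * \<alpha>^2 * (8450*\<alpha>^2 + 5641/162))"
  shows "specialization_of_parametric_pullback t h"
  by (rule specialization_by_k1_k2[OF assms(1,2) _ _ _ attained_P32[of \<alpha>] assms(3)];
      (simp add: J1_def jinv_def K1_def K2_def power_divide power_mult_distrib)?; algebra?)

lemma attained_P33:
  fixes \<mu> :: complex
  shows "attained (128/3) ((1/2)^2) ((3 * \<mu>)^2) ((\<mu>)^2) ((5 * \<mu>)^2)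
    (-79/4 + (3145/3) * \<mu>^2)"
proof -
  have "covering [:17280, -2880, 1296, -72, 1:] [:384, 288, -48, 1:] 2 3
    (-1/1327104) (-1/1327104) 5 0 1 (128/3) HG_Zero HG_Infinity HG_Infinity 1 3 1"
    by (unfold_locales; (simp add: over_def pderiv_pCons del: mult_cancel_left mult_cancel_right)?; algebra)
  thus ?thesis
    by (rule attained_if_covering[where zi = HG_Infinity and mi = 5]; (simp add: over_def)?; algebra)
qed

lemma specialization_P33:
  assumes "t \<noteq> 0" "t \<noteq> 1"
    and "entry_k2 t h (7^3 * 2287^3 / (2^6 * 3^2 * 5^6)) (1/2, \<alpha>, 3*\<alpha>, 5*\<alpha>) (7 * 11 * 23 * 61 * 131 * 2287 / (2^15 * 3^2 * 5^6) * (12580*\<alpha>^2 - 237)) (16009/40 * \<alpha>^2 * (23*\<alpha>^2 - 63/100)) (250/16009 * \<alpha>^2 * (15309*\<alpha>^2 + 40709/100))"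
  shows "specialization_of_parametric_pullback t h"
  by (rule specialization_by_k1_k2[OF assms(1,2) _ _ _ attained_P33[of \<alpha>] assms(3)];
      (simp add: J1_def jinv_def K1_def K2_def power_divide power_mult_distrib)?; algebra?)

text \<open>Degree 6 with \<open>k1\<close> = 5: the point 0 is the simple point over 1, and
  five-fold branching occurs over 1 at the root of \<open>f\<close>. The parameter t is that of
  \<open>attained_P33\<close>.\<close>

lemma attained_P34:
  fixes \<mu> :: complex
  shows "attained (128/3) ((1/5)^2) ((3 * \<mu>)^2) ((2 * \<mu>)^2) ((\<mu>)^2)
    (-651/25 + (1258/3) * \<mu>^2)"
proof -
  have "covering [:1024, 2328, -228, 1:] [:24, 1:] 2 5
    (-1/576) (-1/576) 1 0 1 (128/3) HG_One HG_Infinity HG_Infinity 1 3 2"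
    by (unfold_locales; (simp add: over_def pderiv_pCons del: mult_cancel_left mult_cancel_right)?; algebra)
  thus ?thesis
    by (rule attained_if_covering[where zi = HG_Infinity and mi = 1]; (simp add: over_def)?; algebra)
qed

lemma specialization_P34:
  assumes "t \<noteq> 0" "t \<noteq> 1"
    and "entry_k2 t h (7^3 * 2287^3 / (2^6 * 3^2 * 5^6)) (1/5, \<alpha>, 2*\<alpha>, 3*\<alpha>) (7 * 11 * 23 * 61 * 131 * 2287 / (2^13 * 3^2 * 5^8) * (31450*\<alpha>^2 - 1953)) (- (16009/100) * \<alpha>^2 * (7*\<alpha>^2 - 3/100)) (8/16009 * \<alpha>^2 * (88749*\<alpha>^2 + 40621/100))"
  shows "specialization_of_parametric_pullback t h"
  by (rule specialization_by_k1_k2[OF assms(1,2) _ _ _ attained_P34[of \<alpha>] assms(3)];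
      (simp add: J1_def jinv_def K1_def K2_def power_divide power_mult_distrib)?; algebra?)

lemma attained_P35:
  fixes \<mu> :: complex
  shows "attained (81/49) ((1/3)^2) ((7 * \<mu>)^2) ((\<mu>)^2) ((2 * \<mu>)^2)
    (67/441 + (-918/49) * \<mu>^2)"
proof -
  have "covering [:6561, 30618, -44226, 18144, -3591, 686:] [:567, -189, -171, 49:] 2 3
    (1/26040609) (4/26040609) (1/7) 0 1 (81/49) HG_One HG_Infinity HG_Infinity 1 7 1"
    by (unfold_locales; (simp add: over_def pderiv_pCons del: mult_cancel_left mult_cancel_right)?; algebra)
  thus ?thesis
    by (rule attained_if_covering[where zi = HG_Infinity and mi = 2]; (simp add: over_def)?; algebra)
qed

lemma specialization_P35:
  assumes "t \<noteq> 0" "t \<noteq> 1"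
    and "entry_k2 t h (4993^3 / (2^2 * 3^8 * 7^4)) (1/3, \<alpha>, 2*\<alpha>, 7*\<alpha>) (5 * 13 * 17 * 113 * 4993 / (2^9 * 3^10 * 7^4) * (8262*\<alpha>^2 - 67)) (4993/9 * \<alpha>^2 * (\<alpha>^2 - 17/882)) (2/4993 * \<alpha>^2 * (672868*\<alpha>^2 + 64153/9))"
  shows "specialization_of_parametric_pullback t h"
  by (rule specialization_by_k1_k2[OF assms(1,2) _ _ _ attained_P35[of \<alpha>] assms(3)];
      (simp add: J1_def jinv_def K1_def K2_def power_divide power_mult_distrib)?; algebra?)

text \<open>Degree 7, with one singular point over 0, one over 1, and poles of orders 2 and
  5.\<close>

lemma attained_P36:
  fixes \<mu> :: complex
  shows "attained (189/64) ((1/2)^2) ((2 * \<mu>)^2) ((1/3)^2) ((5 * \<mu>)^2)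
    (-635/2304 + (697/32) * \<mu>^2)"
proof -
  have "covering [:-12005, 25725, -18816, 4096:] [:49, -133, 64:] 2 3
    (1/22235661) (64/22235661) (5/64) 0 1 (189/64) HG_Zero HG_Infinity HG_One 1 2 1"
    by (unfold_locales; (simp add: over_def pderiv_pCons del: mult_cancel_left mult_cancel_right)?; algebra)
  thus ?thesis
    by (rule attained_if_covering[where zi = HG_Infinity and mi = 5]; (simp add: over_def)?; algebra)
qed

lemma specialization_P36:
  assumes "t \<noteq> 0" "t \<noteq> 1"
    and "entry_k2 t h (19^3 * 1459^3 / (2^4 * 3^6 * 5^6 * 7^2)) (1/2, 1/3, 2*\<alpha>, 5*\<alpha>) (11 * 19 * 23 * 61 * 157 * 1459 / (2^13 * 3^8 * 5^6 * 7^2) * (50184*\<alpha>^2 - 635)) (27721/8000 * (100*\<alpha>^4 - 1849/324*\<alpha>^2 + 1/36)) (35721/27721 * (100*\<alpha>^4 + 4322681/1285956*\<alpha>^2 + 1/36))"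
  shows "specialization_of_parametric_pullback t h"
  by (rule specialization_by_k1_k2[OF assms(1,2) _ _ _ attained_P36[of \<alpha>] assms(3)];
      (simp add: J1_def jinv_def K1_def K2_def power_divide power_mult_distrib)?; algebra?)

text \<open>The simple points over 0 are the conjugate pair -r, r, which enters the covering only
  through x^2 - 8/9. Both poles, at 1 and at infinity, are double, and so the entry has \<mu> =
  \<alpha>/2.\<close>

lemma attained_P37:
  fixes \<mu> r :: complex
  assumes r: "r^2 = 8/9"
  shows "attained ((1 + r) / (2 * r)) ((1/2)^2) ((1/2)^2) ((2 * \<mu>)^2) ((2 * \<mu>)^2)
    (r * (9/32) + r * (-9/2) * \<mu>^2)"
proof -
  note rr = sqrt_pair_products[OF r]
  have c: "(8/9 :: complex) \<noteq> 0" "(8/9 :: complex) \<noteq> 1" by (simp_all add: field_simps)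
  note nz = sqrt_distinct[OF r c]
  have "covering [:-4, 3:] [:-2, 3:] 2 4
    (-1/16) (-1/144) 2 (-r) r 1 HG_Zero HG_Zero HG_Infinity 1 1 2"
    by (unfold_locales; (simp add: nz over_def pderiv_pCons mult.assoc rr del: mult_cancel_left mult_cancel_right)?; (algebra | use r in algebra))
  thus ?thesis
    by (rule attained_if_covering[where zi = HG_Infinity and mi = 2]; (simp add: nz over_def)?; (algebra | use r in algebra))
qed

lemma specialization_P37:
  assumes "t \<noteq> 0" "t \<noteq> 1"
    and "entry t h (2^3 * 3^3 * 11^3) (1/2, 1/2, \<alpha>, \<alpha>) (3^5 * 7 * 11 / 2^5 * (4*\<alpha>^2 - 1)) (- 33 * (\<alpha>^2 - 1/4)^2)"
  shows "specialization_of_parametric_pullback t h"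
proof -
  \<comment> \<open>Either square root will do, as the other one replaces s by 1 - s.\<close>
  obtain r where r: "r^2 = ((8/9) :: complex)" by (meson power2_csqrt)
  show ?thesis
    by (rule specialization_by_k1_sqrt[OF assms(1,2) r _ _ _ _ _ attained_P37[OF r, of "\<alpha> / 2"] assms(3), where T = "1/32"];
        simp add: field_simps power2_eq_square; algebra?)
qed

lemma attained_P38:
  fixes \<mu> r :: complex
  assumes r: "r^2 = 4/3"
  shows "attained ((1 + r) / (2 * r)) ((1/2)^2) ((1/2)^2) ((3 * \<mu>)^2) ((3 * \<mu>)^2)
    (r * (3/16) + r * (-27/4) * \<mu>^2)"
proof -
  note rr = sqrt_pair_products[OF r]
  have c: "(4/3 :: complex) \<noteq> 0" "(4/3 :: complex) \<noteq> 1" by (simp_all add: field_simps)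
  note nz = sqrt_distinct[OF r c]
  have "covering [:4, -6, 3:] [:0, -4, 3:] 2 3
    (3/64) (1/64) 3 (-r) r 1 HG_Zero HG_Zero HG_Infinity 1 1 3"
    by (unfold_locales; (simp add: nz over_def pderiv_pCons mult.assoc rr del: mult_cancel_left mult_cancel_right)?; (algebra | use r in algebra))
  thus ?thesis
    by (rule attained_if_covering[where zi = HG_Infinity and mi = 3]; (simp add: nz over_def)?; (algebra | use r in algebra))
qed

lemma specialization_P38:
  assumes "t \<noteq> 0" "t \<noteq> 1"
    and "entry t h (2^4 * 3^3 * 5^3) (1/2, 1/2, \<alpha>, \<alpha>) (3^3 * 5 * 11 / 2^4 * (4*\<alpha>^2 - 1)) (15 * (\<alpha>^2 - 1/4)^2)"
  shows "specialization_of_parametric_pullback t h"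
proof -
  obtain r where r: "r^2 = ((4/3) :: complex)" by (meson power2_csqrt)
  show ?thesis
    by (rule specialization_by_k1_sqrt[OF assms(1,2) r _ _ _ _ _ attained_P38[OF r, of "\<alpha> / 3"] assms(3), where T = "-1/16"];
        simp add: field_simps power2_eq_square; algebra?)
qed

lemma attained_P39:
  fixes \<mu> r :: complex
  assumes r: "r^2 = 48/49"
  shows "attained ((1 + r) / (2 * r)) ((1/4)^2) ((1/4)^2) ((3 * \<mu>)^2) ((3 * \<mu>)^2)
    (r * (497/768) + r * (-231/16) * \<mu>^2)"
proof -
  note rr = sqrt_pair_products[OF r]
  have c: "(48/49 :: complex) \<noteq> 0" "(48/49 :: complex) \<noteq> 1" by (simp_all add: field_simps)
  note nz = sqrt_distinct[OF r c]
  have "covering [:160, 84, -588, 343:] [:-6, 7:] 2 4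
    (-1/87808) (-1/1792) (3/49) (-r) r 1 HG_One HG_One HG_Infinity 1 1 3"
    by (unfold_locales; (simp add: nz over_def pderiv_pCons mult.assoc rr del: mult_cancel_left mult_cancel_right)?; (algebra | use r in algebra))
  thus ?thesis
    by (rule attained_if_covering[where zi = HG_Infinity and mi = 3]; (simp add: nz over_def)?; (algebra | use r in algebra))
qed

lemma specialization_P39:
  assumes "t \<noteq> 0" "t \<noteq> 1"
    and "entry t h (2^2 * 193^3 / 3) (1/4, 1/4, \<alpha>, \<alpha>) (7 * 193 * 383 / (2^8 * 3) * (176*\<alpha>^2 - 71)) (- 193 * (\<alpha>^2 - 1/16)^2)"
  shows "specialization_of_parametric_pullback t h"
proof -
  obtain r where r: "r^2 = ((48/49) :: complex)" by (meson power2_csqrt)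
  show ?thesis
    by (rule specialization_by_k1_sqrt[OF assms(1,2) r _ _ _ _ _ attained_P39[OF r, of "\<alpha> / 3"] assms(3), where T = "1/192"];
        simp add: field_simps power2_eq_square; algebra?)
qed

lemma attained_P40:
  fixes \<mu> r :: complex
  assumes r: "r^2 = 27/25"
  shows "attained ((1 + r) / (2 * r)) ((1/3)^2) ((1/3)^2) ((4 * \<mu>)^2) ((4 * \<mu>)^2)
    (r * (115/243) + r * (-560/27) * \<mu>^2)"
proof -
  note rr = sqrt_pair_products[OF r]
  have c: "(27/25 :: complex) \<noteq> 0" "(27/25 :: complex) \<noteq> 1" by (simp_all add: field_simps)
  note nz = sqrt_distinct[OF r c]
  have "covering [:-459, 580, 750, -1500, 625:] [:13, -40, 25:] 2 3
    (1/270000) (1/10800) (4/25) (-r) r 1 HG_One HG_One HG_Infinity 1 1 4"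
    by (unfold_locales; (simp add: nz over_def pderiv_pCons mult.assoc rr del: mult_cancel_left mult_cancel_right)?; (algebra | use r in algebra))
  thus ?thesis
    by (rule attained_if_covering[where zi = HG_Infinity and mi = 4]; (simp add: nz over_def)?; (algebra | use r in algebra))
qed

lemma specialization_P40:
  assumes "t \<noteq> 0" "t \<noteq> 1"
    and "entry t h (2^7 * 53^3 / 3^3) (1/3, 1/3, \<alpha>, \<alpha>) (5 * 53 * 109 / 3^5 * (63*\<alpha>^2 - 23)) (53 * (\<alpha>^2 - 1/9)^2)"
  shows "specialization_of_parametric_pullback t h"
proof -
  obtain r where r: "r^2 = ((27/25) :: complex)" by (meson power2_csqrt)
  show ?thesis
    by (rule specialization_by_k1_sqrt[OF assms(1,2) r _ _ _ _ _ attained_P40[OF r, of "\<alpha> / 4"] assms(3), where T = "-1/54"];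
        simp add: field_simps power2_eq_square; algebra?)
qed

text \<open>Now the conjugate pair consists of double poles; the third pole, at infinity, is simple.
  The single root of \<open>f\<close> accounts for the whole fibre over 1.\<close>

lemma attained_P42:
  fixes \<mu> r :: complex
  assumes r: "r^2 = 4/5"
  shows "attained ((1 + r) / (2 * r)) ((2 * \<mu>)^2) ((2 * \<mu>)^2) ((1/2)^2) ((\<mu>)^2)
    (r * (15/32) + r * (-45/8) * \<mu>^2)"
proof -
  note rr = sqrt_pair_products[OF r]
  have c: "(4/5 :: complex) \<noteq> 0" "(4/5 :: complex) \<noteq> 1" by (simp_all add: field_simps)
  note nz = sqrt_distinct[OF r c]
  have "covering [:-4, 8, 1:] [:-2, 1:] 2 5
    (1/25) (1/25) 1 (-r) r 1 HG_Infinity HG_Infinity HG_Zero 2 2 1"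
    by (unfold_locales; (simp add: nz over_def pderiv_pCons mult.assoc rr del: mult_cancel_left mult_cancel_right)?; (algebra | use r in algebra))
  thus ?thesis
    by (rule attained_if_covering[where zi = HG_Infinity and mi = 1]; (simp add: nz over_def)?; (algebra | use r in algebra))
qed

lemma specialization_P42:
  assumes "t \<noteq> 0" "t \<noteq> 1"
    and "entry t h (2^4 * 17^3) (1/2, \<alpha>, 2*\<alpha>, 2*\<alpha>) (3 * 5 * 17 * 31 / 2^5 * (12*\<alpha>^2 - 1)) (- 51 * \<alpha>^2 * (4*\<alpha>^2 - 1/4))"
  shows "specialization_of_parametric_pullback t h"
proof -
  obtain r where r: "r^2 = ((4/5) :: complex)" by (meson power2_csqrt)
  show ?thesis
    by (rule specialization_by_k1_sqrt[OF assms(1,2) r _ _ _ _ _ attained_P42[OF r, of \<alpha>] assms(3), where T = "1/16"];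
        simp add: field_simps power2_eq_square; algebra?)
qed

text \<open>Degree 12 with all four singular points in the fibre over infinity, with pole orders 1,
  1, 5, 5. The fibres over 0 and 1 consist of six double and four triple points, all regular for
  exponent differences 1/2 and 1/3.\<close>

lemma attained_P43:
  fixes \<mu> r :: complex
  assumes r: "r^2 = 125/121"
  shows "attained ((1 + r) / (2 * r)) ((\<mu>)^2) ((\<mu>)^2) ((5 * \<mu>)^2) ((5 * \<mu>)^2)
    (r * (88/125) + r * (-5104/125) * \<mu>^2)"
proof -
  note rr = sqrt_pair_products[OF r]
  have c: "(125/121 :: complex) \<noteq> 0" "(125/121 :: complex) \<noteq> 1" by (simp_all add: field_simps)
  note nz = sqrt_distinct[OF r c]
  have "covering [:517625, 493878, -4905945, 4977940, 1976535, -4831530, 1771561:] [:-9455, 22660, -1210, -26620, 14641:] 2 3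
    (1/1077562607616) (1/1077562607616) (5/121) (-r) r 1 HG_Infinity HG_Infinity HG_Infinity 1 1 5"
    by (unfold_locales; (simp add: nz over_def pderiv_pCons mult.assoc rr del: mult_cancel_left mult_cancel_right)?; (algebra | use r in algebra))
  thus ?thesis
    by (rule attained_if_covering[where zi = HG_Infinity and mi = 5]; (simp add: nz over_def)?; (algebra | use r in algebra))
qed

lemma specialization_P43:
  assumes "t \<noteq> 0" "t \<noteq> 1"
    and "entry t h (2^14 * 31^3 / 5^3) (\<alpha>, \<alpha>, 5*\<alpha>, 5*\<alpha>) (2^5 * 11 * 31 * 251 / 5^3 * (58*\<alpha>^2 - 1)) (71424 * \<alpha>^4)"
  shows "specialization_of_parametric_pullback t h"
proof -
  obtain r where r: "r^2 = ((125/121) :: complex)" by (meson power2_csqrt)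
  show ?thesis
    by (rule specialization_by_k1_sqrt[OF assms(1,2) r _ _ _ _ _ attained_P43[OF r, of \<alpha>] assms(3), where T = "-1/125"];
        simp add: field_simps power2_eq_square; algebra?)
qed

lemma attained_P44:
  fixes \<mu> r :: complex
  assumes r: "r^2 = -16/9"
  shows "attained ((1 + r) / (2 * r)) ((1/4)^2) ((1/4)^2) ((\<mu>)^2) ((5 * \<mu>)^2)
    (r * (-9/256) + r * (9/16) * \<mu>^2)"
proof -
  note rr = sqrt_pair_products[OF r]
  have c: "(-16/9 :: complex) \<noteq> 0" "(-16/9 :: complex) \<noteq> 1" by (simp_all add: field_simps)
  note nz = sqrt_distinct[OF r c]
  have "covering [:-32, 36, -36, 27:] [:-2, 3:] 2 4
    (-1/768) (-3/256) (5/9) (-r) r 1 HG_One HG_One HG_Infinity 1 1 1"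
    by (unfold_locales; (simp add: nz over_def pderiv_pCons mult.assoc rr del: mult_cancel_left mult_cancel_right)?; (algebra | use r in algebra))
  thus ?thesis
    by (rule attained_if_covering[where zi = HG_Infinity and mi = 5]; (simp add: nz over_def)?; (algebra | use r in algebra))
qed

lemma specialization_P44:
  assumes "t \<noteq> 0" "t \<noteq> 1"
    and "entry t h (2^2 * 3^3 * 13^3 / 5^4) (1/4, 1/4, \<alpha>, 5*\<alpha>) (3^5 * 13 * 17 / (2^8 * 5^4) * (1 - 16*\<alpha>^2)) (39 * (\<alpha>^2 - 1/16) * (\<alpha>^2 - 1/400))"
  shows "specialization_of_parametric_pullback t h"
proof -
  obtain r where r: "r^2 = ((-16/9) :: complex)" by (meson power2_csqrt)
  show ?thesis
    by (rule specialization_by_k1_sqrt[OF assms(1,2) r _ _ _ _ _ attained_P44[OF r, of \<alpha>] assms(3), where T = "-25/64"];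
        simp add: field_simps power2_eq_square; algebra?)
qed

lemma attained_P45:
  fixes \<mu> r :: complex
  assumes r: "r^2 = -4/121"
  shows "attained ((1 + r) / (2 * r)) ((1/2)^2) ((1/2)^2) ((\<mu>)^2) ((5 * \<mu>)^2)
    (r * (55/16) + r * (-979/4) * \<mu>^2)"
proof -
  note rr = sqrt_pair_products[OF r]
  have c: "(-4/121 :: complex) \<noteq> 0" "(-4/121 :: complex) \<noteq> 1" by (simp_all add: field_simps)
  note nz = sqrt_distinct[OF r c]
  have "covering [:76, -198, 121:] [:16, -132, 121:] 2 3
    (-11/1728) (-1/19008) 5 (-r) r 1 HG_Zero HG_Zero HG_Infinity 1 1 1"
    by (unfold_locales; (simp add: nz over_def pderiv_pCons mult.assoc rr del: mult_cancel_left mult_cancel_right)?; (algebra | use r in algebra))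
  thus ?thesis
    by (rule attained_if_covering[where zi = HG_Infinity and mi = 5]; (simp add: nz over_def)?; (algebra | use r in algebra))
qed

lemma specialization_P45:
  assumes "t \<noteq> 0" "t \<noteq> 1"
    and "entry t h (- (2^4 * 109^3 / 5^6)) (1/2, 1/2, \<alpha>, 5*\<alpha>) (11 * 109 * 157 / (2^4 * 5^6) * (5 - 356*\<alpha>^2)) (- (109/5) * (\<alpha>^2 - 1/4) * (\<alpha>^2 - 1/100))"
  shows "specialization_of_parametric_pullback t h"
proof -
  obtain r where r: "r^2 = ((-4/121) :: complex)" by (meson power2_csqrt)
  show ?thesis
    by (rule specialization_by_k1_sqrt[OF assms(1,2) r _ _ _ _ _ attained_P45[OF r, of \<alpha>] assms(3), where T = "-125/16"];
        simp add: field_simps power2_eq_square; algebra?)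
qed

lemma attained_P46:
  fixes \<mu> r :: complex
  assumes r: "r^2 = -4/121"
  shows "attained ((1 + r) / (2 * r)) ((\<mu>)^2) ((\<mu>)^2) ((1/5)^2) ((4 * \<mu>)^2)
    (r * (99/25) + r * (-297/4) * \<mu>^2)"
proof -
  note rr = sqrt_pair_products[OF r]
  have c: "(-4/121 :: complex) \<noteq> 0" "(-4/121 :: complex) \<noteq> 1" by (simp_all add: field_simps)
  note nz = sqrt_distinct[OF r c]
  have "covering [:-112, 11, -1936, 2662:] [:-1, 11:] 2 5
    (1/378125) (4/34375) (2/121) (-r) r 1 HG_Infinity HG_Infinity HG_One 1 1 1"
    by (unfold_locales; (simp add: nz over_def pderiv_pCons mult.assoc rr del: mult_cancel_left mult_cancel_right)?; (algebra | use r in algebra))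
  thus ?thesis
    by (rule attained_if_covering[where zi = HG_Infinity and mi = 4]; (simp add: nz over_def)?; (algebra | use r in algebra))
qed

lemma specialization_P46:
  assumes "t \<noteq> 0" "t \<noteq> 1"
    and "entry t h (- (2^4 * 109^3 / 5^6)) (1/5, \<alpha>, \<alpha>, 4*\<alpha>) (3^2 * 11 * 109 * 157 / (2^2 * 5^8) * (4 - 75*\<alpha>^2)) (327/25 * \<alpha>^2 * (\<alpha>^2 - 1/25))"
  shows "specialization_of_parametric_pullback t h"
proof -
  obtain r where r: "r^2 = ((-4/121) :: complex)" by (meson power2_csqrt)
  show ?thesis
    by (rule specialization_by_k1_sqrt[OF assms(1,2) r _ _ _ _ _ attained_P46[OF r, of \<alpha>] assms(3), where T = "-125/16"];
        simp add: field_simps power2_eq_square; algebra?)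
qed

text \<open>A polynomial covering of degree 4: the three finite singular points lie over 0, 0 and 1,
  and infinity is the only pole.\<close>

lemma attained_P47:
  fixes \<mu> r :: complex
  assumes r: "r^2 = -2/25"
  shows "attained ((1 + r) / (2 * r)) ((1/2)^2) ((1/2)^2) ((1/3)^2) ((4 * \<mu>)^2)
    (r * (55/72) + r * (-40) * \<mu>^2)"
proof -
  note rr = sqrt_pair_products[OF r]
  have c: "(-2/25 :: complex) \<noteq> 0" "(-2/25 :: complex) \<noteq> 1" by (simp_all add: field_simps)
  note nz = sqrt_distinct[OF r c]
  have "covering [:-4, 5:] [:-1, 5:] 2 3
    (25/27) (5/27) 4 (-r) r 1 HG_Zero HG_Zero HG_One 1 1 1"
    by (unfold_locales; (simp add: nz over_def pderiv_pCons mult.assoc rr del: mult_cancel_left mult_cancel_right)?; (algebra | use r in algebra))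
  thus ?thesis
    by (rule attained_if_covering[where zi = HG_Infinity and mi = 4]; (simp add: nz over_def)?; (algebra | use r in algebra))
qed

lemma specialization_P47:
  assumes "t \<noteq> 0" "t \<noteq> 1"
    and "entry t h (- (2^5 * 19^3 / 3^6)) (1/2, 1/2, 1/3, \<alpha>) (5 * 19 * 43 / (2^3 * 3^8) * (11 - 36*\<alpha>^2)) (95/972 * (\<alpha>^2 - 1/4))"
  shows "specialization_of_parametric_pullback t h"
proof -
  obtain r where r: "r^2 = ((-2/25) :: complex)" by (meson power2_csqrt)
  show ?thesis
    by (rule specialization_by_k1_sqrt[OF assms(1,2) r _ _ _ _ _ attained_P47[OF r, of "\<alpha> / 4"] assms(3), where T = "-27/8"];
        simp add: field_simps power2_eq_square; algebra?)
qed

lemma attained_P48: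
  fixes \<mu> r :: complex
  assumes r: "r^2 = -32/49"
  shows "attained ((1 + r) / (2 * r)) ((1/2)^2) ((1/2)^2) ((\<mu>)^2) ((3 * \<mu>)^2)
    (r * (7/128) + r * (-77/32) * \<mu>^2)"
proof -
  note rr = sqrt_pair_products[OF r]
  have c: "(-32/49 :: complex) \<noteq> 0" "(-32/49 :: complex) \<noteq> 1" by (simp_all add: field_simps)
  note nz = sqrt_distinct[OF r c]
  have "covering [:-8, 7:] [:-4, 7:] 2 4
    (-7/256) (-1/1792) 3 (-r) r 1 HG_Zero HG_Zero HG_Infinity 1 1 1"
    by (unfold_locales; (simp add: nz over_def pderiv_pCons mult.assoc rr del: mult_cancel_left mult_cancel_right)?; (algebra | use r in algebra))
  thus ?thesis
    by (rule attained_if_covering[where zi = HG_Infinity and mi = 3]; (simp add: nz over_def)?; (algebra | use r in algebra))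
qed

lemma specialization_P48:
  assumes "t \<noteq> 0" "t \<noteq> 1"
    and "entry t h (2 * 47^3 / 3^8) (1/2, 1/2, \<alpha>, 3*\<alpha>) (7 * 47 * 337 / (2^7 * 3^8) * (44*\<alpha>^2 - 1)) (47/9 * (\<alpha>^2 - 1/4) * (\<alpha>^2 - 1/36))"
  shows "specialization_of_parametric_pullback t h"
proof -
  obtain r where r: "r^2 = ((-32/49) :: complex)" by (meson power2_csqrt)
  show ?thesis
    by (rule specialization_by_k1_sqrt[OF assms(1,2) r _ _ _ _ _ attained_P48[OF r, of \<alpha>] assms(3), where T = "-81/128"];
        simp add: field_simps power2_eq_square; algebra?)
qed

lemma attained_P49:
  fixes \<mu> r :: complex
  assumes r: "r^2 = -32/49"
  shows "attained ((1 + r) / (2 * r)) ((\<mu>)^2) ((\<mu>)^2) ((1/3)^2) ((8 * \<mu>)^2)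
    (r * (-7/144) + r * (399/32) * \<mu>^2)"
proof -
  note rr = sqrt_pair_products[OF r]
  have c: "(-32/49 :: complex) \<noteq> 0" "(-32/49 :: complex) \<noteq> 1" by (simp_all add: field_simps)
  note nz = sqrt_distinct[OF r c]
  have "covering [:-5696, 11767, -34496, 39788, -38416, 33614:] [:-82, 210, -147, 343:] 2 3
    (1/26040609) (4/3720087) (4/49) (-r) r 1 HG_Infinity HG_Infinity HG_One 1 1 1"
    by (unfold_locales; (simp add: nz over_def pderiv_pCons mult.assoc rr del: mult_cancel_left mult_cancel_right)?; (algebra | use r in algebra))
  thus ?thesis
    by (rule attained_if_covering[where zi = HG_Infinity and mi = 8]; (simp add: nz over_def)?; (algebra | use r in algebra))
qed

lemma specialization_P49:
  assumes "t \<noteq> 0" "t \<noteq> 1"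
    and "entry t h (2 * 47^3 / 3^8) (1/3, \<alpha>, \<alpha>, 8*\<alpha>) (7 * 47 * 337 / (2^5 * 3^10) * (2 - 513*\<alpha>^2)) (- (329/9) * \<alpha>^2 * (\<alpha>^2 - 1/9))"
  shows "specialization_of_parametric_pullback t h"
proof -
  obtain r where r: "r^2 = ((-32/49) :: complex)" by (meson power2_csqrt)
  show ?thesis
    by (rule specialization_by_k1_sqrt[OF assms(1,2) r _ _ _ _ _ attained_P49[OF r, of \<alpha>] assms(3), where T = "-81/128"];
        simp add: field_simps power2_eq_square; algebra?)
qed

text \<open>Degree 4 with \<open>k0\<close> = 4: the fibre over 0 is a single fourfold point, for
  hypergeometric exponent differences 1/4, 1/3, \<mu>.\<close>

lemma attained_P50:
  fixes \<mu> r :: complex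
  assumes r: "r^2 = -1/242"
  shows "attained ((1 + r) / (2 * r)) ((\<mu>)^2) ((\<mu>)^2) ((1/3)^2) ((2 * \<mu>)^2)
    (r * (440/9) + r * (-330) * \<mu>^2)"
proof -
  note rr = sqrt_pair_products[OF r]
  have c: "(-1/242 :: complex) \<noteq> 0" "(-1/242 :: complex) \<noteq> 1" by (simp_all add: field_simps)
  note nz = sqrt_distinct[OF r c]
  have "covering [:-2, 11:] [:1, 11:] 4 3
    (1/6534) (1/594) (2/121) (-r) r 1 HG_Infinity HG_Infinity HG_One 1 1 1"
    by (unfold_locales; (simp add: nz over_def pderiv_pCons mult.assoc rr del: mult_cancel_left mult_cancel_right)?; (algebra | use r in algebra))
  thus ?thesis
    by (rule attained_if_covering[where zi = HG_Infinity and mi = 2]; (simp add: nz over_def)?; (algebra | use r in algebra))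
qed

lemma specialization_P50:
  assumes "t \<noteq> 0" "t \<noteq> 1"
    and "entry t h (- (2^6 * 239^3 / 3^10)) (1/3, \<alpha>, \<alpha>, 2*\<alpha>) (2 * 5 * 11 * 239 * 251 / 3^12 * (4 - 27*\<alpha>^2)) (239/81 * \<alpha>^2 * (\<alpha>^2 - 1/9))"
  shows "specialization_of_parametric_pullback t h"
proof -
  obtain r where r: "r^2 = ((-1/242) :: complex)" by (meson power2_csqrt)
  show ?thesis
    by (rule specialization_by_k1_sqrt[OF assms(1,2) r _ _ _ _ _ attained_P50[OF r, of \<alpha>] assms(3), where T = "-243/4"];
        simp add: field_simps power2_eq_square; algebra?)
qed

lemma attained_P56:
  fixes \<mu> r :: complex
  assumes r: "r^2 = -27/169"
  shows "attained ((1 + r) / (2 * r)) ((1/3)^2) ((1/3)^2) ((\<mu>)^2) ((7 * \<mu>)^2)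
    (r * (65/243) + r * (-1105/27) * \<mu>^2)"
proof -
  note rr = sqrt_pair_products[OF r]
  have c: "(-27/169 :: complex) \<noteq> 0" "(-27/169 :: complex) \<noteq> 1" by (simp_all add: field_simps)
  note nz = sqrt_distinct[OF r c]
  have "covering [:2241, -7592, 29406, -52728, 28561:] [:43, -208, 169:] 2 3
    (-1/2875392) (-13/221184) (7/169) (-r) r 1 HG_One HG_One HG_Infinity 1 1 1"
    by (unfold_locales; (simp add: nz over_def pderiv_pCons mult.assoc rr del: mult_cancel_left mult_cancel_right)?; (algebra | use r in algebra))
  thus ?thesis
    by (rule attained_if_covering[where zi = HG_Infinity and mi = 7]; (simp add: nz over_def)?; (algebra | use r in algebra))
qed

lemma specialization_P56:
  assumes "t \<noteq> 0" "t \<noteq> 1"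
    and "entry t h (- (2^11 * 11^3 / (3^3 * 7^4))) (1/3, 1/3, \<alpha>, 7*\<alpha>) (2 * 5 * 11 * 13 * 103 / (3^5 * 7^4) * (1 - 153*\<alpha>^2)) (- 22 * (\<alpha>^2 - 1/9) * (\<alpha>^2 - 1/441))"
  shows "specialization_of_parametric_pullback t h"
proof -
  obtain r where r: "r^2 = ((-27/169) :: complex)" by (meson power2_csqrt)
  show ?thesis
    by (rule specialization_by_k1_sqrt[OF assms(1,2) r _ _ _ _ _ attained_P56[OF r, of \<alpha>] assms(3), where T = "-49/27"];
        simp add: field_simps power2_eq_square; algebra?)
qed

lemma attained_P57:
  fixes \<mu> r :: complex
  assumes r: "r^2 = -343/169"
  shows "attained ((1 + r) / (2 * r)) ((\<mu>)^2) ((\<mu>)^2) ((1/2)^2) ((7 * \<mu>)^2)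
    (r * (-39/1372) + r * (2379/343) * \<mu>^2)"
proof -
  note rr = sqrt_pair_products[OF r]
  have c: "(-343/169 :: complex) \<noteq> 0" "(-343/169 :: complex) \<noteq> 1" by (simp_all add: field_simps)
  note nz = sqrt_distinct[OF r c]
  have "covering [:46305, -19188, 82134, -8788, 28561:] [:-2037, 4095, -1183, 2197:] 2 3
    (-1/736100352) (-1/9569304576) (7/13) (-r) r 1 HG_Infinity HG_Infinity HG_Zero 1 1 1"
    by (unfold_locales; (simp add: nz over_def pderiv_pCons mult.assoc rr del: mult_cancel_left mult_cancel_right)?; (algebra | use r in algebra))
  thus ?thesis
    by (rule attained_if_covering[where zi = HG_Infinity and mi = 7]; (simp add: nz over_def)?; (algebra | use r in algebra))
qed

lemma specialization_P57:
  assumes "t \<noteq> 0" "t \<noteq> 1"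
    and "entry t h (5^3 * 43^3 / (2^6 * 7^3)) (1/2, \<alpha>, \<alpha>, 7*\<alpha>) (3 * 5 * 11 * 13 * 37 * 43 / (2^15 * 7^3) * (1 - 244*\<alpha>^2)) (- (645/8) * \<alpha>^2 * (\<alpha>^2 - 1/4))"
  shows "specialization_of_parametric_pullback t h"
proof -
  obtain r where r: "r^2 = ((-343/169) :: complex)" by (meson power2_csqrt)
  show ?thesis
    by (rule specialization_by_k1_sqrt[OF assms(1,2) r _ _ _ _ _ attained_P57[OF r, of \<alpha>] assms(3), where T = "-128/343"];
        simp add: field_simps power2_eq_square; algebra?)
qed

lemma attained_P58:
  fixes \<mu> r :: complex
  assumes r: "r^2 = -243/1805"
  shows "attained ((1 + r) / (2 * r)) ((\<mu>)^2) ((\<mu>)^2) ((1/2)^2) ((3 * \<mu>)^2)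
    (r * (95/324) + r * (1615/243) * \<mu>^2)"
proof -
  note rr = sqrt_pair_products[OF r]
  have c: "(-243/1805 :: complex) \<noteq> 0" "(-243/1805 :: complex) \<noteq> 1" by (simp_all add: field_simps)
  note nz = sqrt_distinct[OF r c]
  have "covering [:81, 38, 361:] [:-3, 19:] 2 5
    (-1/48640) (-1/924160) (3/19) (-r) r 1 HG_Infinity HG_Infinity HG_Zero 1 1 1"
    by (unfold_locales; (simp add: nz over_def pderiv_pCons mult.assoc rr del: mult_cancel_left mult_cancel_right)?; (algebra | use r in algebra))
  thus ?thesis
    by (rule attained_if_covering[where zi = HG_Infinity and mi = 3]; (simp add: nz over_def)?; (algebra | use r in algebra))
qed

lemma specialization_P58:
  assumes "t \<noteq> 0" "t \<noteq> 1"
    and "entry t h (- (269^3 / (2^10 * 3^5))) (1/2, \<alpha>, \<alpha>, 3*\<alpha>) (5 * 19 * 269 * 499 / (2^19 * 3^5) * (68*\<alpha>^2 + 3)) (269/64 * \<alpha>^2 * (\<alpha>^2 - 1/4))"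
  shows "specialization_of_parametric_pullback t h"
proof -
  obtain r where r: "r^2 = ((-243/1805) :: complex)" by (meson power2_csqrt)
  show ?thesis
    by (rule specialization_by_k1_sqrt[OF assms(1,2) r _ _ _ _ _ attained_P58[OF r, of \<alpha>] assms(3), where T = "-512/243"];
        simp add: field_simps power2_eq_square; algebra?)
qed

text \<open>A polynomial covering of degree 5, with the conjugate pair over 1 and the point 1 over
  0; the pole of order 5 makes \<mu> = \<alpha>/5.\<close>

lemma attained_P59:
  fixes \<mu> r :: complex
  assumes r: "r^2 = -135/121"
  shows "attained ((1 + r) / (2 * r)) ((1/3)^2) ((1/3)^2) ((1/2)^2) ((5 * \<mu>)^2)
    (r * (-187/4860) + r * (110/27) * \<mu>^2)"
proof -
  note rr = sqrt_pair_products[OF r]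
  have c: "(-135/121 :: complex) \<noteq> 0" "(-135/121 :: complex) \<noteq> 1" by (simp_all add: field_simps)
  note nz = sqrt_distinct[OF r c]
  have "covering [:81, -22, 121:] [:-5, 11:] 2 3
    (-11/55296) (-121/55296) (5/11) (-r) r 1 HG_One HG_One HG_Zero 1 1 1"
    by (unfold_locales; (simp add: nz over_def pderiv_pCons mult.assoc rr del: mult_cancel_left mult_cancel_right)?; (algebra | use r in algebra))
  thus ?thesis
    by (rule attained_if_covering[where zi = HG_Infinity and mi = 5]; (simp add: nz over_def)?; (algebra | use r in algebra))
qed

lemma specialization_P59:
  assumes "t \<noteq> 0" "t \<noteq> 1"
    and "entry t h (71^3 / (2^4 * 3^3 * 5)) (1/2, 1/3, 1/3, \<alpha>) (11 * 71 * 167 / (2^13 * 3^5 * 5) * (17 - 72*\<alpha>^2)) (355/2304 * (\<alpha>^2 - 1/9))"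
  shows "specialization_of_parametric_pullback t h"
proof -
  obtain r where r: "r^2 = ((-135/121) :: complex)" by (meson power2_csqrt)
  show ?thesis
    by (rule specialization_by_k1_sqrt[OF assms(1,2) r _ _ _ _ _ attained_P59[OF r, of "\<alpha> / 5"] assms(3), where T = "-64/135"];
        simp add: field_simps power2_eq_square; algebra?)
qed

text \<open>Degree 5 with a pole of order 4 at t and a simple one at infinity. Only I^2 = -1 is
  used, which gives both conjugate entries at once.\<close>

lemma attained_P60:
  fixes \<mu> I :: complex
  assumes I: "I^2 = -1"
  shows "attained (4/5 + 2/5*I) ((1/2)^2) ((1/4)^2) ((4 * \<mu>)^2) ((\<mu>)^2)
    ((9/80 + 1/40*I) + (-27/5 + 4/5*I) * \<mu>^2)"
proof -
  have "covering [:4 + 8*I, -4 - 8*I, 1:] [:2*I, 1:] 2 4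
    (-7/625 + 24/625*I) (-7/625 + 24/625*I) 1 0 1 (4/5 + 2/5*I) HG_Zero HG_One HG_Infinity 1 1 4"
    by (unfold_locales; (simp add: over_def pderiv_pCons del: mult_cancel_left mult_cancel_right)?; use I in algebra)
  thus ?thesis
    by (rule attained_if_covering[where zi = HG_Infinity and mi = 1]; (simp add: over_def)?; use I in algebra)
qed

lemma specialization_P60:
  assumes "t \<noteq> 0" "t \<noteq> 1" and I: "I^2 = -1" and "P60 I t h \<alpha>"
  shows "specialization_of_parametric_pullback t h"
proof -
  have p: "(1 + I)^12 = -64"
    "(3 - 2*I)^3 = -9 - 46*I"
    using I by algebra+
  \<comment> \<open>(2 - I)^2 = 3 - 4 I has the inverse (3 + 4 I)/25.\<close>
  have d: "x / ((2 - I)^2) = x * (3/25 + 4/25*I)" for x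
    by (rule div_eq_mult_if, (unfold p)?, use I in algebra)+
  show ?thesis
    \<comment> \<open>All numbers are in the normal form a + b I: \<open>u\<close> is s (s - 1) for
      s = (4 + 2 I)/5, \<open>v\<close> and \<open>n\<close> are the inverses of u and u + 1, and
      \<open>j'\<close> and \<open>J\<close> are the values of \<open>jinv\<close> and
      \<open>J1\<close> at s.\<close>
    by (rule specialization_by_k1_k2_inverses[OF assms(1,2) attained_P60[OF I, of \<alpha>] assms(4)[unfolded P60_def],
          where u = "-8/25 + 6/25*I" and v = "-2 - 3/2*I" and n = "17/13 - 6/13*I" and j' = "-10048/25 + 11136/25*I" and J = "81/10 - 67/10*I"];
        (unfold d)?; (unfold p)?; (use I in algebra | simp add: add_mset_commute power_divide power_mult_distrib))
qed

text \<open>Degree 7 with a pole of order 6 at 1 and a simple one at t. Infinity is a simple point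
  over 1, whence \<kappa>/14 = -1.\<close>

lemma attained_P61:
  fixes \<mu> w :: complex
  assumes w: "w^2 + w + 1 = 0"
  shows "attained (8/9 + 4/9*w) ((1/2)^2) ((6 * \<mu>)^2) ((\<mu>)^2) ((1/3)^2)
    ((41/324 + 4/81*w) + (-127/9 - 68/9*w) * \<mu>^2)"
proof -
  have "covering [:3 + 2*w, -7, 1 - 4*w, 1:] [:-2 + 4*w, -14 - 14*w, 14:] 2 3
    1 (10/3087 - 17/6174*w) (-14) 0 1 (8/9 + 4/9*w) HG_Zero HG_Infinity HG_Infinity 1 6 1"
    by (unfold_locales; (simp add: over_def pderiv_pCons del: mult_cancel_left mult_cancel_right)?; use w in algebra)
  thus ?thesis
    by (rule attained_if_covering[where zi = HG_One and mi = 1]; (simp add: over_def)?; use w in algebra)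
qed

lemma specialization_P61:
  assumes "t \<noteq> 0" "t \<noteq> 1" and w: "w^2 + w + 1 = 0" and "P61 w t h \<alpha>"
  shows "specialization_of_parametric_pullback t h"
proof -
  have p: "(1 + 2*w)^6 = -27"
    "(3 + 2*w)^2 = 5 + 8*w"
    "(1 - 2*w)^3 = -19 - 18*w"
    "(7 + 6*w)^3 = -197 + 126*w"
    using w by algebra+
  have d: "x / ((1 + 2*w)^6 * (3 + 2*w)^2) = x * (1/441 + 8/1323*w)"
    "x / (2^3 * 3^3 * (2 - w)^2) = x * (1/1323 + 5/10584*w)"
    "x / (4 + 8*w) = x * (-1/12 - 1/6*w)"
    "x / (15 + 19*w) = x * (-4/301 - 19/301*w)"
    "x / (10 + 16*w) = x * (-3/98 - 4/49*w)" for x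
    by (rule div_eq_mult_if, (unfold p)?, use w in algebra)+
  show ?thesis
    by (rule specialization_by_k1_k2_inverses[OF assms(1,2) attained_P61[OF w, of \<alpha>] assms(4)[unfolded P61_def],
          where u = "-8/27 + 4/27*w" and v = "-81/28 - 27/28*w" and n = "405/301 - 108/301*w" and j' = "495808/1323 + 645040/1323*w" and J = "-2003/1764 - 31181/3528*w"];
        (unfold d)?; (unfold p)?; (use w in algebra | simp add: add_mset_commute power_divide power_mult_distrib))
qed

lemma omega_root: "omega^2 + omega + 1 = 0"
proof -
  have polar: "omega = cis (2 * pi / 3)"
    by (simp add: omega_def cis_conv_exp mult_ac)
  have cartesian: "omega = Complex (- 1 / 2) (sqrt 3 / 2)"
    unfolding polar by (simp add: complex_eq_iff cos_120 sin_120)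
  show ?thesis
    unfolding cartesian by (simp add: complex_eq_iff power2_eq_square)
qed

section \<open>Assembly of the entries\<close>

lemma specialization_P25_to_P36:
  assumes "t \<noteq> 0" "t \<noteq> 1" "P25_to_P36 t h \<alpha>"
  shows "specialization_of_parametric_pullback t h"
  using assms(3) unfolding P25_to_P36_def
  by (elim disjE) (erule specialization_P25[OF assms(1,2)]
    specialization_P26[OF assms(1,2)]
    specialization_P27[OF assms(1,2)]
    specialization_P28[OF assms(1,2)]
    specialization_P29[OF assms(1,2)]
    specialization_P30[OF assms(1,2)]
    specialization_P31[OF assms(1,2)]
    specialization_P32[OF assms(1,2)]
    specialization_P33[OF assms(1,2)]
    specialization_P34[OF assms(1,2)]
    specialization_P35[OF assms(1,2)]
    specialization_P36[OF assms(1,2)])+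

lemma specialization_P37_to_P59:
  assumes "t \<noteq> 0" "t \<noteq> 1" "P37_to_P59 t h \<alpha>"
  shows "specialization_of_parametric_pullback t h"
  using assms(3) unfolding P37_to_P59_def
  by (elim disjE) (erule specialization_P37[OF assms(1,2)]
    specialization_P38[OF assms(1,2)]
    specialization_P39[OF assms(1,2)]
    specialization_P40[OF assms(1,2)]
    specialization_P42[OF assms(1,2)]
    specialization_P43[OF assms(1,2)]
    specialization_P44[OF assms(1,2)]
    specialization_P45[OF assms(1,2)]
    specialization_P46[OF assms(1,2)]
    specialization_P47[OF assms(1,2)]
    specialization_P48[OF assms(1,2)]
    specialization_P49[OF assms(1,2)]
    specialization_P50[OF assms(1,2)]
    specialization_P56[OF assms(1,2)]
    specialization_P57[OF assms(1,2)]
    specialization_P58[OF assms(1,2)]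
    specialization_P59[OF assms(1,2)])+

theorem theoremC2:
  fixes t :: complex and h :: heun_params
  assumes "t \<noteq> 0" and "t \<noteq> 1"
    and "(\<comment> \<open>(i)\<close>
          jinv t = 1728 \<and> (\<exists>\<alpha> \<beta> \<gamma>. HE h \<alpha> \<alpha> \<beta> \<gamma> \<and> Q0 t h = 0 \<and>
            k1 t h = 3 * (\<alpha>^2 - \<beta>^2) * (\<alpha>^2 - \<gamma>^2))) \<or>
         (\<comment> \<open>(ii)\<close>
          jinv t = 0 \<and> (\<exists>\<alpha> \<beta>. HE h \<alpha> \<alpha> \<alpha> \<beta>) \<and> Q0 t h = 0) \<or>
         (\<comment> \<open>(iii)\<close>
          \<exists>\<alpha> \<beta>. entry_k2 t h (35152/9) (1/2, \<alpha>, 2*\<alpha>, \<beta>)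
            (5 * 7 * 13 / (2^5 * 3^2) * (4*\<alpha>^2 + 8*\<beta>^2 - 3))
            (- 13 * (\<alpha>^4 - 5/4*\<alpha>^2*\<beta>^2 + 1/16*\<beta>^2))
            (36/13*\<alpha>^4 + 5*\<alpha>^2*\<beta>^2 + 5/13*\<alpha>^2 + 9/52*\<beta>^2)) \<or>
         (\<comment> \<open>(iv)\<close>
          \<exists>\<alpha> \<beta>. entry_k2 t h (1556068/81) (\<alpha>, 2*\<alpha>, \<beta>, 2*\<beta>)
            (5 * 7 * 17 * 73 / (2^5 * 3^4) * (23*\<alpha>^2 + 23*\<beta>^2 - 4))
            (73/2 * (\<alpha>^4 - 4*\<alpha>^2*\<beta>^2 + \<beta>^4))
            (324/73 * (\<alpha>^4 + 274/81*\<alpha>^2*\<beta>^2 + \<beta>^4)) \<or>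
          entry_k2 t h (1556068/81) (\<alpha>, 3*\<alpha>, \<beta>, 3*\<beta>)
            (5 * 7 * 17 * 73 / (2^4 * 3^4) * (23*\<alpha>^2 + 23*\<beta>^2 - 2))
            (- 73 * (\<alpha>^4 - 10*\<alpha>^2*\<beta>^2 + \<beta>^4))
            (576/73 * (\<alpha>^4 + 185/16*\<alpha>^2*\<beta>^2 + \<beta>^4))) \<or>
         (\<comment> \<open>(v)\<close>
          \<exists>\<alpha>. P25_to_P36 t h \<alpha> \<or> P37_to_P59 t h \<alpha>) \<or>
         (\<comment> \<open>(vi)\<close>
          \<exists>\<alpha>. P60 \<i> t h \<alpha> \<or> P60 (- \<i>) t h \<alpha> \<or> P61 omega t h \<alpha> \<or> P61 (- omega - 1) t h \<alpha>)"
  shows "specialization_of_parametric_pullback t h"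
  using assms(3)
proof (elim disjE exE conjE)
  fix \<alpha> \<beta> \<gamma>
  assume "jinv t = 1728" "HE h \<alpha> \<alpha> \<beta> \<gamma>" "Q0 t h = 0" "k1 t h = 3 * (\<alpha>^2 - \<beta>^2) * (\<alpha>^2 - \<gamma>^2)"
  thus ?thesis by (rule specialization_square[OF assms(1,2)])
next
  fix \<alpha> \<beta>
  assume "jinv t = 0" "HE h \<alpha> \<alpha> \<alpha> \<beta>" "Q0 t h = 0"
  thus ?thesis by (rule specialization_cubic[OF assms(1,2)])
next
  \<comment> \<open>\<open>- omega - 1\<close> is the other root of w^2 + w + 1, the complex
    conjugate of \<open>omega\<close>.\<close>
  have conj_root: "(- omega - 1)^2 + (- omega - 1) + 1 = 0"
    using omega_root by algebra
  fix \<alpha>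
  show ?thesis if "P60 \<i> t h \<alpha>" using specialization_P60[OF assms(1,2) _ that] by simp
  show ?thesis if "P60 (- \<i>) t h \<alpha>" using specialization_P60[OF assms(1,2) _ that] by simp
  show ?thesis if "P61 omega t h \<alpha>" by (rule specialization_P61[OF assms(1,2) omega_root that])
  show ?thesis if "P61 (- omega - 1) t h \<alpha>" by (rule specialization_P61[OF assms(1,2) conj_root that])
qed (erule specialization_chebyshev[OF assms(1,2)] specialization_1212[OF assms(1,2)]
      specialization_1313[OF assms(1,2)] specialization_P25_to_P36[OF assms(1,2)]
      specialization_P37_to_P59[OF assms(1,2)])+

end
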